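(* For each fixed mesh (fixed $h>0$), each $\varepsilon\in[0,1]$ and each $f\in\mathcal V'$ there exists a unique $(u_h^\varepsilon,q_h^\varepsilon)\in V_h\times L_h$ such that $$a(u_h^\varepsilon,v_h)+(1-\varepsilon)a_\|(q_h^\varepsilon,v_h)=(f,v_h)\ \ \forall v_h\in V_h,\qquad a_\|(u_h^\varepsilon,w_h)-\varepsilon a_\|(q_h^\varepsilon,w_h)=0\ \ \forall w_h\in L_h ,$$ and it satisfies $$\|u_h^\varepsilon,q_h^\varepsilon\|_{X_{\varepsilon,h}}\le\frac1\beta\|f\|_{\mathcal V'},$$ where $\beta>0$ is the constant, independent of $\varepsilon$ and of the mesh, described in the context. Moreover $$\|u_h^\varepsilon-u_h^0,q_h^\varepsilon-q_h^0\|_{X_{\varepsilon,h}}\to0\quad\text{as }\varepsilon\to0 .$$ Finally, the condition number (in the matrix 2-norm) of the matrix corresponding to this discrete problem is bounded by a constant independent of $\varepsilon\in[0,1]$ (assuming that the same bases of $V_h$ and $L_h$ are chosen for all values of $\varepsilon$).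
   Context: Let $\Omega\subset\mathbb R^d$, $d\in\{2,3\}$, be a domain with regular boundary $\Gamma$ and unit outward normal $n$, and let $b\in(C^\infty(\Omega))^d$ be a smooth vector field with $|b(x)|=1$ for all $x\in\Omega$. Put $\Gamma_D=\{x\in\Gamma: b\cdot n=0\}$, $\Gamma_{in}=\{x\in\Gamma: b\cdot n<0\}$, $\Gamma_{out}=\{x\in\Gamma: b\cdot n>0\}$; $\Gamma_D$ has nonempty relative interior. It is assumed that all field lines (integral curves) of $b$ are open and enter $\Omega$ through $\Gamma_{in}$. For scalar $\phi$, $\nabla_\|\phi:=(b\cdot\nabla\phi)\,b$. Coefficients: $A_\|\in W^{2,\infty}(\Omega)$ (scalar) and $A_\perp\in\mathbb M_{d\times d}(W^{2,\infty}(\Omega))$ satisfy, for constants $0<A_0\le A_1$ and a.a. $x\in\Omega$, $A_0\le A_\|(x)\le A_1$ and $A_0\|v\|^2\le v^tA_\perp(x)v\le A_1\|v\|^2$ for all $v\in\mathbb R^d$ with $v\cdot b(x)=0$. Put $A:=(b\otimes b)A_\|(b\otimes b)+(Id-b\otimes b)A_\perp(Id-b\otimes b)$. Spaces and forms: $\mathcal V=\{v\in H^1(\Omega): v|_{\Gamma_D}=0\}$ with scalar product $a(u,v):=\int_\Omega A\nabla u\cdot\nabla v\,dx$ and norm $|\cdot|_{\mathcal V}$; $\mathcal V'$ is its dual with dual norm, and $(f,v)$ denotes the $L^2$ product or duality pairing. $a_\|(u,v):=\int_\Omega A_\|\nabla_\|u\cdot\nabla_\|v\,dx$, $|u|_\|:=\sqrt{a_\|(u,u)}$.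 $\mathcal L_{in}=\{q\in L^2(\Omega):\nabla_\|q\in L^2(\Omega),\ q|_{\Gamma_{in}}=0\}$. Discretization: $\mathcal T_h$ is a mesh on $\Omega$ of triangles (resp. rectangles) of maximal size $h$, $V_h\subset\mathcal V$ is the finite dimensional space of $\mathbb P_k$ (resp. $\mathbb Q_k$) finite elements on $\mathcal T_h$, $L_h:=V_h\cap\mathcal L_{in}$, $X_h:=V_h\times L_h$. On $L_h$, $|q_h|_{*h}:=\sup_{v_h\in V_h}\frac{a_\|(q_h,v_h)}{|v_h|_{\mathcal V}}$, and $\|u_h,q_h\|_{X_{\varepsilon,h}}:=(|u_h|_{\mathcal V}^2+|q_h|_{*h}^2+\varepsilon|q_h|_\|^2)^{1/2}$. The constant $\beta>0$ is independent of the mesh and of $\varepsilon$ and such that, for all $\varepsilon\in[0,1]$, the form $C_\varepsilon((u,q),(v,w)):=a(u,v)+(1-\varepsilon)a_\|(q,v)+a_\|(u,w)-\varepsilon a_\|(q,w)$ satisfies $\inf_{(u_h,q_h)\in X_h}\sup_{(v_h,w_h)\in X_h}\frac{C_\varepsilon((u_h,q_h),(v_h,w_h))}{\|u_h,q_h\|_{X_{\varepsilon,h}}\|v_h,w_h\|_{X_{\varepsilon,h}}}\ge\beta$ (such a constant exists). The matrix of the discrete problem is the matrix of $C_\varepsilon$ on $V_h\times L_h$ with respect to chosen bases of $V_h$ and $L_h$. *)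

theory Defs
  imports "HOL-Analysis.Analysis" "Jordan_Normal_Form.Matrix"
begin

hide_const (open) Matrix.mat Matrix.row Matrix.col Matrix.vec
no_notation vec_index (infixl "$" 100)
no_notation scalar_prod (infix "\<bullet>" 70)

primrec Ck :: "nat \<Rightarrow> (real^'n) set \<Rightarrow> (real^'n \<Rightarrow> real) \<Rightarrow> bool" where
  "Ck 0 S f = continuous_on S f"
| "Ck (Suc m) S f = ((\<forall>x\<in>S. f differentiable (at x)) \<and>
     (\<forall>i. Ck m S (\<lambda>x. frechet_derivative f (at x) (axis i 1))))"

definition smooth :: "(real^'n) set \<Rightarrow> (real^'n \<Rightarrow> real) \<Rightarrow> bool" where
  "smooth S f \<longleftrightarrow> (\<forall>m. Ck m S f)"

definition lipschitz_boundary :: "(real^'n) set \<Rightarrow> bool" where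
  "lipschitz_boundary \<Omega> \<longleftrightarrow>
     (\<forall>x\<in>frontier \<Omega>. \<exists>e r L g. norm e = 1 \<and> r > 0 \<and> L-lipschitz_on {z. z \<bullet> e = 0} g \<and>
        \<Omega> \<inter> ball x r = {y \<in> ball x r. y \<bullet> e > g (y - (y \<bullet> e) *\<^sub>R e)})"

definition regular_domain :: "(real^'n) set \<Rightarrow> bool" where
  "regular_domain \<Omega> \<longleftrightarrow> open \<Omega> \<and> connected \<Omega> \<and> \<Omega> \<noteq> {} \<and> bounded \<Omega> \<and> lipschitz_boundary \<Omega>"

text \<open>In a Lipschitz domain the following holds precisely at the points where the local graph
  function of the boundary is differentiable, hence almost everywhere on the boundary; it fails
  at the edges and corners of a polyhedron.\<close>

definition outward_normal :: "(real^'n) set \<Rightarrow> real^'n \<Rightarrow> real^'n \<Rightarrow> bool" where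
  "outward_normal \<Omega> x \<nu> \<longleftrightarrow> x \<in> frontier \<Omega> \<and> norm \<nu> = 1 \<and>
     (\<forall>e>0. \<exists>r>0. \<forall>y\<in>ball x r.
        ((y - x) \<bullet> \<nu> < - e * norm (y - x) \<longrightarrow> y \<in> \<Omega>) \<and>
        ((y - x) \<bullet> \<nu> > e * norm (y - x) \<longrightarrow> y \<notin> \<Omega>))"

definition Gamma_D :: "(real^'n) set \<Rightarrow> (real^'n \<Rightarrow> real^'n) \<Rightarrow> (real^'n) set" where
  "Gamma_D \<Omega> b = {x. \<exists>\<nu>. outward_normal \<Omega> x \<nu> \<and> b x \<bullet> \<nu> = 0}"

definition Gamma_in :: "(real^'n) set \<Rightarrow> (real^'n \<Rightarrow> real^'n) \<Rightarrow> (real^'n) set" where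
  "Gamma_in \<Omega> b = {x. \<exists>\<nu>. outward_normal \<Omega> x \<nu> \<and> b x \<bullet> \<nu> < 0}"

definition corners :: "(real^'n) set \<Rightarrow> (real^'n) set" where
  "corners \<Omega> = {x \<in> frontier \<Omega>. \<not> (\<exists>\<nu>. outward_normal \<Omega> x \<nu>)}"

text \<open>Continuity up to the boundary is what gives \<open>b \<cdot> n\<close> a meaning there.\<close>

definition unit_field :: "(real^'n) set \<Rightarrow> (real^'n \<Rightarrow> real^'n) \<Rightarrow> bool" where
  "unit_field \<Omega> b \<longleftrightarrow> (\<forall>i. smooth \<Omega> (\<lambda>x. b x $ i)) \<and> continuous_on (closure \<Omega>) b \<and>
     (\<forall>x\<in>\<Omega>. norm (b x) = 1)"

definition integral_curve ::
    "(real^'n) set \<Rightarrow> (real^'n \<Rightarrow> real^'n) \<Rightarrow> real set \<Rightarrow> (real \<Rightarrow> real^'n) \<Rightarrow> bool" where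
  "integral_curve \<Omega> b I \<gamma> \<longleftrightarrow>
     (\<forall>t\<in>I. \<gamma> t \<in> \<Omega> \<and> (\<gamma> has_vector_derivative b (\<gamma> t)) (at t within I))"

definition field_lines_open :: "(real^'n) set \<Rightarrow> (real^'n \<Rightarrow> real^'n) \<Rightarrow> bool" where
  "field_lines_open \<Omega> b \<longleftrightarrow>
     \<not> (\<exists>\<gamma> T. T > 0 \<and> integral_curve \<Omega> b {0..T} \<gamma> \<and> \<gamma> 0 = \<gamma> T)"

text \<open>The normal, and with it \<open>Gamma_in\<close>, is undefined at corners; a field line may also enter
  through a corner that is a limit of inflow points. When the boundary is of class \<open>C\<^sup>1\<close> there are
  no corners and the entry point lies in \<open>Gamma_in\<close>.\<close>

definition field_lines_enter :: "(real^'n) set \<Rightarrow> (real^'n \<Rightarrow> real^'n) \<Rightarrow> bool" where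
  "field_lines_enter \<Omega> b \<longleftrightarrow>
     (\<forall>x\<in>\<Omega>. \<exists>\<gamma> T. T > 0 \<and> \<gamma> T = x \<and> continuous_on {0..T} \<gamma> \<and>
        \<gamma> 0 \<in> Gamma_in \<Omega> b \<union> (corners \<Omega> \<inter> closure (Gamma_in \<Omega> b)) \<and>
        integral_curve \<Omega> b {0<..T} \<gamma>)"

definition L2 :: "(real^'n) set \<Rightarrow> (real^'n \<Rightarrow> real) set" where
  "L2 \<Omega> = {u \<in> borel_measurable (lebesgue_on \<Omega>). integrable (lebesgue_on \<Omega>) (\<lambda>x. (u x)\<^sup>2)}"

definition Linf :: "(real^'n) set \<Rightarrow> (real^'n \<Rightarrow> real) set" where
  "Linf \<Omega> = {u \<in> borel_measurable (lebesgue_on \<Omega>). \<exists>C. AE x in lebesgue_on \<Omega>. \<bar>u x\<bar> \<le> C}"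

definition test_functions :: "(real^'n) set \<Rightarrow> (real^'n \<Rightarrow> real) set" where
  "test_functions \<Omega> =
     {\<phi>. smooth UNIV \<phi> \<and> compact (closure {x. \<phi> x \<noteq> 0}) \<and> closure {x. \<phi> x \<noteq> 0} \<subseteq> \<Omega>}"

definition divergence :: "(real^'n \<Rightarrow> real^'n) \<Rightarrow> real^'n \<Rightarrow> real" where
  "divergence F x = (\<Sum>i\<in>UNIV. frechet_derivative (\<lambda>y. F y $ i) (at x) (axis i 1))"

text \<open>\<open>g\<close> is the distributional derivative \<open>c \<cdot> \<nabla>u\<close> of \<open>u\<close> along the vector field \<open>c\<close>, smooth
  in \<open>\<Omega>\<close>. For \<open>c\<close> the constant \<open>i\<close>-th coordinate field it is the weak partial derivative.\<close>

definition has_weak_deriv ::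
    "(real^'n) set \<Rightarrow> (real^'n \<Rightarrow> real^'n) \<Rightarrow> (real^'n \<Rightarrow> real) \<Rightarrow> (real^'n \<Rightarrow> real) \<Rightarrow> bool" where
  "has_weak_deriv \<Omega> c u g \<longleftrightarrow>
     (\<forall>\<phi>\<in>test_functions \<Omega>.
        integral\<^sup>L (lebesgue_on \<Omega>) (\<lambda>x. u x * divergence (\<lambda>y. \<phi> y *\<^sub>R c y) x) =
        - integral\<^sup>L (lebesgue_on \<Omega>) (\<lambda>x. g x * \<phi> x))"

definition wderiv ::
    "(real^'n) set \<Rightarrow> (real^'n \<Rightarrow> real^'n) \<Rightarrow> (real^'n \<Rightarrow> real) \<Rightarrow> real^'n \<Rightarrow> real" where
  "wderiv \<Omega> c u = (SOME g. g \<in> L2 \<Omega> \<and> has_weak_deriv \<Omega> c u g)"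

abbreviation coord_field :: "'n \<Rightarrow> real^'n \<Rightarrow> real^'n" where
  "coord_field i \<equiv> (\<lambda>_. axis i 1)"

definition grad :: "(real^'n) set \<Rightarrow> (real^'n \<Rightarrow> real) \<Rightarrow> real^'n \<Rightarrow> real^'n" where
  "grad \<Omega> u x = (\<chi> i. wderiv \<Omega> (coord_field i) u x)"

definition grad_par ::
    "(real^'n) set \<Rightarrow> (real^'n \<Rightarrow> real^'n) \<Rightarrow> (real^'n \<Rightarrow> real) \<Rightarrow> real^'n \<Rightarrow> real^'n" where
  "grad_par \<Omega> b u x = wderiv \<Omega> b u x *\<^sub>R b x"

text \<open>Functions in \<open>L\<^sup>2\<close> whose derivatives along all the fields in \<open>C\<close> are in \<open>L\<^sup>2\<close>. Elements are
  functions rather than equivalence classes; their values outside \<open>\<Omega>\<close> and on null sets are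
  irrelevant.\<close>

definition deriv_space ::
    "(real^'n) set \<Rightarrow> (real^'n \<Rightarrow> real^'n) set \<Rightarrow> (real^'n \<Rightarrow> real) set" where
  "deriv_space \<Omega> C = {u \<in> L2 \<Omega>. \<forall>c\<in>C. \<exists>g\<in>L2 \<Omega>. has_weak_deriv \<Omega> c u g}"

definition H1 :: "(real^'n) set \<Rightarrow> (real^'n \<Rightarrow> real) set" where
  "H1 \<Omega> = deriv_space \<Omega> (range coord_field)"

definition W2inf :: "(real^'n) set \<Rightarrow> (real^'n \<Rightarrow> real) set" where
  "W2inf \<Omega> = {u \<in> Linf \<Omega>. \<forall>i. \<exists>g\<in>Linf \<Omega>. has_weak_deriv \<Omega> (coord_field i) u g \<and>
     (\<forall>j. \<exists>h\<in>Linf \<Omega>. has_weak_deriv \<Omega> (coord_field j) g h)}"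

text \<open>The surface measure is the \<open>(d-1)\<close>-dimensional Hausdorff measure. It comes from a metric outer
  measure, for which all Borel sets are measurable.\<close>

definition hausdorff_pre :: "real \<Rightarrow> (real^'n) set \<Rightarrow> ennreal" where
  "hausdorff_pre \<delta> A =
     (INF U\<in>{U :: nat \<Rightarrow> (real^'n) set. A \<subseteq> (\<Union>i. U i) \<and> (\<forall>i. bounded (U i) \<and> diameter (U i) \<le> \<delta>)}.
        \<Sum>i. ennreal (unit_ball_vol (real (CARD('n) - 1)) * (diameter (U i) / 2) ^ (CARD('n) - 1)))"

definition surface :: "(real^'n) measure" where
  "surface = measure_of UNIV (sets borel) (\<lambda>A. SUP \<delta>\<in>{0<..}. hausdorff_pre \<delta> A)"

definition L2_conv ::
    "(real^'n) measure \<Rightarrow> (nat \<Rightarrow> real^'n \<Rightarrow> real) \<Rightarrow> (real^'n \<Rightarrow> real) \<Rightarrow> bool" where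
  "L2_conv M \<phi> u \<longleftrightarrow> (\<lambda>m. \<integral>\<^sup>+x. ennreal ((\<phi> m x - u x)\<^sup>2) \<partial>M) \<longlonglongrightarrow> 0"

text \<open>\<open>g\<close> is the trace on \<open>S \<subseteq> frontier \<Omega>\<close> of an element \<open>u\<close> of \<open>deriv_space \<Omega> C\<close>: the restriction
  map of smooth functions, extended by continuity with values in \<open>L\<^sup>2\<^sub>l\<^sub>o\<^sub>c S\<close>. For compact \<open>S\<close> this
  is \<open>L\<^sup>2 S\<close>; the local version is needed because traces in \<open>deriv_space \<Omega> {b}\<close> need not be square
  integrable up to the points where \<open>b\<close> becomes tangential.\<close>

definition has_trace ::
    "(real^'n) set \<Rightarrow> (real^'n \<Rightarrow> real^'n) set \<Rightarrow> (real^'n) set \<Rightarrow>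
     (real^'n \<Rightarrow> real) \<Rightarrow> (real^'n \<Rightarrow> real) \<Rightarrow> bool" where
  "has_trace \<Omega> C S u g \<longleftrightarrow> g \<in> borel_measurable borel \<and>
     (\<exists>\<phi>. (\<forall>m. smooth UNIV (\<phi> m)) \<and> L2_conv (lebesgue_on \<Omega>) \<phi> u \<and>
       (\<forall>c\<in>C. L2_conv (lebesgue_on \<Omega>)
          (\<lambda>m x. frechet_derivative (\<phi> m) (at x) (c x)) (wderiv \<Omega> c u)) \<and>
       (\<forall>K. compact K \<and> K \<subseteq> S \<longrightarrow> L2_conv (restrict_space surface K) \<phi> g))"

definition space_V :: "(real^'n) set \<Rightarrow> (real^'n \<Rightarrow> real^'n) \<Rightarrow> (real^'n \<Rightarrow> real) set" where
  "space_V \<Omega> b = {v \<in> H1 \<Omega>. \<exists>g. has_trace \<Omega> (range coord_field) (frontier \<Omega>) v g \<and>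
     (AE x in surface. x \<in> Gamma_D \<Omega> b \<longrightarrow> g x = 0)}"

definition space_Lin :: "(real^'n) set \<Rightarrow> (real^'n \<Rightarrow> real^'n) \<Rightarrow> (real^'n \<Rightarrow> real) set" where
  "space_Lin \<Omega> b = {q \<in> deriv_space \<Omega> {b}. \<exists>g. has_trace \<Omega> {b} (Gamma_in \<Omega> b) q g \<and>
     (AE x in surface. x \<in> Gamma_in \<Omega> b \<longrightarrow> g x = 0)}"

definition coefficients ::
    "(real^'n) set \<Rightarrow> (real^'n \<Rightarrow> real^'n) \<Rightarrow> (real^'n \<Rightarrow> real) \<Rightarrow> (real^'n \<Rightarrow> real^'n^'n) \<Rightarrow>
     real \<Rightarrow> real \<Rightarrow> bool" where
  "coefficients \<Omega> b Apar Aperp A0 A1 \<longleftrightarrow>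
     Apar \<in> W2inf \<Omega> \<and> (\<forall>i j. (\<lambda>x. Aperp x $ i $ j) \<in> W2inf \<Omega>) \<and> 0 < A0 \<and> A0 \<le> A1 \<and>
     (AE x in lebesgue_on \<Omega>. A0 \<le> Apar x \<and> Apar x \<le> A1 \<and>
        (\<forall>v. v \<bullet> b x = 0 \<longrightarrow>
           A0 * (norm v)\<^sup>2 \<le> v \<bullet> (Aperp x *v v) \<and> v \<bullet> (Aperp x *v v) \<le> A1 * (norm v)\<^sup>2))"

definition outer_prod :: "real^'n \<Rightarrow> real^'n \<Rightarrow> real^'n^'n" where
  "outer_prod v w = (\<chi> i j. v $ i * w $ j)"

definition diffusion ::
    "(real^'n \<Rightarrow> real^'n) \<Rightarrow> (real^'n \<Rightarrow> real) \<Rightarrow> (real^'n \<Rightarrow> real^'n^'n) \<Rightarrow> real^'n \<Rightarrow> real^'n^'n"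
  where
  "diffusion b Apar Aperp x =
     (let P = outer_prod (b x) (b x); Id = Finite_Cartesian_Product.mat 1
      in P ** (Apar x *\<^sub>R P) + (Id - P) ** Aperp x ** (Id - P))"

definition form_a ::
    "(real^'n) set \<Rightarrow> (real^'n \<Rightarrow> real^'n) \<Rightarrow> (real^'n \<Rightarrow> real) \<Rightarrow> (real^'n \<Rightarrow> real^'n^'n) \<Rightarrow>
     (real^'n \<Rightarrow> real) \<Rightarrow> (real^'n \<Rightarrow> real) \<Rightarrow> real" where
  "form_a \<Omega> b Apar Aperp u v =
     integral\<^sup>L (lebesgue_on \<Omega>) (\<lambda>x. (diffusion b Apar Aperp x *v grad \<Omega> u x) \<bullet> grad \<Omega> v x)"

definition form_par ::
    "(real^'n) set \<Rightarrow> (real^'n \<Rightarrow> real^'n) \<Rightarrow> (real^'n \<Rightarrow> real) \<Rightarrow>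
     (real^'n \<Rightarrow> real) \<Rightarrow> (real^'n \<Rightarrow> real) \<Rightarrow> real" where
  "form_par \<Omega> b Apar u v =
     integral\<^sup>L (lebesgue_on \<Omega>) (\<lambda>x. Apar x * (grad_par \<Omega> b u x \<bullet> grad_par \<Omega> b v x))"

text \<open>The remaining notions are stated for arbitrary bilinear forms \<open>a\<close> and \<open>ap\<close> in the roles of
  \<open>form_a\<close> and \<open>form_par\<close>.\<close>

type_synonym 'n field = "real^'n \<Rightarrow> real"
type_synonym 'n form = "'n field \<Rightarrow> 'n field \<Rightarrow> real"

definition form_norm :: "'n form \<Rightarrow> 'n field \<Rightarrow> real" where
  "form_norm a u = sqrt (a u u)"

definition in_dual :: "'n field set \<Rightarrow> 'n form \<Rightarrow> ('n field \<Rightarrow> real) \<Rightarrow> bool" where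
  "in_dual V a f \<longleftrightarrow>
     (\<forall>u\<in>V. \<forall>v\<in>V. \<forall>s t. f (\<lambda>x. s * u x + t * v x) = s * f u + t * f v) \<and>
     (\<exists>C. \<forall>v\<in>V. \<bar>f v\<bar> \<le> C * form_norm a v)"

text \<open>In the suprema below \<open>v = 0\<close> is admitted and contributes \<open>0 / 0 = 0\<close>, which does not change
  them unless the space is trivial.\<close>

definition dual_norm :: "'n field set \<Rightarrow> 'n form \<Rightarrow> ('n field \<Rightarrow> real) \<Rightarrow> real" where
  "dual_norm V a f = (SUP v\<in>V. \<bar>f v\<bar> / form_norm a v)"

definition star_norm :: "'n form \<Rightarrow> 'n form \<Rightarrow> 'n field set \<Rightarrow> 'n field \<Rightarrow> real" where
  "star_norm a ap Vh q = (SUP v\<in>Vh. ap q v / form_norm a v)"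

definition X_norm ::
    "'n form \<Rightarrow> 'n form \<Rightarrow> 'n field set \<Rightarrow> real \<Rightarrow> 'n field \<times> 'n field \<Rightarrow> real" where
  "X_norm a ap Vh \<epsilon> = (\<lambda>(u, q).
     sqrt ((form_norm a u)\<^sup>2 + (star_norm a ap Vh q)\<^sup>2 + \<epsilon> * (form_norm ap q)\<^sup>2))"

definition form_C ::
    "'n form \<Rightarrow> 'n form \<Rightarrow> real \<Rightarrow> 'n field \<times> 'n field \<Rightarrow> 'n field \<times> 'n field \<Rightarrow> real" where
  "form_C a ap \<epsilon> = (\<lambda>(u, q) (v, w).
     a u v + (1 - \<epsilon>) * ap q v + ap u w - \<epsilon> * ap q w)"

definition inf_sup ::
    "('n field \<times> 'n field) set \<Rightarrow> ('n field \<times> 'n field \<Rightarrow> real) \<Rightarrow>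
     ('n field \<times> 'n field \<Rightarrow> 'n field \<times> 'n field \<Rightarrow> real) \<Rightarrow> ereal" where
  "inf_sup X nrm B =
     (INF x\<in>X - {(\<lambda>_. 0, \<lambda>_. 0)}. SUP y\<in>X - {(\<lambda>_. 0, \<lambda>_. 0)}. ereal (B x y / (nrm x * nrm y)))"

definition discrete_solution ::
    "'n form \<Rightarrow> 'n form \<Rightarrow> 'n field set \<Rightarrow> 'n field set \<Rightarrow> real \<Rightarrow> ('n field \<Rightarrow> real) \<Rightarrow>
     'n field \<Rightarrow> 'n field \<Rightarrow> bool" where
  "discrete_solution a ap Vh Lh \<epsilon> f u q \<longleftrightarrow> u \<in> Vh \<and> q \<in> Lh \<and>
     (\<forall>v\<in>Vh. a u v + (1 - \<epsilon>) * ap q v = f v) \<and>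
     (\<forall>w\<in>Lh. ap u w - \<epsilon> * ap q w = 0)"

datatype fe_kind = Simplices | Rectangles

text \<open>Rectangles need not be parallel to the coordinate axes.\<close>

fun cell :: "fe_kind \<Rightarrow> (real^'n) set \<Rightarrow> bool" where
  "cell Simplices K = (int CARD('n) simplex K)"
| "cell Rectangles K =
     (\<exists>(R :: real^'n^'n) l u. orthogonal_matrix R \<and> box l u \<noteq> {} \<and> K = (*v) R ` cbox l u)"

definition fe_mesh :: "fe_kind \<Rightarrow> (real^'n) set \<Rightarrow> (real^'n) set set \<Rightarrow> bool" where
  "fe_mesh kind \<Omega> T \<longleftrightarrow> finite T \<and> (\<forall>K\<in>T. cell kind K) \<and> \<Union>T = closure \<Omega> \<and>
     (\<forall>K\<in>T. \<forall>K'\<in>T. (K \<inter> K') face_of K)"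

definition mesh_size :: "(real^'n) set set \<Rightarrow> real" where
  "mesh_size T = Max (diameter ` T)"

definition polys :: "('n \<Rightarrow> nat) set \<Rightarrow> (real^'n \<Rightarrow> real) set" where
  "polys I = {p. \<exists>c. p = (\<lambda>x. \<Sum>\<alpha>\<in>I. c \<alpha> * (\<Prod>i\<in>UNIV. (x $ i) ^ \<alpha> i))}"

definition Pk :: "nat \<Rightarrow> (real^'n \<Rightarrow> real) set" where
  "Pk k = polys {\<alpha>. (\<Sum>i\<in>UNIV. \<alpha> i) \<le> k}"

definition Qk :: "nat \<Rightarrow> (real^'n \<Rightarrow> real) set" where
  "Qk k = polys {\<alpha>. \<forall>i. \<alpha> i \<le> k}"

text \<open>\<open>Qk\<close> refers to the coordinates along the edges of the rectangle. All admissible rotations \<open>R\<close>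
  for a given rectangle differ by a signed permutation of the axes, which preserves \<open>Qk\<close>.\<close>

fun local_fe :: "fe_kind \<Rightarrow> nat \<Rightarrow> (real^'n) set \<Rightarrow> (real^'n \<Rightarrow> real) \<Rightarrow> bool" where
  "local_fe Simplices k K v = (\<exists>p\<in>Pk k. \<forall>x\<in>K. v x = p x)"
| "local_fe Rectangles k K v =
     (\<forall>(R :: real^'n^'n) l u. orthogonal_matrix R \<and> K = (*v) R ` cbox l u \<longrightarrow>
        (\<exists>p\<in>Qk k. \<forall>y\<in>cbox l u. v (R *v y) = p y))"

text \<open>Finite element functions are continuous; they are extended by 0 outside the closed domain so that
  equality in the finite element space is equality of functions.\<close>

definition fe_space ::
    "fe_kind \<Rightarrow> nat \<Rightarrow> (real^'n) set \<Rightarrow> (real^'n \<Rightarrow> real^'n) \<Rightarrow> (real^'n) set set \<Rightarrow> 'n field set" where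
  "fe_space kind k \<Omega> b T =
     {v \<in> space_V \<Omega> b. continuous_on (closure \<Omega>) v \<and> (\<forall>x. x \<notin> closure \<Omega> \<longrightarrow> v x = 0) \<and>
        (\<forall>K\<in>T. local_fe kind k K v)}"

definition is_basis :: "'n field set \<Rightarrow> nat \<Rightarrow> (nat \<Rightarrow> 'n field) \<Rightarrow> bool" where
  "is_basis V N e \<longleftrightarrow> (\<forall>i<N. e i \<in> V) \<and>
     (\<forall>v\<in>V. \<exists>c. v = (\<lambda>x. \<Sum>i<N. c i * e i x)) \<and>
     (\<forall>c. (\<lambda>x. \<Sum>i<N. c i * e i x) = (\<lambda>_. 0) \<longrightarrow> (\<forall>i<N. c i = 0))"

definition product_basis :: "nat \<Rightarrow> (nat \<Rightarrow> 'n field) \<Rightarrow> (nat \<Rightarrow> 'n field) \<Rightarrow> nat \<Rightarrow> 'n field \<times> 'n field"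
  where "product_basis N e l i = (if i < N then (e i, \<lambda>_. 0) else (\<lambda>_. 0, l (i - N)))"

definition system_matrix ::
    "'n form \<Rightarrow> 'n form \<Rightarrow> real \<Rightarrow> nat \<Rightarrow> (nat \<Rightarrow> 'n field) \<Rightarrow> nat \<Rightarrow> (nat \<Rightarrow> 'n field) \<Rightarrow> real mat" where
  "system_matrix a ap \<epsilon> N e M l =
     Matrix.mat (N + M) (N + M)
       (\<lambda>(i, j). form_C a ap \<epsilon> (product_basis N e l j) (product_basis N e l i))"

definition euclid_norm :: "real Matrix.vec \<Rightarrow> real" where
  "euclid_norm v = sqrt (scalar_prod v v)"

definition mat_norm2 :: "real mat \<Rightarrow> real" where
  "mat_norm2 A = (SUP v\<in>carrier_vec (dim_col A). euclid_norm (A *\<^sub>v v) / euclid_norm v)"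

definition inverse_mat :: "real mat \<Rightarrow> real mat" where
  "inverse_mat A = (THE B. inverts_mat A B \<and> inverts_mat B A)"

text \<open>Meaningful for invertible matrices.\<close>

definition cond2 :: "real mat \<Rightarrow> real" where
  "cond2 A = mat_norm2 A * mat_norm2 (inverse_mat A)"

end

theory Submission
  imports Defs "Jordan_Normal_Form.Determinant" "HOL-Library.Function_Algebras"
begin

text \<open>
  The space \<open>V\<^sub>h\<close> is finite dimensional, so the discrete problem is a square linear system; the
  inf-sup condition makes it injective, hence uniquely solvable, and is at the same time the a priori
  estimate. The difference of \<open>(u\<^sub>\<epsilon>, q\<^sub>\<epsilon>)\<close> and \<open>(u\<^sub>0, q\<^sub>0)\<close> solves the problem for \<open>\<epsilon>\<close> with a
  right-hand side of size \<open>(\<epsilon> + \<surd>\<epsilon>) |q\<^sub>0|\<^sub>\<parallel>\<close>, so the same estimate gives convergence. The matrix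
  depends continuously on \<open>\<epsilon>\<close> and is invertible on the compact interval \<open>[0,1]\<close>; by Cramer's rule so
  does its inverse, which bounds the condition number.

  Bilinearity of the forms rests on the uniqueness of weak derivatives, i.e. the fundamental lemma of
  the calculus of variations, and on the fact that functions in \<open>H\<^sup>1\<close> have the weak derivative
  \<open>b \<cdot> \<nabla>u\<close> along the smooth field \<open>b\<close>. The inequality \<open>a\<^sub>\<parallel>(v, v) \<le> a(v, v)\<close> controls the
  right-hand side of the difference problem by the norm of the test function.
\<close>

hide_const (open) Matrix.mat Matrix.row Matrix.col Matrix.vec
no_notation vec_index (infixl "$" 100)
no_notation scalar_prod (infix "\<bullet>" 70)

section \<open>Smooth functions and test functions\<close>

text \<open>\<open>wderiv\<close> is an arbitrary choice, so it is linear only almost everywhere;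
  linearity of the forms has to be recovered under the integral, once integrability is secured.
  Moreover, \<open>b\<close> is smooth only inside \<Omega>, and its derivatives may blow up at the
  boundary, so \<open>b\<close> is differentiated only after multiplication by a test function. The
  hypotheses do not directly say that \<open>form_norm a\<close> is definite or that
  \<open>a\<close> is symmetric: \<open>Aperp\<close> is elliptic on vectors orthogonal to
  \<open>b\<close> and need not be symmetric. Definiteness of the mesh norm is therefore read off
  the inf-sup condition: for a nonzero pair of norm 0 every quotient would be a division by 0, hence
  0, contradicting \<beta> > 0. Cauchy-Schwarz is applied to \<open>ap\<close>, which is symmetric
  and nonnegative, and is carried over to \<open>form_norm a\<close> by comparing the forms. The
  rate has two sources: against \<open>v\<close> the full \<epsilon> survives, while against
  \<open>w\<close> a factor sqrt \<epsilon> is spent on the parallel norm of \<open>w\<close>, which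
  carries the weight \<epsilon> in the squared norm.\<close>

lemma frechet_eqI:
  assumes "(f has_derivative f') (at x)"
  shows "frechet_derivative f (at x) = f'"
  using frechet_derivative_at[OF assms] by simp

lemma frechet_derivative_has: "f differentiable (at x) \<Longrightarrow> (f has_derivative frechet_derivative f (at x)) (at x)"
  using frechet_derivative_works by blast

section \<open>Calculus of \<open>Ck\<close> functions\<close>

lemma Ck_SucD:
  assumes "Ck (Suc m) S f"
  shows "x \<in> S \<Longrightarrow> (f has_derivative frechet_derivative f (at x)) (at x)"
    and "Ck m S (\<lambda>x. frechet_derivative f (at x) (axis i 1))"
  using assms unfolding Ck.simps by (simp_all add: frechet_derivative_has)

lemma Ck_Suc_imp_Ck: "Ck (Suc m) S f \<Longrightarrow> Ck m S f"
proof (induction m arbitrary: f)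
  case 0
  then have "\<forall>x\<in>S. f differentiable (at x)" by simp
  then have "continuous_on S f"
    by (meson continuous_at_imp_continuous_on differentiable_imp_continuous_within)
  then show ?case by (metis Ck.simps(1))
next
  case (Suc m)
  then show ?case by (metis Ck.simps(2))
qed

lemma Ck_imp_continuous_on: "Ck m S f \<Longrightarrow> continuous_on S f"
proof (induction m)
  case (Suc m)
  then show ?case using Ck_Suc_imp_Ck by blast
qed simp

text \<open>\<open>Ck\<close> is defined through \<open>frechet_derivative\<close> at the points of
  \<open>S\<close>; since \<open>S\<close> is open, this derivative sees only the values of the
  function on \<open>S\<close>.\<close>

lemma Ck_cong:
  assumes "open S" "\<And>x. x \<in> S \<Longrightarrow> f x = g x" "Ck m S f"
  shows "Ck m S g"
  using assms(2,3)
proof (induction m arbitrary: f g)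
  case 0
  then show ?case by (metis Ck.simps(1) continuous_on_cong)
next
  case (Suc m)
  have d: "(g has_derivative frechet_derivative f (at x)) (at x)" if "x \<in> S" for x
    by (rule has_derivative_transform_within_open[OF Ck_SucD(1)[OF Suc.prems(2) that] assms(1) that])
       (rule Suc.prems(1))
  have e: "frechet_derivative g (at x) = frechet_derivative f (at x)" if "x \<in> S" for x
    using frechet_eqI[OF d[OF that]] .
  have "Ck m S (\<lambda>x. frechet_derivative g (at x) (axis i 1))" for i
    by (rule Suc.IH[of "\<lambda>x. frechet_derivative f (at x) (axis i 1)"]) (simp_all add: e Ck_SucD(2)[OF Suc.prems(2)])
  moreover have "g differentiable (at x)" if "x \<in> S" for x
    using d[OF that] differentiable_def by blast
  ultimately show ?case by simp
qed

text \<open>Lets an explicit derivative replace \<open>frechet_derivative\<close>, so that sum,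
  product and chain rule can be fed into inductions on the order.\<close>

lemma Ck_SucI:
  assumes "open S" "\<And>x. x \<in> S \<Longrightarrow> (f has_derivative f' x) (at x)"
    "\<And>i. Ck m S (\<lambda>x. f' x (axis i 1))"
  shows "Ck (Suc m) S f"
proof -
  have e: "frechet_derivative f (at x) = f' x" if "x \<in> S" for x
    using frechet_eqI[OF assms(2)[OF that]] .
  have "Ck m S (\<lambda>x. frechet_derivative f (at x) (axis i 1))" for i
    by (rule Ck_cong[OF assms(1) _ assms(3)[of i]]) (simp add: e)
  then show ?thesis using assms(2) by (auto simp: differentiable_def)
qed

lemma Ck_const: "open S \<Longrightarrow> Ck m S (\<lambda>x. c)"
proof (induction m arbitrary: c)
  case (Suc m)
  then show ?case by simp
qed simp

lemma Ck_add:
  assumes "open S" "Ck m S f" "Ck m S g"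
  shows "Ck m S (\<lambda>x. f x + g x)"
  using assms(2,3)
proof (induction m arbitrary: f g)
  case 0
  then show ?case by (auto intro: continuous_intros)
next
  case (Suc m)
  show ?case
    by (rule Ck_SucI[OF assms(1), where f' = "\<lambda>x h. frechet_derivative f (at x) h + frechet_derivative g (at x) h"])
       (intro has_derivative_add Suc.IH Suc.prems[THEN Ck_SucD(1)] Suc.prems[THEN Ck_SucD(2)] | assumption)+
qed

lemma Ck_mult:
  assumes "open S" "Ck m S f" "Ck m S g"
  shows "Ck m S (\<lambda>x. f x * g x)"
  using assms(2,3)
proof (induction m arbitrary: f g)
  case 0
  then show ?case by (auto intro: continuous_intros)
next
  case (Suc m)
  \<comment> \<open>The product rule leaves one factor undifferentiated, so both factors are also
    needed at order \<open>m\<close>.\<close>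
  have "Ck m S f" "Ck m S g" using Suc.prems by (blast intro: Ck_Suc_imp_Ck)+
  then show ?case
    by (intro Ck_SucI[OF assms(1), where f' = "\<lambda>x h. f x * frechet_derivative g (at x) h + frechet_derivative f (at x) h * g x"])
       (intro has_derivative_mult Ck_add Suc.IH assms(1) Suc.prems[THEN Ck_SucD(1)] Suc.prems[THEN Ck_SucD(2)] | assumption)+
qed

lemma Ck_prod:
  assumes "open S" "finite I" "\<And>i. i \<in> I \<Longrightarrow> Ck m S (f i)"
  shows "Ck m S (\<lambda>x. \<Prod>i\<in>I. f i x)"
  using assms(2,3) by (induction I) (auto intro: Ck_const Ck_mult assms(1))

text \<open>Regularity is local. This later glues a product with a cutoff, smooth on \<Omega>, to 0
  away from the support.\<close>

lemma Ck_Un: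
  assumes "open S" "open U" "Ck m S f" "Ck m U f"
  shows "Ck m (S \<union> U) f"
  using assms(3,4)
proof (induction m arbitrary: f)
  case 0
  then show ?case using assms(1,2) by (simp add: continuous_on_open_Un)
qed auto

lemma Ck_subset: "Ck m S f \<Longrightarrow> U \<subseteq> S \<Longrightarrow> Ck m U f"
proof (induction m arbitrary: f)
  case 0
  then show ?case by (auto intro: continuous_on_subset)
next
  case (Suc m)
  then show ?case by (simp add: subset_iff)
qed

text \<open>The family is closed under differentiation up to linear combinations, also at 0.\<close>

definition flat :: "nat \<Rightarrow> real \<Rightarrow> real" where
  "flat k t = (if t > 0 then exp (- 1 / t) / t ^ k else 0)"

text \<open>On the right, s = 1/t turns \<open>flat k t\<close> into s^k / exp s with s tending to
  infinity; on the left the function is 0.\<close>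

lemma flat_tendsto_0: "(flat k \<longlongrightarrow> 0) (at 0)"
proof -
  have "((\<lambda>t. (1/t) ^ k / exp (1/t)) \<longlongrightarrow> 0) (at_right (0::real))"
    by (rule filterlim_compose[OF tendsto_power_div_exp_0])
       (simp add: filterlim_inverse_at_top_right divide_inverse)
  then have "(flat k \<longlongrightarrow> 0) (at_right 0)"
    by (rule Lim_transform_eventually)
       (auto simp: eventually_at_filter flat_def exp_minus field_simps power_divide)
  moreover have "(flat k \<longlongrightarrow> 0) (at_left 0)"
    by (rule tendsto_eventually) (auto simp: eventually_at_filter flat_def)
  ultimately show ?thesis by (simp add: filterlim_split_at_real)
qed

lemma flat_has_derivative:
  "(flat k has_real_derivative flat (k + 2) t - real k * flat (k + 1) t) (at t)"
proof -
  consider "t > 0" | "t < 0" | "t = 0" by linarith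
  then show ?thesis
  proof cases
    case 1
    have "((\<lambda>t. exp (- 1 / t) / t ^ k) has_real_derivative flat (k + 2) t - real k * flat (k + 1) t) (at t)"
      using 1 by (auto intro!: derivative_eq_intros simp: flat_def field_simps power2_eq_square)
         (cases k; simp add: field_simps)
    then show ?thesis
      by (rule has_field_derivative_transform_within_open[where S = "{0<..}"]) (use 1 in \<open>auto simp: flat_def\<close>)
  next
    case 2
    have "((\<lambda>t. 0) has_real_derivative 0) (at t)" by simp
    then have "(flat k has_real_derivative 0) (at t)"
      by (rule has_field_derivative_transform_within_open[where S = "{..<0}"]) (use 2 in \<open>auto simp: flat_def\<close>)
    then show ?thesis using 2 by (simp add: flat_def)
  next
    case 3
    \<comment> \<open>At 0 the difference quotient of \<open>flat k\<close> is
      \<open>flat (k + 1)\<close>, whose limit is known.\<close>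
    have "((\<lambda>h. flat (k + 1) h) \<longlongrightarrow> 0) (at 0)" by (rule flat_tendsto_0)
    then have "((\<lambda>h. (flat k (0 + h) - flat k 0) / h) \<longlongrightarrow> 0) (at 0)"
      by (rule Lim_transform_eventually) (auto simp: eventually_at_filter flat_def)
    then show ?thesis using 3 by (simp add: DERIV_def flat_def)
  qed
qed

lemma Ck_flat: "Ck m UNIV (\<lambda>x::real^'n. flat k (\<alpha> * x $ i + \<gamma>))"
proof (induction m arbitrary: k)
  case 0
  have "continuous_on UNIV (flat k)"
    by (intro continuous_at_imp_continuous_on ballI DERIV_isCont[OF flat_has_derivative])
  then have "continuous_on UNIV (\<lambda>x::real^'n. flat k (\<alpha> * x $ i + \<gamma>))"
    by (rule continuous_on_compose2) (auto intro!: continuous_intros)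
  then show ?case by simp
next
  case (Suc m)
  let ?g = "\<lambda>x::real^'n. \<alpha> * x $ i + \<gamma>"
  let ?d = "\<lambda>x h::real^'n. (flat (k + 2) (?g x) - real k * flat (k + 1) (?g x)) * (\<alpha> * h $ i)"
  show ?case
  proof (rule Ck_SucI[where f' = ?d])
    fix x
    have "bounded_linear (\<lambda>h::real^'n. \<alpha> * h $ i)"
      by (intro bounded_linear_const_mult bounded_linear_vec_nth)
    then have "(?g has_derivative (\<lambda>h. \<alpha> * h $ i)) (at x)"
      by (intro has_derivative_add_const bounded_linear_imp_has_derivative)
    from DERIV_compose_FDERIV[OF flat_has_derivative[of k "?g x"] this]
    show "((\<lambda>x. flat k (?g x)) has_derivative ?d x) (at x)"
      by (simp only: mult.commute)
  next
    fix j
    have "Ck m UNIV (\<lambda>x::real^'n. (flat (k + 2) (?g x) + (- real k) * flat (k + 1) (?g x)) * (\<alpha> * axis j 1 $ i))"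
      by (intro Ck_mult Ck_add Ck_const Suc open_UNIV)
    then show "Ck m UNIV (\<lambda>x. ?d x (axis j 1))" by simp
  qed auto
qed

text \<open>For growing \<open>m\<close> the factors exp(-1/(m t)) with t > 0 increase to 1 while
  the support stays in the same box. These smooth functions between 0 and 1 thus approximate the
  indicator of the open box pointwise and take the place of mollifiers.\<close>

definition bump :: "real^'n \<Rightarrow> real^'n \<Rightarrow> nat \<Rightarrow> real^'n \<Rightarrow> real" where
  "bump l u m x = (\<Prod>i\<in>UNIV. flat 0 (real m * (x $ i - l $ i)) * flat 0 (real m * (u $ i - x $ i)))"

lemma smooth_bump: "smooth UNIV (bump l u m :: real^'n \<Rightarrow> real)"
proof -
  have "Ck r UNIV (\<lambda>x::real^'n. \<Prod>i\<in>UNIV. flat 0 (real m * x $ i + (- real m * l $ i)) * flat 0 ((- real m) * x $ i + real m * u $ i))" for r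
    by (intro Ck_prod Ck_mult Ck_flat open_UNIV finite_class.finite_UNIV)
  moreover have "bump l u m = (\<lambda>x::real^'n. \<Prod>i\<in>UNIV. flat 0 (real m * x $ i + (- real m * l $ i)) * flat 0 ((- real m) * x $ i + real m * u $ i))"
    by (auto simp: bump_def algebra_simps)
  ultimately show ?thesis by (simp add: smooth_def)
qed

lemma flat_bounds: "0 \<le> flat 0 t" "flat 0 t \<le> 1"
  by (auto simp: flat_def)

lemma bump_bounds: "0 \<le> bump l u m x" "bump l u m x \<le> 1"
  by (auto simp: bump_def intro!: prod_nonneg prod_le_1 flat_bounds mult_le_one mult_nonneg_nonneg)

lemma bump_outside: "x \<notin> box l u \<Longrightarrow> bump l u m x = 0"
proof -
  assume "x \<notin> box l u"
  then obtain i where "x $ i \<le> l $ i \<or> u $ i \<le> x $ i"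
    by (auto simp: mem_box_cart not_less)
  then have "flat 0 (real m * (x $ i - l $ i)) * flat 0 (real m * (u $ i - x $ i)) = 0"
    by (auto simp: flat_def mult_less_0_iff zero_less_mult_iff)
  then show ?thesis unfolding bump_def by (intro prod_zero) auto
qed

lemma flat_scaled_tendsto_1:
  assumes "t > 0" shows "(\<lambda>m. flat 0 (real m * t)) \<longlonglongrightarrow> 1"
proof -
  have "(\<lambda>m. exp (- (inverse (real m) * inverse t))) \<longlonglongrightarrow> exp (- (0 * inverse t))"
    by (intro tendsto_intros lim_inverse_n)
  then have "(\<lambda>m. exp (- (inverse (real m) * inverse t))) \<longlonglongrightarrow> 1" by simp
  \<comment> \<open>The two sequences agree from m = 1 on: at m = 0 the argument of
    \<open>flat\<close> is 0 and so is its value, while the exponential is 1.\<close>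
  then show ?thesis
    by (rule Lim_transform_eventually)
       (use assms in \<open>auto simp: flat_def divide_inverse eventually_sequentially intro!: exI[of _ 1]\<close>)
qed

lemma bump_tendsto: "(\<lambda>m. bump l u m x) \<longlonglongrightarrow> indicator (box l u) x"
proof (cases "x \<in> box l u")
  case True
  then have "(\<lambda>m. bump l u m x) \<longlonglongrightarrow> (\<Prod>i\<in>(UNIV::'a set). 1 * 1)"
    unfolding bump_def
    by (intro tendsto_prod tendsto_mult flat_scaled_tendsto_1) (auto simp: mem_box_cart)
  then show ?thesis using True by simp
qed (simp add: bump_outside)

lemma bump_test_function:
  assumes "cbox l u \<subseteq> \<Omega>"
  shows "bump l u m \<in> test_functions \<Omega>"
proof -
  have "{x. bump l u m x \<noteq> 0} \<subseteq> cbox l u"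
    using bump_outside box_subset_cbox by blast
  then have "closure {x. bump l u m x \<noteq> 0} \<subseteq> cbox l u"
    by (intro closure_minimal) auto
  moreover from this have "compact (closure {x. bump l u m x \<noteq> 0})"
    by (meson bounded_cbox bounded_subset closed_closure compact_eq_bounded_closed)
  ultimately show ?thesis using assms smooth_bump by (auto simp: test_functions_def)
qed

text \<open>\<open>f\<close> may misbehave at the boundary of \<Omega>. The product is still smooth
  everywhere: it is smooth on \<Omega> and 0 off the closed support of \<phi>, and these two open
  sets cover the space.\<close>

lemma test_functions_mult:
  assumes "open \<Omega>" and \<phi>: "\<phi> \<in> test_functions \<Omega>" and f: "smooth \<Omega> f"
  shows "(\<lambda>x. \<phi> x * f x) \<in> test_functions \<Omega>"
proof -
  let ?K = "closure {x. \<phi> x \<noteq> 0}"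
  have K: "compact ?K" "?K \<subseteq> \<Omega>" "\<And>m. Ck m UNIV \<phi>"
    using \<phi> by (auto simp: test_functions_def smooth_def)
  have "Ck m UNIV (\<lambda>x. \<phi> x * f x)" for m
  proof -
    have "Ck m \<Omega> (\<lambda>x. \<phi> x * f x)"
      using assms K(3) f by (auto intro: Ck_mult Ck_subset simp: smooth_def)
    moreover have "Ck m (- ?K) (\<lambda>x. \<phi> x * f x)"
      by (rule Ck_cong[OF _ _ Ck_const[of _ m 0]])
         (use closure_subset[of "{x. \<phi> x \<noteq> 0}"] in \<open>auto simp: open_Compl\<close>)
    ultimately have "Ck m (\<Omega> \<union> - ?K) (\<lambda>x. \<phi> x * f x)"
      by (intro Ck_Un assms) (auto simp: open_Compl)
    moreover have "\<Omega> \<union> - ?K = UNIV" using K by auto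
    ultimately show ?thesis by simp
  qed
  moreover have "closure {x. \<phi> x * f x \<noteq> 0} \<subseteq> ?K" by (rule closure_mono) auto
  moreover from this have "compact (closure {x. \<phi> x * f x \<noteq> 0})"
    using K(1) by (meson bounded_subset closed_closure compact_eq_bounded_closed)
  ultimately show ?thesis using K(2) by (auto simp: test_functions_def smooth_def)
qed

lemma test_functions_deriv:
  assumes \<phi>: "\<phi> \<in> test_functions \<Omega>"
  shows "(\<lambda>x. frechet_derivative \<phi> (at x) (axis i 1)) \<in> test_functions \<Omega>"
proof -
  let ?K = "closure {x. \<phi> x \<noteq> 0}" and ?d = "\<lambda>x. frechet_derivative \<phi> (at x) (axis i 1)"
  have K: "compact ?K" "?K \<subseteq> \<Omega>" "\<And>m. Ck (Suc m) UNIV \<phi>"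
    using \<phi> by (auto simp: test_functions_def smooth_def simp del: Ck.simps)
  have "?d x = 0" if "x \<notin> ?K" for x
  proof -
    have "((\<lambda>x. 0) has_derivative (\<lambda>h. 0)) (at x)" by simp
    then have "(\<phi> has_derivative (\<lambda>h. 0)) (at x)"
      by (rule has_derivative_transform_within_open[where s = "- ?K"])
         (use that closure_subset[of "{x. \<phi> x \<noteq> 0}"] in \<open>auto simp: open_Compl\<close>)
    then show ?thesis by (simp add: frechet_eqI)
  qed
  then have "closure {x. ?d x \<noteq> 0} \<subseteq> ?K" by (intro closure_minimal) auto
  moreover from this have "compact (closure {x. ?d x \<noteq> 0})"
    using K(1) by (meson bounded_subset closed_closure compact_eq_bounded_closed)
  moreover have "Ck m UNIV ?d" for m using K(3)[of m] by simp
  ultimately show ?thesis using K(2) by (auto simp: test_functions_def smooth_def)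
qed

lemma test_functions_continuous: "\<phi> \<in> test_functions \<Omega> \<Longrightarrow> continuous_on UNIV \<phi>"
  by (auto simp: test_functions_def smooth_def intro: Ck_imp_continuous_on)

lemma test_functions_bounded:
  assumes \<phi>: "\<phi> \<in> test_functions \<Omega>"
  obtains C where "\<And>x. \<bar>\<phi> x\<bar> \<le> C"
proof -
  let ?K = "closure {x. \<phi> x \<noteq> 0}"
  have "compact (\<phi> ` ?K)"
    using \<phi> test_functions_continuous[OF \<phi>]
    by (auto simp: test_functions_def intro!: compact_continuous_image intro: continuous_on_subset)
  then obtain C where C: "\<And>x. x \<in> ?K \<Longrightarrow> \<bar>\<phi> x\<bar> \<le> C"
    by (metis bounded_real compact_imp_bounded image_eqI)
  \<comment> \<open>\<open>C\<close> may be negative when the support is empty.\<close>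
  have "\<bar>\<phi> x\<bar> \<le> max C 0" for x
  proof (cases "x \<in> ?K")
    case False
    then have "\<phi> x = 0" using closure_subset[of "{x. \<phi> x \<noteq> 0}"] by auto
    then show ?thesis by simp
  qed (use C in \<open>simp add: le_max_iff_disj\<close>)
  then show ?thesis using that by blast
qed

section \<open>The fundamental lemma of the calculus of variations\<close>

text \<open>Countability allows almost-everywhere statements on the single boxes to be
  combined.\<close>

lemma open_countable_Union_boxes:
  fixes \<Omega> :: "(real^'n) set"
  assumes "open \<Omega>"
  obtains \<D> where "countable \<D>" "\<And>X. X \<in> \<D> \<Longrightarrow> \<exists>l u. X = box l u \<and> cbox l u \<subseteq> \<Omega>" "\<Omega> \<subseteq> \<Union>\<D>"
proof -
  define F where "F = {box l u | l u :: real^'n. cbox l u \<subseteq> \<Omega>}"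
  have "\<exists>X\<in>F. x \<in> X" if x: "x \<in> \<Omega>" for x
  proof -
    obtain l u where "cbox l u \<subseteq> \<Omega>" "x \<in> box l u"
      by (rule open_contains_cbox[OF assms x])
    then show ?thesis by (auto simp: F_def)
  qed
  then have cover: "\<Omega> \<subseteq> \<Union>F" by blast
  obtain F' where "F' \<subseteq> F" "countable F'" "\<Union>F' = \<Union>F"
    by (rule Lindelof[of F]) (auto simp: F_def)
  then show ?thesis using cover by (intro that[of F']) (auto simp: F_def)
qed

lemma integrable_imp_set_integrable:
  fixes f :: "'a \<Rightarrow> real"
  shows "integrable M f \<Longrightarrow> A \<in> sets M \<Longrightarrow> set_integrable M A f"
  unfolding set_integrable_def by (rule integrable_mult_indicator)

text \<open>Dynkin's argument: open boxes form an intersection-stable generator of the Borel sets.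
  Everything is cut down to one fixed box, on which the total integral is 0, so that passing to
  complements preserves the property.\<close>

lemma set_integral_borel_in_box_eq_0:
  fixes G :: "real^'n \<Rightarrow> real"
  assumes G: "integrable lebesgue G"
    and zero: "\<And>l u. cbox l u \<subseteq> cbox a b \<Longrightarrow> set_lebesgue_integral lebesgue (box l u) G = 0"
    and A: "A \<in> sets borel"
  shows "set_lebesgue_integral lebesgue (A \<inter> box a b) G = 0"
proof -
  let ?E = "range (\<lambda>(l, u). box l u) :: (real^'n) set set"
  have SI: "set_integrable lebesgue S G" if "S \<in> sets lebesgue" for S
    using G that by (rule integrable_imp_set_integrable)
  have leb: "S \<in> sets lebesgue" if "S \<in> sigma_sets UNIV ?E" for S :: "(real^'n) set"
    using that by (simp add: borel_eq_box)
  have "Int_stable ?E" by (auto simp: Int_stable_def box_Int_box)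
  moreover have "?E \<subseteq> Pow UNIV" by simp
  moreover have "A \<in> sigma_sets UNIV ?E" using A by (simp add: borel_eq_box)
  ultimately show ?thesis
  proof (induction A rule: sigma_sets_induct_disjoint)
    case (basic A)
    then obtain l u where "A = box l u" by auto
    then obtain c d where cd: "A \<inter> box a b = box c d" by (auto simp: box_Int_box)
    show ?case
    proof (cases "box c d = {}")
      case False
      \<comment> \<open>\<open>zero\<close> asks for containment of closed boxes; the closure of a
        nonempty open box is the closed one.\<close>
      have "closure (box c d) \<subseteq> closure (box a b)"
        by (metis cd closure_mono inf_le2)
      then have "cbox c d \<subseteq> cbox a b" using False cd
        by (metis closure_box inf_bot_right)
      then show ?thesis using zero cd by simp
    qed (simp add: cd set_lebesgue_integral_def)
  next
    case empty
    show ?case by (simp add: set_lebesgue_integral_def)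
  next
    case (compl A)
    have *: "A \<inter> box a b \<in> sets lebesgue" "(box a b - A) \<in> sets lebesgue"
      using leb[OF compl(1)] by (simp_all add: sets.Int sets.Diff)
    have "set_lebesgue_integral lebesgue ((A \<inter> box a b) \<union> (box a b - A)) G =
      set_lebesgue_integral lebesgue (A \<inter> box a b) G + set_lebesgue_integral lebesgue (box a b - A) G"
      by (intro set_integral_Un SI *) auto
    moreover have "(A \<inter> box a b) \<union> (box a b - A) = box a b" by auto
    moreover have "(UNIV - A) \<inter> box a b = box a b - A" by auto
    ultimately show ?case using zero[of a b] compl(2) by simp
  next
    case (union A)
    have "A i \<in> sets lebesgue" for i
      by (rule leb) (use union(2) in auto)
    then have *: "A i \<inter> box a b \<in> sets lebesgue" for i
      by (intro sets.Int) auto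
    have "set_lebesgue_integral lebesgue (\<Union>i. A i \<inter> box a b) G = (\<Sum>i. set_lebesgue_integral lebesgue (A i \<inter> box a b) G)"
    proof (rule lebesgue_integral_countable_add[OF *])
      show "(A i \<inter> box a b) \<inter> (A j \<inter> box a b) = {}" if "i \<noteq> j" for i j
        using union(1) that by (auto simp: disjoint_family_on_def)
      show "set_integrable lebesgue (\<Union>i. A i \<inter> box a b) G"
        using * by (intro SI sets.countable_UN') auto
    qed
    moreover have "(\<Union>i. A i) \<inter> box a b = (\<Union>i. A i \<inter> box a b)" by auto
    ultimately show ?case by (simp only: union(3) suminf_zero)
  qed
qed

text \<open>A function whose integral over every measurable set is 0 vanishes almost everywhere. The
  integrals vanish on boxes, hence on Borel sets inside a box, hence on Lebesgue sets inside a
  box.\<close>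

lemma AE_zero_if_integral_boxes_zero:
  fixes G :: "real^'n \<Rightarrow> real"
  assumes G: "integrable lebesgue G" and \<Omega>: "open \<Omega>"
    and zero: "\<And>l u. cbox l u \<subseteq> \<Omega> \<Longrightarrow> set_lebesgue_integral lebesgue (box l u) G = 0"
  shows "AE x in lebesgue. x \<in> \<Omega> \<longrightarrow> G x = 0"
proof -
  have box: "AE x in lebesgue. x \<in> box a b \<longrightarrow> G x = 0" if ab: "cbox a b \<subseteq> \<Omega>" for a b
  proof -
    let ?G = "\<lambda>x. indicator (box a b) x *\<^sub>R G x"
    have int: "integrable lebesgue ?G"
      using G by (intro integrable_mult_indicator) auto
    have "set_lebesgue_integral lebesgue A ?G = set_lebesgue_integral lebesgue A (\<lambda>x. 0)" if A: "A \<in> sets lebesgue" for A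
    proof -
      \<comment> \<open>Up to a null set \<open>A\<close> is an F-sigma set, in particular a Borel
        set.\<close>
      obtain C T where CT: "fsigma C" "T \<in> null_sets lebesgue" "C \<union> T = A"
        using lebesgue_set_almost_fsigma[OF A] by blast
      have C: "C \<in> sets borel"
        using CT(1) by (induction rule: fsigma.induct) (auto intro!: borel_closed)
      have "set_lebesgue_integral lebesgue A ?G = set_lebesgue_integral lebesgue (A \<inter> box a b) G"
        by (simp add: set_lebesgue_integral_def indicator_inter_arith mult.assoc)
      also have "\<dots> = set_lebesgue_integral lebesgue (C \<inter> box a b) G"
      proof (rule set_integral_cong_set)
        have "set_integrable lebesgue (A \<inter> box a b) G" "set_integrable lebesgue (C \<inter> box a b) G"
          using A C by (auto intro!: integrable_imp_set_integrable[OF G])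
        then show "set_borel_measurable lebesgue (A \<inter> box a b) G" "set_borel_measurable lebesgue (C \<inter> box a b) G"
          unfolding set_borel_measurable_def set_integrable_def by (auto intro: borel_measurable_integrable)
        show "AE x in lebesgue. (x \<in> C \<inter> box a b) = (x \<in> A \<inter> box a b)"
          using AE_not_in[OF CT(2)] by eventually_elim (use CT(3) in auto)
      qed
      also have "\<dots> = 0"
        using ab by (intro set_integral_borel_in_box_eq_0[OF G _ C] zero) blast
      finally show ?thesis by simp
    qed
    then have "AE x in lebesgue. ?G x = 0"
      by (intro density_unique_real int) auto
    then show ?thesis by eventually_elim (auto simp: indicator_def split: if_splits)
  qed
  obtain \<D> where \<D>: "countable \<D>" "\<And>X. X \<in> \<D> \<Longrightarrow> \<exists>l u. X = box l u \<and> cbox l u \<subseteq> \<Omega>" "\<Omega> \<subseteq> \<Union>\<D>"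
    using open_countable_Union_boxes[OF \<Omega>] by metis
  have "AE x in lebesgue. \<forall>X\<in>\<D>. x \<in> X \<longrightarrow> G x = 0"
    using \<D>(2) box by (subst AE_ball_countable[OF \<D>(1)]) metis
  then show ?thesis by eventually_elim (use \<D>(3) in blast)
qed

section \<open>Weak derivatives and traces\<close>

text \<open>The nonnegative integrals may be infinite, so the triangle inequality is replaced by (p
  + q)^2 \<le> 2 p^2 + 2 q^2 under the integral.\<close>

lemma L2_conv_lin:
  assumes "\<And>m. \<phi> m \<in> borel_measurable M" "u \<in> borel_measurable M" "L2_conv M \<phi> u"
    and "\<And>m. \<psi> m \<in> borel_measurable M" "v \<in> borel_measurable M" "L2_conv M \<psi> v"
  shows "L2_conv M (\<lambda>m x. s * \<phi> m x + t * \<psi> m x) (\<lambda>x. s * u x + t * v x)"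
  unfolding L2_conv_def
proof (rule tendsto_sandwich[OF _ _ tendsto_const])
  note [measurable] = assms(1,2,4,5)
  let ?A = "\<lambda>m. \<integral>\<^sup>+x. ennreal ((\<phi> m x - u x)\<^sup>2) \<partial>M" and ?B = "\<lambda>m. \<integral>\<^sup>+x. ennreal ((\<psi> m x - v x)\<^sup>2) \<partial>M"
  show "\<forall>\<^sub>F m in sequentially. 0 \<le> (\<integral>\<^sup>+x. ennreal ((s * \<phi> m x + t * \<psi> m x - (s * u x + t * v x))\<^sup>2) \<partial>M)"
    by simp
  have "(\<integral>\<^sup>+x. ennreal ((s * \<phi> m x + t * \<psi> m x - (s * u x + t * v x))\<^sup>2) \<partial>M)
      \<le> ennreal (2 * s\<^sup>2) * ?A m + ennreal (2 * t\<^sup>2) * ?B m" for m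
  proof -
    have "ennreal ((s * \<phi> m x + t * \<psi> m x - (s * u x + t * v x))\<^sup>2)
        \<le> ennreal (2 * s\<^sup>2) * ennreal ((\<phi> m x - u x)\<^sup>2) + ennreal (2 * t\<^sup>2) * ennreal ((\<psi> m x - v x)\<^sup>2)" for x
    proof -
      have "(p + q)\<^sup>2 \<le> 2 * p\<^sup>2 + 2 * q\<^sup>2" for p q :: real
        using zero_le_power2[of "p - q"] by (simp add: power2_eq_square algebra_simps)
      from this[of "s * (\<phi> m x - u x)" "t * (\<psi> m x - v x)"]
      have "(s * \<phi> m x + t * \<psi> m x - (s * u x + t * v x))\<^sup>2
        \<le> (2 * s\<^sup>2) * (\<phi> m x - u x)\<^sup>2 + (2 * t\<^sup>2) * (\<psi> m x - v x)\<^sup>2"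
      proof -
        assume a: "(s * (\<phi> m x - u x) + t * (\<psi> m x - v x))\<^sup>2 \<le> 2 * (s * (\<phi> m x - u x))\<^sup>2 + 2 * (t * (\<psi> m x - v x))\<^sup>2"
        have e: "s * \<phi> m x + t * \<psi> m x - (s * u x + t * v x) = s * (\<phi> m x - u x) + t * (\<psi> m x - v x)"
          by (simp add: algebra_simps)
        show ?thesis using a unfolding e by (simp only: power_mult_distrib mult.assoc)
      qed
      then show ?thesis
        by (simp add: ennreal_mult[symmetric] ennreal_plus[symmetric] ennreal_leI del: ennreal_plus)
    qed
    then have "(\<integral>\<^sup>+x. ennreal ((s * \<phi> m x + t * \<psi> m x - (s * u x + t * v x))\<^sup>2) \<partial>M)
      \<le> (\<integral>\<^sup>+x. ennreal (2 * s\<^sup>2) * ennreal ((\<phi> m x - u x)\<^sup>2) + ennreal (2 * t\<^sup>2) * ennreal ((\<psi> m x - v x)\<^sup>2) \<partial>M)"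
      by (intro nn_integral_mono)
    also have "\<dots> = ennreal (2 * s\<^sup>2) * ?A m + ennreal (2 * t\<^sup>2) * ?B m"
      by (subst nn_integral_add; (subst nn_integral_cmult)?; measurable)
         (subst nn_integral_cmult; measurable)+
    finally show ?thesis .
  qed
  then show "\<forall>\<^sub>F m in sequentially. (\<integral>\<^sup>+x. ennreal ((s * \<phi> m x + t * \<psi> m x - (s * u x + t * v x))\<^sup>2) \<partial>M)
      \<le> ennreal (2 * s\<^sup>2) * ?A m + ennreal (2 * t\<^sup>2) * ?B m"
    by simp
  have "(\<lambda>m. ennreal (2 * s\<^sup>2) * ?A m + ennreal (2 * t\<^sup>2) * ?B m) \<longlonglongrightarrow> ennreal (2 * s\<^sup>2) * 0 + ennreal (2 * t\<^sup>2) * 0"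
    using assms(3,6) unfolding L2_conv_def by (intro tendsto_add ennreal_tendsto_cmult) auto
  then show "(\<lambda>m. ennreal (2 * s\<^sup>2) * ?A m + ennreal (2 * t\<^sup>2) * ?B m) \<longlonglongrightarrow> 0"
    by simp
qed

lemma L2_conv_cong_AE:
  assumes "L2_conv M \<phi> u" "AE x in M. u x = v x"
  shows "L2_conv M \<phi> v"
proof -
  have "(\<integral>\<^sup>+x. ennreal ((\<phi> m x - v x)\<^sup>2) \<partial>M) = (\<integral>\<^sup>+x. ennreal ((\<phi> m x - u x)\<^sup>2) \<partial>M)" for m
    by (rule nn_integral_cong_AE) (use assms(2) in eventually_elim, simp)
  then show ?thesis using assms(1) by (simp add: L2_conv_def)
qed

lemma smooth_lin:
  assumes "smooth UNIV \<phi>" "smooth UNIV \<psi>"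
  shows "smooth UNIV (\<lambda>x. s * \<phi> x + t * \<psi> x)"
  using assms unfolding smooth_def by (intro allI Ck_add Ck_mult Ck_const) auto

lemma smooth_has_derivative:
  assumes "smooth UNIV \<phi>"
  shows "(\<phi> has_derivative frechet_derivative \<phi> (at x)) (at x)"
  using assms unfolding smooth_def by (blast intro: Ck_SucD(1))

lemma frechet_derivative_lin:
  assumes "smooth UNIV \<phi>" "smooth UNIV \<psi>"
  shows "frechet_derivative (\<lambda>x. s * \<phi> x + t * \<psi> x) (at x) h =
    s * frechet_derivative \<phi> (at x) h + t * frechet_derivative \<psi> (at x) h"
proof -
  have "((\<lambda>x. s * \<phi> x + t * \<psi> x) has_derivative
      (\<lambda>h. s * frechet_derivative \<phi> (at x) h + t * frechet_derivative \<psi> (at x) h)) (at x)"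
    by (intro has_derivative_add has_derivative_mult_right smooth_has_derivative assms)
  then show ?thesis by (simp add: frechet_eqI)
qed

text \<open>Reduces measurability of the derivative along a variable field to that of the partial
  derivatives, which are continuous.\<close>

lemma frechet_derivative_expand:
  assumes "smooth UNIV \<phi>"
  shows "frechet_derivative \<phi> (at x) h = (\<Sum>i\<in>UNIV. h $ i * frechet_derivative \<phi> (at x) (axis i 1))"
proof -
  have lin: "linear (frechet_derivative \<phi> (at x))"
    using smooth_has_derivative[OF assms] has_derivative_linear by blast
  have "h = (\<Sum>i\<in>UNIV. h $ i *\<^sub>R axis i 1)"
    using basis_expansion[of h] by (simp add: scalar_mult_eq_scaleR)
  then have "frechet_derivative \<phi> (at x) h = frechet_derivative \<phi> (at x) (\<Sum>i\<in>UNIV. h $ i *\<^sub>R axis i 1)"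
    by simp
  also have "\<dots> = (\<Sum>i\<in>UNIV. h $ i * frechet_derivative \<phi> (at x) (axis i 1))"
    by (simp add: linear_sum[OF lin] linear_cmul[OF lin])
  finally show ?thesis .
qed

section \<open>Square integrable and essentially bounded functions on a bounded open set\<close>

locale bounded_open =
  fixes \<Omega> :: "(real^'n) set"
  assumes open_\<Omega>: "open \<Omega>" and bounded_\<Omega>: "bounded \<Omega>"
begin

abbreviation M where "M \<equiv> lebesgue_on \<Omega>"

lemma \<Omega>_sets: "\<Omega> \<in> sets lebesgue"
  using open_\<Omega> by (simp add: borel_open)

lemma finite_measure_M: "finite_measure M"
proof
  have "\<Omega> \<in> lmeasurable"
    using bounded_set_imp_lmeasurable[OF bounded_\<Omega> \<Omega>_sets] .
  then show "emeasure M (space M) \<noteq> \<infinity>"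
    using \<Omega>_sets by (simp add: emeasure_restrict_space fmeasurable_def)
qed

lemma AE_M: "AE x in M. P x" if "\<And>x. x \<in> \<Omega> \<Longrightarrow> P x"
  using that by (intro AE_I2) simp

lemma continuous_on_measurable: "continuous_on \<Omega> f \<Longrightarrow> f \<in> borel_measurable M" for f :: "real^'n \<Rightarrow> real"
  using continuous_imp_measurable_on_sets_lebesgue \<Omega>_sets by blast

lemma L2_measurable: "u \<in> L2 \<Omega> \<Longrightarrow> u \<in> borel_measurable M"
  by (simp add: L2_def)

lemma Linf_measurable: "u \<in> Linf \<Omega> \<Longrightarrow> u \<in> borel_measurable M"
  by (simp add: Linf_def)

lemma L2_lin:
  assumes "u \<in> L2 \<Omega>" "v \<in> L2 \<Omega>"
  shows "(\<lambda>x. s * u x + t * v x) \<in> L2 \<Omega>"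
proof -
  have [measurable]: "u \<in> borel_measurable M" "v \<in> borel_measurable M"
    using assms by (auto dest: L2_measurable)
  have "integrable M (\<lambda>x. (s * u x + t * v x)\<^sup>2)"
  proof (rule Bochner_Integration.integrable_bound)
    show "integrable M (\<lambda>x. (2 * s\<^sup>2) * (u x)\<^sup>2 + (2 * t\<^sup>2) * (v x)\<^sup>2)"
      using assms by (intro Bochner_Integration.integrable_add integrable_mult_right) (auto simp: L2_def)
    show "(\<lambda>x. (s * u x + t * v x)\<^sup>2) \<in> borel_measurable M" by measurable
    have "(p + q)\<^sup>2 \<le> 2 * p\<^sup>2 + 2 * q\<^sup>2" for p q :: real
      using zero_le_power2[of "p - q"] by (simp add: power2_eq_square algebra_simps)
    from this[of "s * u _" "t * v _"]
    show "AE x in M. norm ((s * u x + t * v x)\<^sup>2) \<le> norm ((2 * s\<^sup>2) * (u x)\<^sup>2 + (2 * t\<^sup>2) * (v x)\<^sup>2)"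
      by (auto simp: power_mult_distrib mult.assoc)
  qed
  then show ?thesis by (simp add: L2_def)
qed

lemma L2_mult_integrable:
  assumes "u \<in> L2 \<Omega>" "v \<in> L2 \<Omega>"
  shows "integrable M (\<lambda>x. u x * v x)"
proof (rule Bochner_Integration.integrable_bound)
  have [measurable]: "u \<in> borel_measurable M" "v \<in> borel_measurable M"
    using assms by (auto dest: L2_measurable)
  show "integrable M (\<lambda>x. (u x)\<^sup>2 + (v x)\<^sup>2)"
    using assms by (intro Bochner_Integration.integrable_add) (auto simp: L2_def)
  show "(\<lambda>x. u x * v x) \<in> borel_measurable M" by measurable
  have "\<bar>p * q\<bar> \<le> p\<^sup>2 + q\<^sup>2" for p q :: real
  proof -
    have "2 * (\<bar>p\<bar> * \<bar>q\<bar>) \<le> p\<^sup>2 + q\<^sup>2"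
      using zero_le_power2[of "\<bar>p\<bar> - \<bar>q\<bar>"] by (simp add: power2_diff)
    then show ?thesis by (simp add: abs_mult) (smt (verit) mult_nonneg_nonneg abs_ge_zero)
  qed
  then show "AE x in M. norm (u x * v x) \<le> norm ((u x)\<^sup>2 + (v x)\<^sup>2)" by auto
qed

lemma Linf_const: "(\<lambda>x. c) \<in> Linf \<Omega>"
  by (auto simp: Linf_def intro!: exI[of _ "\<bar>c\<bar>"])

lemma Linf_add:
  assumes "f \<in> Linf \<Omega>" "g \<in> Linf \<Omega>"
  shows "(\<lambda>x. f x + g x) \<in> Linf \<Omega>"
proof -
  obtain C D where "AE x in M. \<bar>f x\<bar> \<le> C" "AE x in M. \<bar>g x\<bar> \<le> D"
    using assms by (auto simp: Linf_def)
  then have "AE x in M. \<bar>f x + g x\<bar> \<le> C + D" by eventually_elim linarith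
  then show ?thesis using assms by (auto simp: Linf_def)
qed

lemma Linf_mult:
  assumes "f \<in> Linf \<Omega>" "g \<in> Linf \<Omega>"
  shows "(\<lambda>x. f x * g x) \<in> Linf \<Omega>"
proof -
  obtain C D where "AE x in M. \<bar>f x\<bar> \<le> C" "AE x in M. \<bar>g x\<bar> \<le> D"
    using assms by (auto simp: Linf_def)
  then have "AE x in M. \<bar>f x * g x\<bar> \<le> C * D"
    by eventually_elim (auto simp: abs_mult intro!: mult_mono order_trans[OF abs_ge_zero])
  then show ?thesis using assms by (auto simp: Linf_def)
qed

lemma Linf_sum:
  assumes "\<And>i. i \<in> I \<Longrightarrow> f i \<in> Linf \<Omega>"
  shows "(\<lambda>x. \<Sum>i\<in>I. f i x) \<in> Linf \<Omega>"
proof (cases "finite I")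
  case True
  then show ?thesis using assms
    by (induction I) (auto intro: Linf_const Linf_add)
qed (simp add: Linf_const)

lemma Linf_mult_L2:
  assumes "f \<in> Linf \<Omega>" "u \<in> L2 \<Omega>"
  shows "(\<lambda>x. f x * u x) \<in> L2 \<Omega>"
proof -
  have [measurable]: "u \<in> borel_measurable M" "f \<in> borel_measurable M"
    using assms by (auto dest: L2_measurable Linf_measurable)
  obtain C where C: "AE x in M. \<bar>f x\<bar> \<le> C" using assms by (auto simp: Linf_def)
  have "integrable M (\<lambda>x. (f x * u x)\<^sup>2)"
  proof (rule Bochner_Integration.integrable_bound)
    show "integrable M (\<lambda>x. C\<^sup>2 * (u x)\<^sup>2)"
      using assms by (intro integrable_mult_right) (auto simp: L2_def)
    show "(\<lambda>x. (f x * u x)\<^sup>2) \<in> borel_measurable M" by measurable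
    show "AE x in M. norm ((f x * u x)\<^sup>2) \<le> norm (C\<^sup>2 * (u x)\<^sup>2)"
      using C
    proof eventually_elim
      case (elim x)
      then have "(f x)\<^sup>2 \<le> C\<^sup>2" by (metis abs_ge_zero power2_abs power_mono)
      then show ?case by (simp add: power_mult_distrib mult_right_mono)
    qed
  qed
  then show ?thesis by (simp add: L2_def)
qed

text \<open>Boundedness of \<Omega> enters through its finite measure, which makes constants square
  integrable.\<close>

lemma Linf_subset_L2: "f \<in> Linf \<Omega> \<Longrightarrow> f \<in> L2 \<Omega>"
proof -
  interpret finite_measure M by (rule finite_measure_M)
  have "(\<lambda>x. 1) \<in> L2 \<Omega>" by (simp add: L2_def)
  then show "f \<in> Linf \<Omega> \<Longrightarrow> f \<in> L2 \<Omega>" using Linf_mult_L2[of f "\<lambda>x. 1"] by simp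
qed

lemma L2_integrable: "u \<in> L2 \<Omega> \<Longrightarrow> integrable M u"
  using L2_mult_integrable[OF Linf_subset_L2[OF Linf_const[of 1]], of u] by simp

lemma L2_sum:
  assumes "finite I" "\<And>i. i \<in> I \<Longrightarrow> f i \<in> L2 \<Omega>"
  shows "(\<lambda>x. \<Sum>i\<in>I. f i x) \<in> L2 \<Omega>"
  using assms
proof (induction I)
  case empty
  show ?case using Linf_subset_L2[OF Linf_const] by simp
next
  case (insert i I)
  then show ?case using L2_lin[of "f i" "\<lambda>x. \<Sum>i\<in>I. f i x" 1 1] by simp
qed

lemma continuous_bounded_Linf:
  assumes "continuous_on \<Omega> f" "\<And>x. x \<in> \<Omega> \<Longrightarrow> \<bar>f x\<bar> \<le> C"
  shows "f \<in> Linf \<Omega>"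
  using continuous_on_measurable[OF assms(1)] AE_M[of "\<lambda>x. \<bar>f x\<bar> \<le> C"] assms(2)
  by (auto simp: Linf_def)

lemma test_Linf: "\<phi> \<in> test_functions \<Omega> \<Longrightarrow> \<phi> \<in> Linf \<Omega>"
  by (metis continuous_bounded_Linf continuous_on_subset subset_UNIV test_functions_bounded test_functions_continuous)

text \<open>For a box whose closure lies in \<Omega> the cutoffs \<open>bump l u m\<close> are test
  functions tending to its indicator. Dominated convergence with majorant |g| then turns the
  hypothesis into vanishing integrals over boxes.\<close>

lemma fundamental_lemma:
  assumes g: "g \<in> L2 \<Omega>" and zero: "\<And>\<phi>. \<phi> \<in> test_functions \<Omega> \<Longrightarrow> integral\<^sup>L M (\<lambda>x. g x * \<phi> x) = 0"
  shows "AE x in M. g x = 0"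
proof -
  let ?G = "\<lambda>x. indicator \<Omega> x *\<^sub>R g x"
  have G: "integrable lebesgue ?G"
    using L2_integrable[OF g] \<Omega>_sets by (simp add: integrable_restrict_space)
  have "set_lebesgue_integral lebesgue (box l u) ?G = 0" if lu: "cbox l u \<subseteq> \<Omega>" for l u
  proof -
    have [measurable]: "g \<in> borel_measurable M" using g by (rule L2_measurable)
    have "(\<lambda>m. integral\<^sup>L M (\<lambda>x. g x * bump l u m x)) \<longlonglongrightarrow> integral\<^sup>L M (\<lambda>x. g x * indicator (box l u) x)"
    proof (rule integral_dominated_convergence[where w = "\<lambda>x. \<bar>g x\<bar>"])
      show "(\<lambda>x. g x * indicator (box l u) x) \<in> borel_measurable M"
        using lu box_subset_cbox \<Omega>_sets
        by (intro borel_measurable_times borel_measurable_indicator) (auto simp: sets_restrict_space_iff)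
      show "(\<lambda>x. g x * bump l u m x) \<in> borel_measurable M" for m
        using test_Linf[OF bump_test_function[OF lu]] by (intro borel_measurable_times) (auto dest: Linf_measurable)
      show "integrable M (\<lambda>x. \<bar>g x\<bar>)" using L2_integrable[OF g] by simp
      show "AE x in M. (\<lambda>m. g x * bump l u m x) \<longlonglongrightarrow> g x * indicator (box l u) x"
        by (intro AE_I2 tendsto_mult tendsto_const bump_tendsto)
      show "AE x in M. norm (g x * bump l u m x) \<le> \<bar>g x\<bar>" for m
        by (intro AE_I2) (simp add: abs_mult mult_left_le bump_bounds)
    qed
    then have "integral\<^sup>L M (\<lambda>x. g x * indicator (box l u) x) = 0"
      using zero[OF bump_test_function[OF lu]] by (simp add: LIMSEQ_const_iff)
    moreover have "integral\<^sup>L M (\<lambda>x. g x * indicator (box l u) x) =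
        (\<integral>x. indicator \<Omega> x *\<^sub>R (g x * indicator (box l u) x) \<partial>lebesgue)"
      using \<Omega>_sets by (simp add: integral_restrict_space)
    ultimately show ?thesis by (simp add: set_lebesgue_integral_def mult_ac)
  qed
  then have "AE x in lebesgue. x \<in> \<Omega> \<longrightarrow> ?G x = 0"
    by (intro AE_zero_if_integral_boxes_zero G open_\<Omega>)
  then have "AE x in lebesgue. x \<in> \<Omega> \<longrightarrow> g x = 0" by eventually_elim auto
  then show ?thesis using \<Omega>_sets by (simp add: AE_restrict_space_iff)
qed

lemma Linf_mult_integrable:
  assumes "f \<in> Linf \<Omega>" "u \<in> L2 \<Omega>" "v \<in> L2 \<Omega>"
  shows "integrable M (\<lambda>x. f x * (u x * v x))"
  using L2_mult_integrable[OF Linf_mult_L2[OF assms(1,2)] assms(3)] by (simp add: mult.assoc)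

section \<open>Weak derivatives along smooth vector fields\<close>

definition smooth_field :: "(real^'n \<Rightarrow> real^'n) \<Rightarrow> bool" where
  "smooth_field c \<longleftrightarrow> (\<forall>i. smooth \<Omega> (\<lambda>x. c x $ i))"

lemma smooth_coord_field: "smooth_field (coord_field i)"
  using Ck_const[OF open_\<Omega>] by (simp add: smooth_field_def smooth_def)

lemma test_mult_component:
  assumes "\<phi> \<in> test_functions \<Omega>" "smooth_field c"
  shows "(\<lambda>x. \<phi> x * c x $ i) \<in> test_functions \<Omega>"
  using assms test_functions_mult[OF open_\<Omega>] by (simp add: smooth_field_def)

text \<open>The derivatives of \<open>c\<close> may be unbounded near the boundary, but \<phi> times
  a component of \<open>c\<close> is a test function, so its derivatives are bounded.\<close>

lemma divergence_test_Linf: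
  assumes "\<phi> \<in> test_functions \<Omega>" "smooth_field c"
  shows "divergence (\<lambda>y. \<phi> y *\<^sub>R c y) \<in> Linf \<Omega>"
proof -
  have "(\<lambda>x. \<Sum>i\<in>UNIV. frechet_derivative (\<lambda>y. \<phi> y * c y $ i) (at x) (axis i 1)) \<in> Linf \<Omega>"
    by (intro Linf_sum test_Linf test_functions_deriv test_mult_component assms)
  moreover have "divergence (\<lambda>y. \<phi> y *\<^sub>R c y) =
      (\<lambda>x. \<Sum>i\<in>UNIV. frechet_derivative (\<lambda>y. \<phi> y * c y $ i) (at x) (axis i 1))"
    by (simp add: divergence_def fun_eq_iff)
  ultimately show ?thesis by simp
qed

lemma integrable_L2_Linf: "u \<in> L2 \<Omega> \<Longrightarrow> f \<in> Linf \<Omega> \<Longrightarrow> integrable M (\<lambda>x. u x * f x)"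
  by (rule L2_mult_integrable[OF _ Linf_subset_L2])

lemma has_weak_deriv_lin:
  assumes "smooth_field c" "u \<in> L2 \<Omega>" "v \<in> L2 \<Omega>" "g \<in> L2 \<Omega>" "k \<in> L2 \<Omega>"
    and "has_weak_deriv \<Omega> c u g" "has_weak_deriv \<Omega> c v k"
  shows "has_weak_deriv \<Omega> c (\<lambda>x. s * u x + t * v x) (\<lambda>x. s * g x + t * k x)"
  unfolding has_weak_deriv_def
proof
  fix \<phi> assume \<phi>: "\<phi> \<in> test_functions \<Omega>"
  let ?d = "divergence (\<lambda>y. \<phi> y *\<^sub>R c y)"
  note int = integrable_L2_Linf[OF _ divergence_test_Linf[OF \<phi> assms(1)]] integrable_L2_Linf[OF _ test_Linf[OF \<phi>]]
  have "integral\<^sup>L M (\<lambda>x. (s * u x + t * v x) * ?d x) = integral\<^sup>L M (\<lambda>x. s * (u x * ?d x) + t * (v x * ?d x))"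
    by (simp add: algebra_simps)
  also have "\<dots> = s * integral\<^sup>L M (\<lambda>x. u x * ?d x) + t * integral\<^sup>L M (\<lambda>x. v x * ?d x)"
    using int assms by (simp add: Bochner_Integration.integral_add)
  also have "\<dots> = - (s * integral\<^sup>L M (\<lambda>x. g x * \<phi> x) + t * integral\<^sup>L M (\<lambda>x. k x * \<phi> x))"
    using assms(6,7) \<phi> by (simp add: has_weak_deriv_def)
  also have "\<dots> = - integral\<^sup>L M (\<lambda>x. s * (g x * \<phi> x) + t * (k x * \<phi> x))"
    using int assms by (simp add: Bochner_Integration.integral_add)
  also have "\<dots> = - integral\<^sup>L M (\<lambda>x. (s * g x + t * k x) * \<phi> x)"
    by (simp add: algebra_simps)
  finally show "integral\<^sup>L M (\<lambda>x. (s * u x + t * v x) * ?d x) = - integral\<^sup>L M (\<lambda>x. (s * g x + t * k x) * \<phi> x)" .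
qed

lemma has_weak_deriv_unique:
  assumes "g \<in> L2 \<Omega>" "k \<in> L2 \<Omega>" "has_weak_deriv \<Omega> c u g" "has_weak_deriv \<Omega> c u k"
  shows "AE x in M. g x = k x"
proof -
  \<comment> \<open>The coefficients 1 and -1 make the difference an instance of
    \<open>L2_lin\<close>.\<close>
  have "AE x in M. 1 * g x + (-1) * k x = 0"
  proof (rule fundamental_lemma)
    show "(\<lambda>x. 1 * g x + (-1) * k x) \<in> L2 \<Omega>" by (rule L2_lin) fact+
    fix \<phi> assume \<phi>: "\<phi> \<in> test_functions \<Omega>"
    note int = integrable_L2_Linf[OF _ test_Linf[OF \<phi>]]
    have "integral\<^sup>L M (\<lambda>x. (1 * g x + (-1) * k x) * \<phi> x) = integral\<^sup>L M (\<lambda>x. g x * \<phi> x - k x * \<phi> x)"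
      by (simp add: algebra_simps)
    also have "\<dots> = integral\<^sup>L M (\<lambda>x. g x * \<phi> x) - integral\<^sup>L M (\<lambda>x. k x * \<phi> x)"
      by (intro Bochner_Integration.integral_diff int assms)
    also have "\<dots> = 0"
      using assms(3,4) \<phi> unfolding has_weak_deriv_def by force
    finally show "integral\<^sup>L M (\<lambda>x. (1 * g x + (-1) * k x) * \<phi> x) = 0" .
  qed
  then show ?thesis by eventually_elim simp
qed

lemma wderiv_props:
  assumes "u \<in> deriv_space \<Omega> C" "c \<in> C"
  shows "wderiv \<Omega> c u \<in> L2 \<Omega>" "has_weak_deriv \<Omega> c u (wderiv \<Omega> c u)"
proof -
  have "\<exists>g. g \<in> L2 \<Omega> \<and> has_weak_deriv \<Omega> c u g"
    using assms by (auto simp: deriv_space_def)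
  from someI_ex[OF this] show "wderiv \<Omega> c u \<in> L2 \<Omega>" "has_weak_deriv \<Omega> c u (wderiv \<Omega> c u)"
    unfolding wderiv_def by auto
qed

text \<open>\<open>wderiv\<close> picks some weak derivative, and uniqueness makes any other agree
  with it off a null set. Computation rules for \<open>wderiv\<close> are therefore
  almost-everywhere statements.\<close>

lemma wderiv_eqI:
  assumes "g \<in> L2 \<Omega>" "has_weak_deriv \<Omega> c u g"
  shows "AE x in M. wderiv \<Omega> c u x = g x"
proof -
  have "\<exists>g. g \<in> L2 \<Omega> \<and> has_weak_deriv \<Omega> c u g" using assms by auto
  from someI_ex[OF this] show ?thesis
    unfolding wderiv_def by (intro has_weak_deriv_unique[of _ _ c u] assms) auto
qed

lemma deriv_space_L2: "u \<in> deriv_space \<Omega> C \<Longrightarrow> u \<in> L2 \<Omega>"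
  by (simp add: deriv_space_def)

lemma deriv_space_lin:
  assumes "\<And>c. c \<in> C \<Longrightarrow> smooth_field c" "u \<in> deriv_space \<Omega> C" "v \<in> deriv_space \<Omega> C"
  shows "(\<lambda>x. s * u x + t * v x) \<in> deriv_space \<Omega> C"
  unfolding deriv_space_def
  by (auto intro!: L2_lin has_weak_deriv_lin wderiv_props[OF assms(2)] wderiv_props[OF assms(3)]
      deriv_space_L2[OF assms(2)] deriv_space_L2[OF assms(3)] assms(1)
      bexI[where x = "\<lambda>x. s * wderiv \<Omega> _ u x + t * wderiv \<Omega> _ v x"])

lemma wderiv_lin:
  assumes "smooth_field c" "c \<in> C" "u \<in> deriv_space \<Omega> C" "v \<in> deriv_space \<Omega> C"
  shows "AE x in M. wderiv \<Omega> c (\<lambda>x. s * u x + t * v x) x = s * wderiv \<Omega> c u x + t * wderiv \<Omega> c v x"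
  by (intro wderiv_eqI L2_lin has_weak_deriv_lin wderiv_props[OF assms(3) assms(2)] wderiv_props[OF assms(4) assms(2)]
      deriv_space_L2[OF assms(3)] deriv_space_L2[OF assms(4)] assms(1))

lemma zero_L2: "(\<lambda>x. 0) \<in> L2 \<Omega>"
  by (simp add: L2_def)

lemma zero_has_weak_deriv: "has_weak_deriv \<Omega> c (\<lambda>x. 0) (\<lambda>x. 0)"
  by (simp add: has_weak_deriv_def)

lemma zero_deriv_space: "(\<lambda>x. 0) \<in> deriv_space \<Omega> C"
  using zero_L2 zero_has_weak_deriv by (auto simp: deriv_space_def)

text \<open>The divergence of \<phi> c is the sum over i of the i-th partial derivative of \<phi>
  c_i. Each \<phi> c_i is a test function, admissible in the definition of the i-th weak partial
  derivative of \<open>u\<close>; summing these instances gives the claim.\<close>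

lemma H1_imp_has_weak_deriv:
  assumes u: "u \<in> H1 \<Omega>" and c: "smooth_field c" "\<And>i. (\<lambda>x. c x $ i) \<in> Linf \<Omega>"
  shows "(\<lambda>x. c x \<bullet> grad \<Omega> u x) \<in> L2 \<Omega>" "has_weak_deriv \<Omega> c u (\<lambda>x. c x \<bullet> grad \<Omega> u x)"
proof -
  let ?g = "\<lambda>i. wderiv \<Omega> (coord_field i) u"
  have g: "?g i \<in> L2 \<Omega>" "has_weak_deriv \<Omega> (coord_field i) u (?g i)" for i
    using u unfolding H1_def by (auto intro: wderiv_props)
  have uL2: "u \<in> L2 \<Omega>" using u unfolding H1_def by (rule deriv_space_L2)
  have eq: "c x \<bullet> grad \<Omega> u x = (\<Sum>i\<in>UNIV. c x $ i * ?g i x)" for x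
    by (simp add: inner_vec_def grad_def)
  show "(\<lambda>x. c x \<bullet> grad \<Omega> u x) \<in> L2 \<Omega>"
    unfolding eq by (intro L2_sum Linf_mult_L2 c g) auto
  show "has_weak_deriv \<Omega> c u (\<lambda>x. c x \<bullet> grad \<Omega> u x)"
    unfolding has_weak_deriv_def
  proof
    fix \<phi> assume \<phi>: "\<phi> \<in> test_functions \<Omega>"
    let ?p = "\<lambda>i x. \<phi> x * c x $ i"
    have p: "?p i \<in> test_functions \<Omega>" for i by (rule test_mult_component[OF \<phi> c(1)])
    let ?dp = "\<lambda>i x. frechet_derivative (?p i) (at x) (axis i 1)"
    have dp: "?dp i \<in> Linf \<Omega>" for i by (intro test_Linf test_functions_deriv p)
    \<comment> \<open>Only the i-th component of this field is nonzero, so its divergence is a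
      single partial derivative.\<close>
    have coord: "divergence (\<lambda>y. ?p i y *\<^sub>R axis i 1) x = ?dp i x" for i x
    proof -
      have "frechet_derivative (\<lambda>y. (?p i y *\<^sub>R axis i (1::real)) $ j) (at x) (axis j 1) = (if j = i then ?dp i x else 0)" for j
        by (auto simp: axis_def)
      then show ?thesis unfolding divergence_def by simp
    qed
    have "integral\<^sup>L M (\<lambda>x. u x * divergence (\<lambda>y. \<phi> y *\<^sub>R c y) x) = integral\<^sup>L M (\<lambda>x. \<Sum>i\<in>UNIV. u x * ?dp i x)"
      by (simp add: divergence_def sum_distrib_left)
    also have "\<dots> = (\<Sum>i\<in>UNIV. integral\<^sup>L M (\<lambda>x. u x * ?dp i x))"
      by (intro Bochner_Integration.integral_sum integrable_L2_Linf uL2 dp)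
    also have "\<dots> = (\<Sum>i\<in>UNIV. - integral\<^sup>L M (\<lambda>x. ?g i x * ?p i x))"
      using g(2) p unfolding has_weak_deriv_def by (simp add: coord[symmetric])
    also have "\<dots> = - (\<Sum>i\<in>UNIV. integral\<^sup>L M (\<lambda>x. ?g i x * ?p i x))"
      by (simp add: sum_negf)
    also have "(\<Sum>i\<in>UNIV. integral\<^sup>L M (\<lambda>x. ?g i x * ?p i x)) = integral\<^sup>L M (\<lambda>x. \<Sum>i\<in>UNIV. ?g i x * ?p i x)"
      by (intro Bochner_Integration.integral_sum[symmetric] integrable_L2_Linf g test_Linf p)
    also have "(\<lambda>x. \<Sum>i\<in>UNIV. ?g i x * ?p i x) = (\<lambda>x. (c x \<bullet> grad \<Omega> u x) * \<phi> x)"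
      by (simp add: eq sum_distrib_left sum_distrib_right mult_ac)
    finally show "integral\<^sup>L M (\<lambda>x. u x * divergence (\<lambda>y. \<phi> y *\<^sub>R c y) x) = - integral\<^sup>L M (\<lambda>x. (c x \<bullet> grad \<Omega> u x) * \<phi> x)" .
  qed
qed

section \<open>Traces and spaces of functions with vanishing trace\<close>

lemma smooth_field_measurable: "smooth_field c \<Longrightarrow> (\<lambda>x. c x $ i) \<in> borel_measurable M"
  by (intro continuous_on_measurable Ck_imp_continuous_on[of 0]) (auto simp: smooth_field_def smooth_def)

lemma directional_derivative_measurable:
  assumes "smooth UNIV \<phi>" "smooth_field c"
  shows "(\<lambda>x. frechet_derivative \<phi> (at x) (c x)) \<in> borel_measurable M"
proof -
  have "Ck (Suc 0) UNIV \<phi>" using assms(1) unfolding smooth_def by blast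
  then have "continuous_on UNIV (\<lambda>x. frechet_derivative \<phi> (at x) (axis i 1))" for i
    using Ck_SucD(2) Ck_imp_continuous_on by blast
  then have "(\<lambda>x. frechet_derivative \<phi> (at x) (axis i 1)) \<in> borel_measurable M" for i
    by (intro continuous_on_measurable) (auto intro: continuous_on_subset)
  then have "(\<lambda>x. \<Sum>i\<in>UNIV. c x $ i * frechet_derivative \<phi> (at x) (axis i 1)) \<in> borel_measurable M"
    using smooth_field_measurable[OF assms(2)] by (intro borel_measurable_sum borel_measurable_times)
  then show ?thesis by (simp add: frechet_derivative_expand[OF assms(1), symmetric])
qed

text \<open>The approximating sequences are combined with the same coefficients. Their derivatives
  tend to the combination of the two \<open>wderiv\<close>, which is \<open>wderiv\<close> of the
  combination up to a null set.\<close>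

lemma has_trace_lin:
  assumes C: "\<And>c. c \<in> C \<Longrightarrow> smooth_field c" and u: "u \<in> deriv_space \<Omega> C" and v: "v \<in> deriv_space \<Omega> C"
    and tr: "has_trace \<Omega> C S u g" "has_trace \<Omega> C S v k"
  shows "has_trace \<Omega> C S (\<lambda>x. s * u x + t * v x) (\<lambda>x. s * g x + t * k x)"
proof -
  obtain \<phi> where \<phi>: "\<And>m. smooth UNIV (\<phi> m)" "L2_conv M \<phi> u"
      "\<And>c. c \<in> C \<Longrightarrow> L2_conv M (\<lambda>m x. frechet_derivative (\<phi> m) (at x) (c x)) (wderiv \<Omega> c u)"
      "\<And>K. compact K \<Longrightarrow> K \<subseteq> S \<Longrightarrow> L2_conv (restrict_space surface K) \<phi> g"
    using tr(1) unfolding has_trace_def by blast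
  obtain \<psi> where \<psi>: "\<And>m. smooth UNIV (\<psi> m)" "L2_conv M \<psi> v"
      "\<And>c. c \<in> C \<Longrightarrow> L2_conv M (\<lambda>m x. frechet_derivative (\<psi> m) (at x) (c x)) (wderiv \<Omega> c v)"
      "\<And>K. compact K \<Longrightarrow> K \<subseteq> S \<Longrightarrow> L2_conv (restrict_space surface K) \<psi> k"
    using tr(2) unfolding has_trace_def by blast
  have cont: "continuous_on UNIV f" if "smooth UNIV f" for f :: "real^'n \<Rightarrow> real"
    using that unfolding smooth_def by (blast intro: Ck_imp_continuous_on)
  have meas: "f \<in> borel_measurable M" if "smooth UNIV f" for f :: "real^'n \<Rightarrow> real"
    by (rule continuous_on_measurable) (use cont[OF that] in \<open>auto intro: continuous_on_subset\<close>)
  \<comment> \<open>The sigma-algebra of \<open>measure_of\<close> is independent of the set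
    function, so measurability with respect to \<open>surface\<close> is Borel
    measurability.\<close>
  have sets: "sets surface = sets (borel :: (real^'n) measure)"
    unfolding surface_def by (simp add: sets_measure_of_conv sets.sigma_sets_eq[of borel, simplified])
  have smeas: "f \<in> borel_measurable (restrict_space surface K)" if "f \<in> borel_measurable borel" for f :: "real^'n \<Rightarrow> real" and K
    by (intro measurable_restrict_space1) (use that in \<open>simp add: measurable_cong_sets[OF sets refl]\<close>)
  have bor: "g \<in> borel_measurable borel" "k \<in> borel_measurable borel"
    using tr by (auto simp: has_trace_def)
  show ?thesis unfolding has_trace_def
  proof (intro conjI exI[of _ "\<lambda>m x. s * \<phi> m x + t * \<psi> m x"] allI ballI impI)
    show "(\<lambda>x. s * g x + t * k x) \<in> borel_measurable borel"
      using bor by (intro borel_measurable_add borel_measurable_times borel_measurable_const)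
    show "smooth UNIV (\<lambda>x. s * \<phi> m x + t * \<psi> m x)" for m
      by (intro smooth_lin \<phi> \<psi>)
    show "L2_conv M (\<lambda>m x. s * \<phi> m x + t * \<psi> m x) (\<lambda>x. s * u x + t * v x)"
      by (intro L2_conv_lin meas \<phi>(1,2) \<psi>(1,2) L2_measurable deriv_space_L2[OF u] deriv_space_L2[OF v])
    show "L2_conv (restrict_space surface K) (\<lambda>m x. s * \<phi> m x + t * \<psi> m x) (\<lambda>x. s * g x + t * k x)"
      if "compact K \<and> K \<subseteq> S" for K
      by (intro L2_conv_lin smeas borel_measurable_continuous_onI cont \<phi>(1) \<psi>(1) bor)
         (use that \<phi>(4) \<psi>(4) in auto)
    fix c assume c: "c \<in> C"
    have "L2_conv M (\<lambda>m x. s * frechet_derivative (\<phi> m) (at x) (c x) + t * frechet_derivative (\<psi> m) (at x) (c x))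
        (\<lambda>x. s * wderiv \<Omega> c u x + t * wderiv \<Omega> c v x)"
      by (intro L2_conv_lin directional_derivative_measurable \<phi>(1) \<psi>(1) C[OF c] \<phi>(3)[OF c] \<psi>(3)[OF c]
          L2_measurable wderiv_props[OF u c] wderiv_props[OF v c])
    then have "L2_conv M (\<lambda>m x. s * frechet_derivative (\<phi> m) (at x) (c x) + t * frechet_derivative (\<psi> m) (at x) (c x))
        (wderiv \<Omega> c (\<lambda>x. s * u x + t * v x))"
      by (rule L2_conv_cong_AE) (use wderiv_lin[OF C[OF c] c u v, of s t] in eventually_elim, simp)
    then show "L2_conv M (\<lambda>m x. frechet_derivative (\<lambda>x. s * \<phi> m x + t * \<psi> m x) (at x) (c x))
        (wderiv \<Omega> c (\<lambda>x. s * u x + t * v x))"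
      by (simp only: frechet_derivative_lin[OF \<phi>(1) \<psi>(1)])
  qed
qed

lemma has_trace_zero: "has_trace \<Omega> C S (\<lambda>x. 0) (\<lambda>x. 0)"
  unfolding has_trace_def
proof (intro conjI exI[of _ "\<lambda>m x. 0"] allI ballI impI)
  show "smooth UNIV (\<lambda>x::real^'n. 0)" by (simp add: smooth_def Ck_const)
  fix c :: "real^'n \<Rightarrow> real^'n"
  have "L2_conv M (\<lambda>m x. 0) (\<lambda>x. 0)" by (simp add: L2_conv_def)
  then have "L2_conv M (\<lambda>m x. 0) (wderiv \<Omega> c (\<lambda>x. 0))"
    by (rule L2_conv_cong_AE)
       (use wderiv_eqI[OF zero_L2 zero_has_weak_deriv, of c] in eventually_elim, simp)
  then show "L2_conv M (\<lambda>m x. frechet_derivative (\<lambda>x. 0) (at x) (c x)) (wderiv \<Omega> c (\<lambda>x. 0))"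
    by simp
qed (simp_all add: L2_conv_def)

text \<open>Common form of \<open>space_V\<close> and \<open>space_Lin\<close>, so that closure
  under linear combinations is proved once. For \<open>space_V\<close> the sets are the whole
  boundary and \<open>Gamma_D\<close>; for \<open>space_Lin\<close> both are
  \<open>Gamma_in\<close>.\<close>

definition trace_zero_space where
  "trace_zero_space C S R =
     {v \<in> deriv_space \<Omega> C. \<exists>g. has_trace \<Omega> C S v g \<and> (AE x in surface. x \<in> R \<longrightarrow> g x = 0)}"

lemma trace_zero_space_lin:
  assumes C: "\<And>c. c \<in> C \<Longrightarrow> smooth_field c"
    and u: "u \<in> trace_zero_space C S R" and v: "v \<in> trace_zero_space C S R"
  shows "(\<lambda>x. s * u x + t * v x) \<in> trace_zero_space C S R"
proof -
  obtain g where g: "has_trace \<Omega> C S u g" "AE x in surface. x \<in> R \<longrightarrow> g x = 0"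
    using u unfolding trace_zero_space_def by blast
  obtain k where k: "has_trace \<Omega> C S v k" "AE x in surface. x \<in> R \<longrightarrow> k x = 0"
    using v unfolding trace_zero_space_def by blast
  have uv: "u \<in> deriv_space \<Omega> C" "v \<in> deriv_space \<Omega> C"
    using u v unfolding trace_zero_space_def by blast+
  have "has_trace \<Omega> C S (\<lambda>x. s * u x + t * v x) (\<lambda>x. s * g x + t * k x)"
    by (rule has_trace_lin[OF C uv g(1) k(1)])
  moreover have "AE x in surface. x \<in> R \<longrightarrow> s * g x + t * k x = 0"
    using g(2) k(2) by eventually_elim simp
  ultimately show ?thesis
    using deriv_space_lin[OF C uv] unfolding trace_zero_space_def by blast
qed

lemma zero_trace_zero_space: "(\<lambda>x. 0) \<in> trace_zero_space C S R"
  unfolding trace_zero_space_def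
  using zero_deriv_space has_trace_zero[of C S] by (auto intro!: exI[of _ "\<lambda>x. 0"])

lemma space_V_eq: "space_V \<Omega> b = trace_zero_space (range coord_field) (frontier \<Omega>) (Gamma_D \<Omega> b)"
  by (simp add: space_V_def H1_def trace_zero_space_def)

lemma space_Lin_eq: "space_Lin \<Omega> b = trace_zero_space {b} (Gamma_in \<Omega> b) (Gamma_in \<Omega> b)"
  by (simp add: space_Lin_def trace_zero_space_def)

lemma space_V_lin:
  assumes "u \<in> space_V \<Omega> b" "v \<in> space_V \<Omega> b"
  shows "(\<lambda>x. s * u x + t * v x) \<in> space_V \<Omega> b"
  using assms unfolding space_V_eq by (intro trace_zero_space_lin) (auto intro: smooth_coord_field)

lemma zero_space_V: "(\<lambda>x. 0) \<in> space_V \<Omega> b"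
  unfolding space_V_eq by (rule zero_trace_zero_space)

lemma space_Lin_lin:
  assumes "smooth_field b" "u \<in> space_Lin \<Omega> b" "v \<in> space_Lin \<Omega> b"
  shows "(\<lambda>x. s * u x + t * v x) \<in> space_Lin \<Omega> b"
  using assms unfolding space_Lin_eq by (intro trace_zero_space_lin) auto

lemma zero_space_Lin: "(\<lambda>x. 0) \<in> space_Lin \<Omega> b"
  unfolding space_Lin_eq by (rule zero_trace_zero_space)

end

section \<open>The bilinear forms\<close>

lemma outer_prod_mult_vec: "outer_prod v w *v g = (w \<bullet> g) *\<^sub>R v"
  by (simp add: Finite_Cartesian_Product.vec_eq_iff outer_prod_def matrix_vector_mult_def inner_vec_def sum_distrib_left sum_distrib_right mult_ac)

text \<open>As \<open>b x\<close> is a unit vector, \<open>outer_prod (b x) (b x)\<close> is the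
  orthogonal projection onto its line and \<open>Q\<close> the complementary one. Symmetry of
  \<open>Q\<close> moves the outer projection onto the second argument. Orthogonality of
  \<open>Q g\<close> to \<open>b x\<close> makes the ellipticity of \<open>Aperp\<close>
  applicable.\<close>

lemma diffusion_quadratic:
  assumes "norm (b x) = 1"
  defines "Q \<equiv> \<lambda>g. g - (b x \<bullet> g) *\<^sub>R b x"
  shows "(diffusion b Apar Aperp x *v g) \<bullet> g = Apar x * (b x \<bullet> g)\<^sup>2 + Q g \<bullet> (Aperp x *v Q g)"
    and "Q g \<bullet> b x = 0"
proof -
  have bb: "b x \<bullet> b x = 1" using assms(1) by (simp add: norm_eq_1)
  let ?P = "outer_prod (b x) (b x)" and ?I = "Finite_Cartesian_Product.mat 1 :: real^'a^'a"
  have Q: "(?I - ?P) *v w = Q w" for w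
    by (simp add: Q_def matrix_vector_mult_diff_rdistrib outer_prod_mult_vec)
  have sym: "Q w \<bullet> g = Q g \<bullet> w" for w
    by (simp add: Q_def inner_diff_left inner_diff_right inner_commute)
  have "diffusion b Apar Aperp x *v g = ?P *v ((Apar x *\<^sub>R ?P) *v g) + (?I - ?P) *v (Aperp x *v ((?I - ?P) *v g))"
    by (simp add: diffusion_def Let_def matrix_vector_mult_add_rdistrib matrix_vector_mul_assoc matrix_mul_assoc)
  also have "(Apar x *\<^sub>R ?P) *v g = (Apar x * (b x \<bullet> g)) *\<^sub>R b x"
    by (simp add: scaleR_matrix_vector_assoc[symmetric] outer_prod_mult_vec)
  also have "?P *v \<dots> = (Apar x * (b x \<bullet> g)) *\<^sub>R b x"
    by (simp add: outer_prod_mult_vec bb)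
  finally have "diffusion b Apar Aperp x *v g = (Apar x * (b x \<bullet> g)) *\<^sub>R b x + Q (Aperp x *v Q g)"
    by (simp only: Q)
  then show "(diffusion b Apar Aperp x *v g) \<bullet> g = Apar x * (b x \<bullet> g)\<^sup>2 + Q g \<bullet> (Aperp x *v Q g)"
    by (simp add: inner_add_left sym power2_eq_square mult.assoc)
  show "Q g \<bullet> b x = 0"
    using bb by (simp add: Q_def inner_diff_left inner_diff_right inner_commute)
qed

locale anisotropic_diffusion = bounded_open \<Omega> for \<Omega> :: "(real^'n) set" +
  fixes b :: "real^'n \<Rightarrow> real^'n" and Apar :: "real^'n \<Rightarrow> real" and Aperp :: "real^'n \<Rightarrow> real^'n^'n"
    and A0 A1 :: real
  assumes field: "unit_field \<Omega> b" and coeff: "coefficients \<Omega> b Apar Aperp A0 A1"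
begin

lemma norm_b: "x \<in> \<Omega> \<Longrightarrow> norm (b x) = 1"
  using field by (simp add: unit_field_def)

lemma smooth_b: "smooth_field b"
  using field by (simp add: unit_field_def smooth_field_def)

lemma b_Linf: "(\<lambda>x. b x $ i) \<in> Linf \<Omega>"
proof (rule continuous_bounded_Linf)
  show "continuous_on \<Omega> (\<lambda>x. b x $ i)"
    using smooth_b unfolding smooth_field_def smooth_def by (blast intro: Ck_imp_continuous_on)
  show "\<bar>b x $ i\<bar> \<le> 1" if "x \<in> \<Omega>" for x
    using component_le_norm_cart[of "b x" i] norm_b[OF that] by simp
qed

lemma Apar_Linf: "Apar \<in> Linf \<Omega>"
  using coeff by (simp add: coefficients_def W2inf_def)

lemma Aperp_Linf: "(\<lambda>x. Aperp x $ i $ j) \<in> Linf \<Omega>"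
  using coeff by (simp add: coefficients_def W2inf_def)

text \<open>Each entry is a polynomial in the components of \<open>b\<close>, \<open>Apar\<close>
  and the entries of \<open>Aperp\<close>.\<close>

lemma diffusion_Linf: "(\<lambda>x. diffusion b Apar Aperp x $ i $ j) \<in> Linf \<Omega>"
proof -
  let ?P = "\<lambda>i j x. b x $ i * b x $ j"
  let ?Q = "\<lambda>i j x. (if i = j then 1 else 0) + (-1) * ?P i j x"
  have P: "?P i j \<in> Linf \<Omega>" for i j by (intro Linf_mult b_Linf)
  have Q: "?Q i j \<in> Linf \<Omega>" for i j
    by (intro Linf_add Linf_mult[OF Linf_const] P) (rule Linf_const)
  have "(\<lambda>x. diffusion b Apar Aperp x $ i $ j) = (\<lambda>x. (\<Sum>k\<in>UNIV. ?P i k x * (Apar x * ?P k j x)) +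
      (\<Sum>k\<in>UNIV. (\<Sum>l\<in>UNIV. ?Q i l x * Aperp x $ l $ k) * ?Q k j x))"
    by (simp add: diffusion_def Let_def matrix_matrix_mult_def outer_prod_def Finite_Cartesian_Product.mat_def)
  also have "\<dots> \<in> Linf \<Omega>"
    by (intro Linf_add Linf_sum Linf_mult[OF _ Linf_mult] Linf_mult[OF Linf_sum] Linf_mult[OF Q] P Q Apar_Linf Aperp_Linf)
  finally show ?thesis .
qed

lemma grad_L2: "u \<in> H1 \<Omega> \<Longrightarrow> (\<lambda>x. grad \<Omega> u x $ i) \<in> L2 \<Omega>"
  unfolding H1_def by (auto simp: grad_def intro: wderiv_props)

lemma H1_lin: "u \<in> H1 \<Omega> \<Longrightarrow> v \<in> H1 \<Omega> \<Longrightarrow> (\<lambda>x. s * u x + t * v x) \<in> H1 \<Omega>"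
  unfolding H1_def by (rule deriv_space_lin) (auto intro: smooth_coord_field)

lemma grad_lin:
  assumes "u \<in> H1 \<Omega>" "v \<in> H1 \<Omega>"
  shows "AE x in M. grad \<Omega> (\<lambda>x. s * u x + t * v x) x = s *\<^sub>R grad \<Omega> u x + t *\<^sub>R grad \<Omega> v x"
proof -
  have "AE x in M. wderiv \<Omega> (coord_field i) (\<lambda>x. s * u x + t * v x) x =
      s * wderiv \<Omega> (coord_field i) u x + t * wderiv \<Omega> (coord_field i) v x" for i
    using assms unfolding H1_def by (intro wderiv_lin[where C = "range coord_field"] smooth_coord_field) auto
  then have "AE x in M. \<forall>i\<in>UNIV. wderiv \<Omega> (coord_field i) (\<lambda>x. s * u x + t * v x) x =
      s * wderiv \<Omega> (coord_field i) u x + t * wderiv \<Omega> (coord_field i) v x"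
    by (intro AE_finite_allI) auto
  then show ?thesis by eventually_elim (simp add: Finite_Cartesian_Product.vec_eq_iff grad_def)
qed

lemma form_a_integrable:
  assumes "u \<in> H1 \<Omega>" "v \<in> H1 \<Omega>"
  shows "integrable M (\<lambda>x. (diffusion b Apar Aperp x *v grad \<Omega> u x) \<bullet> grad \<Omega> v x)"
proof -
  have "integrable M (\<lambda>x. \<Sum>i\<in>UNIV. \<Sum>j\<in>UNIV. diffusion b Apar Aperp x $ i $ j * (grad \<Omega> u x $ j * grad \<Omega> v x $ i))"
    by (intro Bochner_Integration.integrable_sum Linf_mult_integrable diffusion_Linf grad_L2 assms)
  then show ?thesis
    by (simp add: inner_vec_def matrix_vector_mult_def sum_distrib_right mult.assoc)
qed

lemma form_a_lin_left:
  assumes "u \<in> H1 \<Omega>" "v \<in> H1 \<Omega>" "w \<in> H1 \<Omega>"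
  shows "form_a \<Omega> b Apar Aperp (\<lambda>x. s * u x + t * v x) w =
    s * form_a \<Omega> b Apar Aperp u w + t * form_a \<Omega> b Apar Aperp v w"
proof -
  let ?D = "diffusion b Apar Aperp"
  have "form_a \<Omega> b Apar Aperp (\<lambda>x. s * u x + t * v x) w =
      integral\<^sup>L M (\<lambda>x. s * ((?D x *v grad \<Omega> u x) \<bullet> grad \<Omega> w x) + t * ((?D x *v grad \<Omega> v x) \<bullet> grad \<Omega> w x))"
    unfolding form_a_def
  proof (rule integral_cong_AE)
    show "AE x in M. (?D x *v grad \<Omega> (\<lambda>x. s * u x + t * v x) x) \<bullet> grad \<Omega> w x =
        s * ((?D x *v grad \<Omega> u x) \<bullet> grad \<Omega> w x) + t * ((?D x *v grad \<Omega> v x) \<bullet> grad \<Omega> w x)"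
      using grad_lin[OF assms(1,2), of s t]
      by eventually_elim (simp add: matrix_vector_right_distrib matrix_vector_mult_scaleR inner_add_left)
  qed (use form_a_integrable assms H1_lin in \<open>auto intro!: borel_measurable_integrable\<close>)
  also have "\<dots> = s * form_a \<Omega> b Apar Aperp u w + t * form_a \<Omega> b Apar Aperp v w"
    using form_a_integrable assms by (simp add: form_a_def Bochner_Integration.integral_add)
  finally show ?thesis .
qed

text \<open>\<open>Aperp\<close> may be nonsymmetric, so this does not follow from linearity on the
  left.\<close>

lemma form_a_lin_right:
  assumes "u \<in> H1 \<Omega>" "v \<in> H1 \<Omega>" "w \<in> H1 \<Omega>"
  shows "form_a \<Omega> b Apar Aperp w (\<lambda>x. s * u x + t * v x) =
    s * form_a \<Omega> b Apar Aperp w u + t * form_a \<Omega> b Apar Aperp w v"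
proof -
  let ?D = "diffusion b Apar Aperp"
  have "form_a \<Omega> b Apar Aperp w (\<lambda>x. s * u x + t * v x) =
      integral\<^sup>L M (\<lambda>x. s * ((?D x *v grad \<Omega> w x) \<bullet> grad \<Omega> u x) + t * ((?D x *v grad \<Omega> w x) \<bullet> grad \<Omega> v x))"
    unfolding form_a_def
  proof (rule integral_cong_AE)
    show "AE x in M. (?D x *v grad \<Omega> w x) \<bullet> grad \<Omega> (\<lambda>x. s * u x + t * v x) x =
        s * ((?D x *v grad \<Omega> w x) \<bullet> grad \<Omega> u x) + t * ((?D x *v grad \<Omega> w x) \<bullet> grad \<Omega> v x)"
      using grad_lin[OF assms(1,2), of s t]
      by eventually_elim (simp add: inner_add_right)
  qed (use form_a_integrable assms H1_lin in \<open>auto intro!: borel_measurable_integrable\<close>)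
  also have "\<dots> = s * form_a \<Omega> b Apar Aperp w u + t * form_a \<Omega> b Apar Aperp w v"
    using form_a_integrable assms by (simp add: form_a_def Bochner_Integration.integral_add)
  finally show ?thesis .
qed

text \<open>Makes the rules for derivatives along \<open>b\<close> applicable to functions in
  \<open>H1\<close>.\<close>

lemma H1_deriv_space_b:
  assumes "u \<in> H1 \<Omega>" shows "u \<in> deriv_space \<Omega> {b}"
proof -
  have "u \<in> L2 \<Omega>" using assms unfolding H1_def by (rule deriv_space_L2)
  then show ?thesis
    unfolding deriv_space_def using H1_imp_has_weak_deriv[OF assms smooth_b b_Linf] by blast
qed

lemma wderiv_b: "u \<in> H1 \<Omega> \<Longrightarrow> AE x in M. wderiv \<Omega> b u x = b x \<bullet> grad \<Omega> u x"
  by (intro wderiv_eqI H1_imp_has_weak_deriv smooth_b b_Linf)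

lemma form_par_eq: "form_par \<Omega> b Apar u v = integral\<^sup>L M (\<lambda>x. Apar x * (wderiv \<Omega> b u x * wderiv \<Omega> b v x))"
  unfolding form_par_def
proof (rule Bochner_Integration.integral_cong[OF refl])
  fix x assume "x \<in> space M"
  then have "b x \<bullet> b x = 1" using norm_b by (simp add: norm_eq_1)
  then show "Apar x * (grad_par \<Omega> b u x \<bullet> grad_par \<Omega> b v x) = Apar x * (wderiv \<Omega> b u x * wderiv \<Omega> b v x)"
    by (simp add: grad_par_def)
qed

lemma form_par_integrable:
  assumes "u \<in> H1 \<Omega>" "v \<in> H1 \<Omega>"
  shows "integrable M (\<lambda>x. Apar x * (wderiv \<Omega> b u x * wderiv \<Omega> b v x))"
  by (intro Linf_mult_integrable Apar_Linf wderiv_props(1)[OF H1_deriv_space_b] assms) auto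

lemma form_par_sym: "form_par \<Omega> b Apar u v = form_par \<Omega> b Apar v u"
  by (simp add: form_par_def inner_commute)

lemma form_par_lin_left:
  assumes "u \<in> H1 \<Omega>" "v \<in> H1 \<Omega>" "w \<in> H1 \<Omega>"
  shows "form_par \<Omega> b Apar (\<lambda>x. s * u x + t * v x) w =
    s * form_par \<Omega> b Apar u w + t * form_par \<Omega> b Apar v w"
proof -
  let ?w = "wderiv \<Omega> b"
  have "form_par \<Omega> b Apar (\<lambda>x. s * u x + t * v x) w =
      integral\<^sup>L M (\<lambda>x. s * (Apar x * (?w u x * ?w w x)) + t * (Apar x * (?w v x * ?w w x)))"
    unfolding form_par_eq
  proof (rule integral_cong_AE)
    show "AE x in M. Apar x * (?w (\<lambda>x. s * u x + t * v x) x * ?w w x) =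
        s * (Apar x * (?w u x * ?w w x)) + t * (Apar x * (?w v x * ?w w x))"
      using wderiv_lin[OF smooth_b singletonI H1_deriv_space_b[OF assms(1)] H1_deriv_space_b[OF assms(2)], of s t]
      by eventually_elim (simp add: algebra_simps)
  qed (use form_par_integrable assms H1_lin in \<open>auto intro!: borel_measurable_integrable\<close>)
  also have "\<dots> = s * form_par \<Omega> b Apar u w + t * form_par \<Omega> b Apar v w"
    using form_par_integrable assms by (simp add: form_par_eq Bochner_Integration.integral_add)
  finally show ?thesis .
qed

lemma AE_coeff: "AE x in M. A0 \<le> Apar x \<and> (\<forall>v. v \<bullet> b x = 0 \<longrightarrow> A0 * (norm v)\<^sup>2 \<le> v \<bullet> (Aperp x *v v))"
proof -
  have "AE x in M. A0 \<le> Apar x \<and> Apar x \<le> A1 \<and>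
      (\<forall>v. v \<bullet> b x = 0 \<longrightarrow> A0 * (norm v)\<^sup>2 \<le> v \<bullet> (Aperp x *v v) \<and> v \<bullet> (Aperp x *v v) \<le> A1 * (norm v)\<^sup>2)"
    using coeff by (simp add: coefficients_def)
  then show ?thesis by eventually_elim blast
qed

lemma A0_pos: "0 < A0"
  using coeff by (simp add: coefficients_def)

text \<open>\<open>u\<close> is arbitrary: the integrand is nonnegative almost everywhere, and if it
  is not integrable its integral is 0 by convention.\<close>

lemma form_par_nonneg: "0 \<le> form_par \<Omega> b Apar u u"
  unfolding form_par_eq
proof (rule integral_nonneg_AE)
  show "AE x in M. 0 \<le> Apar x * (wderiv \<Omega> b u x * wderiv \<Omega> b u x)"
    using AE_coeff
  proof eventually_elim
    case (elim x)
    then have "0 \<le> Apar x" using A0_pos by linarith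
    then show ?case by simp
  qed
qed

text \<open>By \<open>diffusion_quadratic\<close> the integrands differ by the perpendicular part,
  which is nonnegative by ellipticity on vectors orthogonal to \<open>b\<close>.\<close>

lemma form_par_le_form_a:
  assumes "u \<in> H1 \<Omega>"
  shows "form_par \<Omega> b Apar u u \<le> form_a \<Omega> b Apar Aperp u u"
  unfolding form_par_eq form_a_def
proof (rule integral_mono_AE)
  have "AE x in M. norm (b x) = 1" by (rule AE_M) (rule norm_b)
  then show "AE x in M. Apar x * (wderiv \<Omega> b u x * wderiv \<Omega> b u x) \<le>
      (diffusion b Apar Aperp x *v grad \<Omega> u x) \<bullet> grad \<Omega> u x"
    using AE_coeff wderiv_b[OF assms]
  proof eventually_elim
    case (elim x)
    let ?q = "grad \<Omega> u x - (b x \<bullet> grad \<Omega> u x) *\<^sub>R b x"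
    have "0 \<le> A0 * (norm ?q)\<^sup>2" using A0_pos by simp
    also have "\<dots> \<le> ?q \<bullet> (Aperp x *v ?q)"
      using elim(2)[THEN conjunct2, rule_format, OF diffusion_quadratic(2)[of b x "grad \<Omega> u x", OF elim(1)]] .
    finally show ?case
      unfolding diffusion_quadratic(1)[of b x, OF elim(1)] elim(3) by (simp add: power2_eq_square)
  qed
qed (intro form_par_integrable form_a_integrable assms)+

end

section \<open>Condition numbers of continuous families of matrices\<close>

lemma abs_euclid_norm_le:
  assumes "i < dim_vec v" shows "\<bar>vec_index v i\<bar> \<le> euclid_norm v"
proof -
  have "(vec_index v i)\<^sup>2 \<le> (\<Sum>j<dim_vec v. (vec_index v j)\<^sup>2)"
    by (rule member_le_sum) (use assms in auto)
  then have "sqrt ((vec_index v i)\<^sup>2) \<le> sqrt (\<Sum>j<dim_vec v. (vec_index v j)\<^sup>2)" by (rule real_sqrt_le_mono)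
  then show ?thesis
    by (simp add: euclid_norm_def scalar_prod_def power2_eq_square lessThan_atLeast0)
qed

lemma euclid_norm_nonneg: "0 \<le> euclid_norm v"
  unfolding euclid_norm_def scalar_prod_def by (intro real_sqrt_ge_zero sum_nonneg) simp

lemma euclid_norm_le_sum: "euclid_norm v \<le> (\<Sum>i<dim_vec v. \<bar>vec_index v i\<bar>)"
  using L2_set_le_sum_abs[of "vec_index v" "{..<dim_vec v}"]
  by (simp add: L2_set_def euclid_norm_def scalar_prod_def power2_eq_square lessThan_atLeast0)

text \<open>A majorant of the 2-norm that is visibly continuous in the entries. Its crudeness is
  harmless, since only boundedness in the parameter is claimed.\<close>

definition entry_sum :: "real mat \<Rightarrow> real" where
  "entry_sum A = (\<Sum>i<dim_row A. \<Sum>j<dim_col A. \<bar>A $$ (i, j)\<bar>)"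

lemma entry_sum_nonneg: "0 \<le> entry_sum A"
  by (simp add: entry_sum_def sum_nonneg)

lemma euclid_norm_mult_le:
  assumes "v \<in> carrier_vec (dim_col A)"
  shows "euclid_norm (A *\<^sub>v v) \<le> entry_sum A * euclid_norm v"
proof -
  have "euclid_norm (A *\<^sub>v v) \<le> (\<Sum>i<dim_row A. \<bar>vec_index (A *\<^sub>v v) i\<bar>)"
    using euclid_norm_le_sum[of "A *\<^sub>v v"] by simp
  also have "\<dots> \<le> (\<Sum>i<dim_row A. \<Sum>j<dim_col A. \<bar>A $$ (i, j)\<bar> * euclid_norm v)"
  proof (rule sum_mono)
    fix i assume i: "i \<in> {..<dim_row A}"
    have "vec_index (A *\<^sub>v v) i = (\<Sum>j<dim_col A. A $$ (i, j) * vec_index v j)"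
      using i assms by (simp add: scalar_prod_def lessThan_atLeast0)
    also have "\<bar>\<dots>\<bar> \<le> (\<Sum>j<dim_col A. \<bar>A $$ (i, j) * vec_index v j\<bar>)" by (rule sum_abs)
    also have "\<dots> \<le> (\<Sum>j<dim_col A. \<bar>A $$ (i, j)\<bar> * euclid_norm v)"
      using assms by (intro sum_mono) (auto simp: abs_mult intro!: mult_left_mono abs_euclid_norm_le)
    finally show "\<bar>vec_index (A *\<^sub>v v) i\<bar> \<le> (\<Sum>j<dim_col A. \<bar>A $$ (i, j)\<bar> * euclid_norm v)" .
  qed
  also have "\<dots> = entry_sum A * euclid_norm v"
    by (simp add: entry_sum_def sum_distrib_right)
  finally show ?thesis .
qed

lemma mat_norm2_bounds: "0 \<le> mat_norm2 A" "mat_norm2 A \<le> entry_sum A"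
proof -
  have b: "euclid_norm (A *\<^sub>v v) / euclid_norm v \<le> entry_sum A" if "v \<in> carrier_vec (dim_col A)" for v
    using euclid_norm_mult_le[OF that] euclid_norm_nonneg[of v] entry_sum_nonneg[of A]
    by (cases "euclid_norm v = 0") (auto simp: divide_le_eq)
  show "mat_norm2 A \<le> entry_sum A"
    unfolding mat_norm2_def by (rule cSUP_least[OF _ b]) (auto intro: zero_carrier_vec)
  \<comment> \<open>A real supremum dominates its members only if the set is bounded above. The
    member at the zero vector is a quotient by 0, hence nonnegative, also in dimension 0.\<close>
  have "bdd_above ((\<lambda>v. euclid_norm (A *\<^sub>v v) / euclid_norm v) ` carrier_vec (dim_col A))"
    by (rule bdd_aboveI2[OF b])
  then have "euclid_norm (A *\<^sub>v 0\<^sub>v (dim_col A)) / euclid_norm (0\<^sub>v (dim_col A) :: real Matrix.vec) \<le> mat_norm2 A"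
    unfolding mat_norm2_def by (rule cSUP_upper[OF zero_carrier_vec])
  then show "0 \<le> mat_norm2 A"
    using divide_nonneg_nonneg[OF euclid_norm_nonneg euclid_norm_nonneg] order_trans by blast
qed

text \<open>By the Leibniz formula the determinant is a polynomial in the entries.\<close>

lemma continuous_on_det:
  fixes A :: "real \<Rightarrow> real mat"
  assumes "\<And>t. A t \<in> carrier_mat n n" "\<And>i j. i < n \<Longrightarrow> j < n \<Longrightarrow> continuous_on S (\<lambda>t. A t $$ (i, j))"
  shows "continuous_on S (\<lambda>t. det (A t))"
proof -
  have "continuous_on S (\<lambda>t. \<Sum>p | p permutes {0..<n}. signof p * (\<Prod>i = 0..<n. A t $$ (i, p i)))"
    by (intro continuous_on_sum continuous_on_mult continuous_on_const continuous_on_prod assms(2))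
       (use permutes_in_image in fastforce)+
  then show ?thesis by (simp add: det_def'[OF assms(1)])
qed

text \<open>Gives the inverse as a rational expression in the entries; the description of
  \<open>inverse_mat\<close> by \<open>THE\<close> does not reveal continuity.\<close>

definition adj_inverse :: "real mat \<Rightarrow> real mat" where
  "adj_inverse A = (1 / det A) \<cdot>\<^sub>m adj_mat A"

lemma adj_inverse:
  assumes A: "A \<in> carrier_mat n n" and d: "det A \<noteq> 0"
  shows "adj_inverse A \<in> carrier_mat n n" "A * adj_inverse A = 1\<^sub>m n" "adj_inverse A * A = 1\<^sub>m n"
proof -
  note adj = adj_mat[OF A]
  show "adj_inverse A \<in> carrier_mat n n" using adj by (simp add: adj_inverse_def)
  show "A * adj_inverse A = 1\<^sub>m n"
    unfolding adj_inverse_def mult_smult_distrib[OF A adj(1)] adj(2)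
    by (rule eq_matI) (use d in auto)
  show "adj_inverse A * A = 1\<^sub>m n"
    unfolding adj_inverse_def mult_smult_assoc_mat[OF adj(1) A] adj(3)
    by (rule eq_matI) (use d in auto)
qed

lemma continuous_on_adj_inverse:
  fixes A :: "real \<Rightarrow> real mat"
  assumes A: "\<And>t. A t \<in> carrier_mat n n" "\<And>i j. i < n \<Longrightarrow> j < n \<Longrightarrow> continuous_on S (\<lambda>t. A t $$ (i, j))"
    and d: "\<And>t. t \<in> S \<Longrightarrow> det (A t) \<noteq> 0" and ij: "i < n" "j < n"
  shows "continuous_on S (\<lambda>t. adj_inverse (A t) $$ (i, j))"
proof -
  have dim: "dim_row (A t) = n" "dim_col (A t) = n" for t using A(1)[of t] by auto
  have "continuous_on S (\<lambda>t. det (mat_delete (A t) j i))"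
  proof (rule continuous_on_det[where n = "n - 1"])
    show "mat_delete (A t) j i \<in> carrier_mat (n - 1) (n - 1)" for t
      by (rule mat_delete_carrier[OF A(1)])
    show "continuous_on S (\<lambda>t. mat_delete (A t) j i $$ (i', j'))" if "i' < n - 1" "j' < n - 1" for i' j'
      using that by (simp add: mat_delete_def dim) (intro conjI impI; rule A(2); simp)+
  qed
  \<comment> \<open>The adjugate is the transposed cofactor matrix, hence the exchanged
    indices.\<close>
  then have "continuous_on S (\<lambda>t. 1 / det (A t) * ((-1) ^ (j + i) * det (mat_delete (A t) j i)))"
    using d by (intro continuous_on_mult continuous_on_divide continuous_on_const continuous_on_det[OF A]) auto
  then show ?thesis
    using ij by (simp add: adj_inverse_def adj_mat_def dim cofactor_def)
qed

lemma continuous_on_entry_sum: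
  assumes A: "\<And>t. A t \<in> carrier_mat n n" "\<And>i j. i < n \<Longrightarrow> j < n \<Longrightarrow> continuous_on S (\<lambda>t. A t $$ (i, j))"
  shows "continuous_on S (\<lambda>t. entry_sum (A t))"
proof -
  have dim: "dim_row (A t) = n" "dim_col (A t) = n" for t using A(1)[of t] by auto
  show ?thesis unfolding entry_sum_def dim
    by (intro continuous_on_sum continuous_on_rabs A(2)) auto
qed

lemma inverse_mat_eq_adj_inverse:
  assumes A: "A \<in> carrier_mat n n" and d: "det A \<noteq> 0"
  shows "inverse_mat A = adj_inverse A"
  unfolding inverse_mat_def
proof (rule the_equality)
  note I = adj_inverse[OF A d]
  show "inverts_mat A (adj_inverse A) \<and> inverts_mat (adj_inverse A) A"
    using I A by (auto simp: inverts_mat_def)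
  fix B assume B: "inverts_mat A B \<and> inverts_mat B A"
  then have AB: "A * B = 1\<^sub>m n" and BA: "B * A = 1\<^sub>m (dim_row B)"
    using A by (auto simp: inverts_mat_def)
  \<comment> \<open>\<open>inverts_mat\<close> does not prescribe the shape of \<open>B\<close>;
    comparing column counts in the two products recovers it.\<close>
  have "dim_col B = n" using arg_cong[OF AB, of dim_col] by simp
  moreover have "dim_row B = n" using arg_cong[OF BA, of dim_col] A by simp
  ultimately have Bc: "B \<in> carrier_mat n n" by auto
  have "B = B * (A * adj_inverse A)" using I(2) Bc by simp
  also have "\<dots> = (B * A) * adj_inverse A" using Bc A I(1) by (simp add: assoc_mult_mat)
  also have "\<dots> = adj_inverse A" using BA Bc I(1) by simp
  finally show "B = adj_inverse A" .
qed

text \<open>Both 2-norms are estimated by entry sums, whose product is continuous and hence bounded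
  on the compact set \<open>S\<close>.\<close>

lemma cond2_bounded:
  fixes A :: "real \<Rightarrow> real mat"
  assumes A: "\<And>t. A t \<in> carrier_mat n n" "\<And>i j. i < n \<Longrightarrow> j < n \<Longrightarrow> continuous_on S (\<lambda>t. A t $$ (i, j))"
    and S: "compact S" and d: "\<And>t. t \<in> S \<Longrightarrow> det (A t) \<noteq> 0"
  shows "\<exists>\<kappa>. \<forall>t\<in>S. invertible_mat (A t) \<and> cond2 (A t) \<le> \<kappa>"
proof -
  have dim: "dim_row (A t) = n" "dim_col (A t) = n" for t using A(1)[of t] by auto
  have Ic: "adj_inverse (A t) \<in> carrier_mat n n" for t
    using adj_mat(1)[OF A(1)[of t]] by (simp add: adj_inverse_def)
  have "bounded ((\<lambda>t. entry_sum (A t) * entry_sum (adj_inverse (A t))) ` S)"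
    by (intro compact_imp_bounded compact_continuous_image S continuous_on_mult
        continuous_on_entry_sum[OF A] continuous_on_entry_sum[OF Ic] continuous_on_adj_inverse[OF A d])
  then obtain \<kappa> where \<kappa>: "\<And>t. t \<in> S \<Longrightarrow> entry_sum (A t) * entry_sum (adj_inverse (A t)) \<le> \<kappa>"
    unfolding bounded_real by (meson abs_le_D1 image_eqI)
  have "invertible_mat (A t) \<and> cond2 (A t) \<le> \<kappa>" if t: "t \<in> S" for t
  proof
    have "inverts_mat (A t) (adj_inverse (A t)) \<and> inverts_mat (adj_inverse (A t)) (A t)"
      using adj_inverse[OF A(1) d[OF t]] dim[of t] by (auto simp: inverts_mat_def)
    then show "invertible_mat (A t)"
      using dim[of t] by (auto simp: invertible_mat_def)
    have "cond2 (A t) \<le> entry_sum (A t) * entry_sum (adj_inverse (A t))"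
      unfolding cond2_def inverse_mat_eq_adj_inverse[OF A(1) d[OF t]]
      by (intro mult_mono mat_norm2_bounds entry_sum_nonneg)
    then show "cond2 (A t) \<le> \<kappa>" using \<kappa>[OF t] by linarith
  qed
  then show ?thesis by blast
qed

section \<open>The abstract discrete problem\<close>

definition lin_closed :: "'n field set \<Rightarrow> bool" where
  "lin_closed V \<longleftrightarrow> (\<lambda>_. 0) \<in> V \<and> (\<forall>u\<in>V. \<forall>v\<in>V. \<forall>s t. (\<lambda>x. s * u x + t * v x) \<in> V)"

text \<open>Linearity is asked for on \<open>V\<close> only, in the shape of the corresponding
  clause of \<open>in_dual\<close>.\<close>

definition lin_on :: "'n field set \<Rightarrow> ('n field \<Rightarrow> real) \<Rightarrow> bool" where
  "lin_on V g \<longleftrightarrow> (\<forall>u\<in>V. \<forall>v\<in>V. \<forall>s t. g (\<lambda>x. s * u x + t * v x) = s * g u + t * g v)"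

lemma lin_closed_zero: "lin_closed V \<Longrightarrow> (\<lambda>_. 0) \<in> V"
  by (simp add: lin_closed_def)

lemma lin_closedD: "lin_closed V \<Longrightarrow> u \<in> V \<Longrightarrow> v \<in> V \<Longrightarrow> (\<lambda>x. s * u x + t * v x) \<in> V"
  by (simp add: lin_closed_def)

lemma lin_onD: "lin_on V g \<Longrightarrow> u \<in> V \<Longrightarrow> v \<in> V \<Longrightarrow> g (\<lambda>x. s * u x + t * v x) = s * g u + t * g v"
  by (simp add: lin_on_def)

lemma lin_on_zero: "lin_closed V \<Longrightarrow> lin_on V g \<Longrightarrow> g (\<lambda>_. 0) = 0"
  using lin_onD[of V g "\<lambda>_. 0" "\<lambda>_. 0" 0 0] by (simp add: lin_closed_zero)

lemma lin_closed_sum: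
  fixes n :: nat
  assumes V: "lin_closed V" and e: "\<And>i. i < n \<Longrightarrow> e i \<in> V"
  shows "(\<lambda>x. \<Sum>i<n. c i * e i x) \<in> V"
  using e
proof (induction n)
  case 0
  then show ?case using lin_closed_zero[OF V] by simp
next
  case (Suc n)
  have "(\<lambda>x. 1 * (\<Sum>i<n. c i * e i x) + c n * e n x) \<in> V"
    by (rule lin_closedD[OF V Suc.IH]) (use Suc.prems in auto)
  then show ?case by simp
qed

lemma lin_on_sum:
  fixes n :: nat
  assumes V: "lin_closed V" and g: "lin_on V g" and e: "\<And>i. i < n \<Longrightarrow> e i \<in> V"
  shows "g (\<lambda>x. \<Sum>i<n. c i * e i x) = (\<Sum>i<n. c i * g (e i))"
  using e
proof (induction n)
  case 0
  then show ?case using lin_on_zero[OF V g] by simp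
next
  case (Suc n)
  have "g (\<lambda>x. 1 * (\<Sum>i<n. c i * e i x) + c n * e n x) = 1 * g (\<lambda>x. \<Sum>i<n. c i * e i x) + c n * g (e n)"
    by (rule lin_onD[OF g lin_closed_sum[OF V]]) (use Suc.prems in auto)
  then show ?case using Suc by simp
qed

lemma sum_lessThan_add: "(\<Sum>i<m + n. f i) = (\<Sum>i<m. f i) + (\<Sum>j<n. f (m + j))" for f :: "nat \<Rightarrow> real"
  by (induction n) (auto simp: add.assoc)

lemma form_C_eq:
  "form_C a ap \<epsilon> x y = a (fst x) (fst y) + (1 - \<epsilon>) * ap (snd x) (fst y) + ap (fst x) (snd y) - \<epsilon> * ap (snd x) (snd y)"
  by (simp add: form_C_def case_prod_beta)

text \<open>Collects what the finite element setting on one mesh supplies. Linearity is restricted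
  to \<open>V\<close>, where weak derivatives exist, whereas symmetry and nonnegativity of
  \<open>ap\<close> hold for arbitrary fields.\<close>

locale discrete_problem =
  fixes V L :: "'n field set" and a ap :: "'n form" and \<beta> :: real
  assumes V: "lin_closed V" and L: "lin_closed L" and LV: "L \<subseteq> V"
    and a_left: "w \<in> V \<Longrightarrow> lin_on V (\<lambda>u. a u w)" and a_right: "u \<in> V \<Longrightarrow> lin_on V (a u)"
    and ap_left: "w \<in> V \<Longrightarrow> lin_on V (\<lambda>u. ap u w)" and ap_sym: "ap u v = ap v u"
    and ap_nonneg: "0 \<le> ap u u" and ap_le_a: "u \<in> V \<Longrightarrow> ap u u \<le> a u u"
    and \<beta>: "\<beta> > 0"
    and inf_sup: "\<epsilon> \<in> {0..1} \<Longrightarrow> ereal \<beta> \<le> inf_sup (V \<times> L) (X_norm a ap V \<epsilon>) (form_C a ap \<epsilon>)"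
begin

abbreviation C where "C \<equiv> form_C a ap"
abbreviation nX where "nX \<equiv> X_norm a ap V"
abbreviation na where "na \<equiv> form_norm a"
abbreviation np where "np \<equiv> form_norm ap"

lemma LV': "q \<in> L \<Longrightarrow> q \<in> V"
  using LV by blast

lemma ap_right: "u \<in> V \<Longrightarrow> lin_on V (ap u)"
  using ap_left[of u] ap_sym by (simp add: lin_on_def)

lemma a_nonneg: "u \<in> V \<Longrightarrow> 0 \<le> a u u"
  using ap_le_a ap_nonneg order_trans by blast

lemma norms_nonneg: "u \<in> V \<Longrightarrow> 0 \<le> na u" "0 \<le> np u" "u \<in> V \<Longrightarrow> np u \<le> na u"
  using a_nonneg ap_nonneg ap_le_a by (simp_all add: form_norm_def)

text \<open>The discriminant argument, with the degenerate case apart because \<open>ap\<close> is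
  only known to be semidefinite.\<close>

lemma ap_Cauchy_Schwarz:
  assumes u: "u \<in> V" and v: "v \<in> V"
  shows "\<bar>ap u v\<bar> \<le> np u * np v"
proof -
  have quad: "0 \<le> s\<^sup>2 * ap u u + 2 * s * t * ap u v + t\<^sup>2 * ap v v" for s t
  proof -
    let ?w = "\<lambda>x. s * u x + t * v x"
    have w: "?w \<in> V" by (rule lin_closedD[OF V u v])
    have "ap ?w ?w = s * ap u ?w + t * ap v ?w" by (rule lin_onD[OF ap_left[OF w] u v])
    also have "ap u ?w = s * ap u u + t * ap u v" by (rule lin_onD[OF ap_right[OF u] u v])
    also have "ap v ?w = s * ap u v + t * ap v v" using lin_onD[OF ap_right[OF v] u v] ap_sym[of v u] by simp
    finally show ?thesis using ap_nonneg[of ?w] by (simp add: power2_eq_square algebra_simps)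
  qed
  have "(ap u v)\<^sup>2 \<le> ap u u * ap v v"
  proof (cases "ap v v = 0")
    case True
    have "ap u v = 0"
    proof (rule ccontr)
      assume n: "ap u v \<noteq> 0"
      \<comment> \<open>With \<open>ap v v = 0\<close> the quadratic is affine in \<open>t\<close>;
        this value of \<open>t\<close> makes it -1.\<close>
      have "0 \<le> ap u u + 2 * (- (ap u u + 1) / (2 * ap u v)) * ap u v"
        using quad[of 1 "- (ap u u + 1) / (2 * ap u v)"] True by simp
      also have "\<dots> = -1" using n by (simp add: field_simps)
      finally show False by simp
    qed
    then show ?thesis using True by simp
  next
    case False
    then have pos: "0 < ap v v" using ap_nonneg[of v] by linarith
    \<comment> \<open>The minimising coefficients, scaled by \<open>ap v v\<close> to avoid a
      division.\<close>
    have "0 \<le> ap v v * (ap u u * ap v v - (ap u v)\<^sup>2)"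
      using quad[of "ap v v" "- ap u v"] by (simp add: power2_eq_square algebra_simps)
    then show ?thesis using pos by (simp add: zero_le_mult_iff)
  qed
  then have "sqrt ((ap u v)\<^sup>2) \<le> sqrt (ap u u * ap v v)" by (rule real_sqrt_le_mono)
  then show ?thesis by (simp add: form_norm_def real_sqrt_mult)
qed

lemma ap_bound: "u \<in> V \<Longrightarrow> v \<in> V \<Longrightarrow> \<bar>ap u v\<bar> \<le> np u * na v"
  using ap_Cauchy_Schwarz mult_left_mono[OF norms_nonneg(3) norms_nonneg(2)] order_trans by blast

lemma na_le_nX:
  assumes "u \<in> V" "0 \<le> \<epsilon>" shows "na u \<le> nX \<epsilon> (u, q)"
proof -
  have "sqrt ((na u)\<^sup>2) \<le> nX \<epsilon> (u, q)"
    unfolding X_norm_def using assms(2) by (simp only: case_prod_conv) (intro real_sqrt_le_mono, simp)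
  then show ?thesis using norms_nonneg(1)[OF assms(1)] by simp
qed

lemma np_le_nX:
  assumes "0 \<le> \<epsilon>" shows "sqrt \<epsilon> * np q \<le> nX \<epsilon> (u, q)"
proof -
  have "sqrt (\<epsilon> * (np q)\<^sup>2) \<le> nX \<epsilon> (u, q)"
    unfolding X_norm_def by (simp only: case_prod_conv) (intro real_sqrt_le_mono, simp)
  then show ?thesis using norms_nonneg(2) by (simp add: real_sqrt_mult)
qed

lemma nX_nonneg: "0 \<le> \<epsilon> \<Longrightarrow> 0 \<le> nX \<epsilon> x"
  by (simp add: X_norm_def case_prod_beta)

text \<open>The inf-sup condition, read as an a priori estimate; for \<open>D = 0\<close> it gives uniqueness.\<close>

lemma stability:
  assumes \<epsilon>: "\<epsilon> \<in> {0..1}" and x: "u \<in> V" "q \<in> L" "(u, q) \<noteq> (\<lambda>_. 0, \<lambda>_. 0)"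
    and D: "0 \<le> D" "\<And>v w. v \<in> V \<Longrightarrow> w \<in> L \<Longrightarrow> C \<epsilon> (u, q) (v, w) \<le> D * nX \<epsilon> (v, w)"
  shows "0 < nX \<epsilon> (u, q)" "nX \<epsilon> (u, q) \<le> D / \<beta>"
proof -
  let ?n = "nX \<epsilon> (u, q)"
  let ?X = "V \<times> L - {(\<lambda>_. 0, \<lambda>_. 0)}"
  have n0: "0 \<le> nX \<epsilon> y" for y using \<epsilon> by (intro nX_nonneg) auto
  \<comment> \<open>The supremum is taken in \<open>ereal\<close>, where it exists without any
    bound; a real bound \<open>r\<close> of the quotients at the fixed pair then dominates
    \<beta>.\<close>
  have le: "\<beta> \<le> r" if r: "\<And>y. y \<in> V \<times> L \<Longrightarrow> C \<epsilon> (u, q) y / (?n * nX \<epsilon> y) \<le> r" for r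
  proof -
    have "ereal \<beta> \<le> (SUP y\<in>?X. ereal (C \<epsilon> (u, q) y / (?n * nX \<epsilon> y)))"
      using inf_sup[OF \<epsilon>] x unfolding inf_sup_def by (meson DiffI INF_lower SigmaI order_trans singletonD)
    also have "\<dots> \<le> ereal r" by (intro SUP_least) (use r in auto)
    finally show ?thesis by simp
  qed
  show pos: "0 < ?n"
  proof (rule ccontr)
    assume "\<not> 0 < ?n"
    then have "?n = 0" using n0[of "(u, q)"] by linarith
    \<comment> \<open>Every quotient has denominator 0 and is therefore 0, so 0 is such a
      bound.\<close>
    then have "\<beta> \<le> 0" by (intro le) simp
    then show False using \<beta> by simp
  qed
  have "\<beta> \<le> D / ?n"
  proof (rule le)
    fix y assume y: "y \<in> V \<times> L"
    then have Cy: "C \<epsilon> (u, q) y \<le> D * nX \<epsilon> y" using D(2)[of "fst y" "snd y"] by (auto simp: mem_Times_iff)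
    show "C \<epsilon> (u, q) y / (?n * nX \<epsilon> y) \<le> D / ?n"
    proof (cases "nX \<epsilon> y = 0")
      case True
      then show ?thesis using D(1) n0[of "(u, q)"] by simp
    next
      case False
      then have "0 < nX \<epsilon> y" using n0[of y] by linarith
      then show ?thesis using Cy pos by (simp add: divide_simps mult.commute)
    qed
  qed
  then show "?n \<le> D / \<beta>" using pos \<beta> by (simp add: field_simps)
qed

text \<open>Handles the pair excluded from \<open>stability\<close>. The supremum in
  \<open>star_norm\<close> is here over the constant 0.\<close>

lemma nX_zero: "nX \<epsilon> (\<lambda>_. 0, \<lambda>_. 0) = 0"
proof -
  have z: "(\<lambda>_. 0) \<in> V" by (rule lin_closed_zero[OF V])
  have "ap (\<lambda>_. 0) v = 0" if "v \<in> V" for v by (rule lin_on_zero[OF V ap_left[OF that]])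
  then have "star_norm a ap V (\<lambda>_. 0) = (SUP v\<in>V. 0)"
    unfolding star_norm_def by (intro SUP_cong refl) simp
  also have "\<dots> = 0" using z by (intro cSUP_const) auto
  finally show ?thesis
    using lin_on_zero[OF V ap_left[OF z]] lin_on_zero[OF V a_left[OF z]]
    by (simp add: X_norm_def form_norm_def)
qed

lemma stability':
  assumes "\<epsilon> \<in> {0..1}" "u \<in> V" "q \<in> L"
    and "0 \<le> D" "\<And>v w. v \<in> V \<Longrightarrow> w \<in> L \<Longrightarrow> C \<epsilon> (u, q) (v, w) \<le> D * nX \<epsilon> (v, w)"
  shows "nX \<epsilon> (u, q) \<le> D / \<beta>"
proof (cases "(u, q) = (\<lambda>_. 0, \<lambda>_. 0)")
  case True
  then show ?thesis using nX_zero assms(4) \<beta> by simp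
qed (use stability(2)[OF assms(1-3) _ assms(4,5)] in blast)

text \<open>Testing with \<open>(v, 0)\<close> and \<open>(0, w)\<close> splits \<open>C\<close> into the two equations of the discrete problem.\<close>

definition eq1 where "eq1 \<epsilon> u q v = a u v + (1 - \<epsilon>) * ap q v"
definition eq2 where "eq2 \<epsilon> u q w = ap u w - \<epsilon> * ap q w"

lemma C_eq: "C \<epsilon> (u, q) (v, w) = eq1 \<epsilon> u q v + eq2 \<epsilon> u q w"
  by (simp add: form_C_def eq1_def eq2_def)

lemma lin_eq1: "u \<in> V \<Longrightarrow> q \<in> V \<Longrightarrow> lin_on V (eq1 \<epsilon> u q)"
  using a_right[of u] ap_right[of q] by (simp add: lin_on_def eq1_def algebra_simps)

lemma lin_eq2: "u \<in> V \<Longrightarrow> q \<in> V \<Longrightarrow> lin_on L (eq2 \<epsilon> u q)"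
  using ap_right[of u] ap_right[of q] LV' by (simp add: lin_on_def eq2_def algebra_simps)

text \<open>The dual splitting: for a fixed test pair, \<open>C\<close> is a functional of
  \<open>u\<close> plus a functional of \<open>q\<close>. It provides linearity of \<open>C\<close>
  in the trial pair, hence the treatment of differences and of matrix columns.\<close>

definition col1 where "col1 \<epsilon> v w u = a u v + ap u w"
definition col2 where "col2 \<epsilon> v w q = (1 - \<epsilon>) * ap q v - \<epsilon> * ap q w"

lemma C_eq_col: "C \<epsilon> (u, q) (v, w) = col1 \<epsilon> v w u + col2 \<epsilon> v w q"
  by (simp add: form_C_def col1_def col2_def)

lemma lin_col1: "v \<in> V \<Longrightarrow> w \<in> V \<Longrightarrow> lin_on V (col1 \<epsilon> v w)"
  using a_left[of v] ap_left[of w] by (simp add: lin_on_def col1_def algebra_simps)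

lemma lin_col2: "v \<in> V \<Longrightarrow> w \<in> V \<Longrightarrow> lin_on L (col2 \<epsilon> v w)"
  using ap_left[of v] ap_left[of w] LV' by (simp add: lin_on_def col2_def algebra_simps)

lemma discrete_solution_eq:
  "discrete_solution a ap V L \<epsilon> f u q \<longleftrightarrow> u \<in> V \<and> q \<in> L \<and> (\<forall>v\<in>V. eq1 \<epsilon> u q v = f v) \<and> (\<forall>w\<in>L. eq2 \<epsilon> u q w = 0)"
  by (simp add: discrete_solution_def eq1_def eq2_def)

lemma solution_unique:
  assumes \<epsilon>: "\<epsilon> \<in> {0..1}"
    and "discrete_solution a ap V L \<epsilon> f u q" "discrete_solution a ap V L \<epsilon> f u' q'"
  shows "u = u' \<and> q = q'"
proof -
  have s: "u \<in> V" "q \<in> L" "\<And>v. v \<in> V \<Longrightarrow> eq1 \<epsilon> u q v = f v" "\<And>w. w \<in> L \<Longrightarrow> eq2 \<epsilon> u q w = 0"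
    and s': "u' \<in> V" "q' \<in> L" "\<And>v. v \<in> V \<Longrightarrow> eq1 \<epsilon> u' q' v = f v" "\<And>w. w \<in> L \<Longrightarrow> eq2 \<epsilon> u' q' w = 0"
    using assms(2,3) by (auto simp: discrete_solution_eq)
  \<comment> \<open>Differences are written with coefficients 1 and -1 to match
    \<open>lin_closed\<close> and \<open>lin_on\<close>.\<close>
  let ?u = "\<lambda>x. 1 * u x + (-1) * u' x" and ?q = "\<lambda>x. 1 * q x + (-1) * q' x"
  have "(?u, ?q) = (\<lambda>_. 0, \<lambda>_. 0)"
  proof (rule ccontr)
    assume n: "(?u, ?q) \<noteq> (\<lambda>_. 0, \<lambda>_. 0)"
    have uq: "?u \<in> V" "?q \<in> L"
      by (rule lin_closedD[OF V s(1) s'(1)], rule lin_closedD[OF L s(2) s'(2)])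
    have "C \<epsilon> (?u, ?q) (v, w) \<le> 0 * nX \<epsilon> (v, w)" if v: "v \<in> V" and w: "w \<in> L" for v w
    proof -
      have "C \<epsilon> (?u, ?q) (v, w) = C \<epsilon> (u, q) (v, w) - C \<epsilon> (u', q') (v, w)"
        unfolding C_eq_col lin_onD[OF lin_col1[OF v LV'[OF w]] s(1) s'(1)] lin_onD[OF lin_col2[OF v LV'[OF w]] s(2) s'(2)]
        by simp
      also have "\<dots> = 0" using s s' v w by (simp add: C_eq)
      finally show ?thesis by simp
    qed
    from stability[OF \<epsilon> uq n order_refl this] show False by simp
  qed
  then show ?thesis by (auto simp: fun_eq_iff)
qed

text \<open>The right-hand side acts on \<open>v\<close> alone, and \<open>na v\<close> is at most
  the norm of \<open>(v, w)\<close>, so a bound for \<open>f\<close> is one for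
  \<open>C \<epsilon> (u, q)\<close>.\<close>

lemma solution_bound:
  assumes \<epsilon>: "\<epsilon> \<in> {0..1}" and sol: "discrete_solution a ap V L \<epsilon> f u q"
    and D: "0 \<le> D" "\<And>v. v \<in> V \<Longrightarrow> f v \<le> D * na v"
  shows "nX \<epsilon> (u, q) \<le> D / \<beta>"
proof (rule stability'[OF \<epsilon> _ _ D(1)])
  have s: "u \<in> V" "q \<in> L" "\<And>v. v \<in> V \<Longrightarrow> eq1 \<epsilon> u q v = f v" "\<And>w. w \<in> L \<Longrightarrow> eq2 \<epsilon> u q w = 0"
    using sol by (auto simp: discrete_solution_eq)
  show "u \<in> V" "q \<in> L" by fact+
  fix v w assume v: "v \<in> V" and w: "w \<in> L"
  have "C \<epsilon> (u, q) (v, w) \<le> D * na v" using s v w D(2) by (simp add: C_eq)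
  also have "\<dots> \<le> D * nX \<epsilon> (v, w)"
    using \<epsilon> by (intro mult_left_mono D(1) na_le_nX v) auto
  finally show "C \<epsilon> (u, q) (v, w) \<le> D * nX \<epsilon> (v, w)" .
qed

text \<open>The difference to the limit solution solves the discrete problem with right-hand side
  \<open>\<epsilon> a\<^sub>\<parallel>(q\<^sub>0, v + w)\<close>, and \<open>\<epsilon> |w|\<^sub>\<parallel>\<close> is at most \<open>\<surd>\<epsilon>\<close> times the norm of \<open>(v, w)\<close>.\<close>

lemma solution_convergence_bound:
  assumes \<epsilon>: "\<epsilon> \<in> {0..1}" and sol: "discrete_solution a ap V L \<epsilon> f u q" "discrete_solution a ap V L 0 f u0 q0"
  shows "nX \<epsilon> (\<lambda>x. u x - u0 x, \<lambda>x. q x - q0 x) \<le> (\<epsilon> + sqrt \<epsilon>) * np q0 / \<beta>"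
proof -
  have e0: "0 \<le> \<epsilon>" using \<epsilon> by simp
  have s: "u \<in> V" "q \<in> L" "\<And>v. v \<in> V \<Longrightarrow> eq1 \<epsilon> u q v = f v" "\<And>w. w \<in> L \<Longrightarrow> eq2 \<epsilon> u q w = 0"
    and s0: "u0 \<in> V" "q0 \<in> L" "\<And>v. v \<in> V \<Longrightarrow> eq1 0 u0 q0 v = f v" "\<And>w. w \<in> L \<Longrightarrow> eq2 0 u0 q0 w = 0"
    using sol by (auto simp: discrete_solution_eq)
  let ?u = "\<lambda>x. 1 * u x + (-1) * u0 x" and ?q = "\<lambda>x. 1 * q x + (-1) * q0 x"
  have "nX \<epsilon> (?u, ?q) \<le> ((\<epsilon> + sqrt \<epsilon>) * np q0) / \<beta>"
  proof (rule stability'[OF \<epsilon>])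
    show "?u \<in> V" "?q \<in> L"
      by (rule lin_closedD[OF V s(1) s0(1)], rule lin_closedD[OF L s(2) s0(2)])
    show "0 \<le> (\<epsilon> + sqrt \<epsilon>) * np q0" using e0 norms_nonneg(2) by simp
    fix v w assume v: "v \<in> V" and w: "w \<in> L"
    have q0V: "q0 \<in> V" and wV: "w \<in> V" using s0(2) w LV' by auto
    have "C \<epsilon> (?u, ?q) (v, w) = C \<epsilon> (u, q) (v, w) - C \<epsilon> (u0, q0) (v, w)"
      unfolding C_eq_col lin_onD[OF lin_col1[OF v wV] s(1) s0(1)] lin_onD[OF lin_col2[OF v wV] s(2) s0(2)]
      by simp
    \<comment> \<open>Both solutions have the same right-hand side, so
      \<open>C \<epsilon> (u, q) (v, w)\<close> and \<open>C 0 (u0, q0) (v, w)\<close> both equal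
      \<open>f v\<close>.\<close>
    also have "\<dots> = C 0 (u0, q0) (v, w) - C \<epsilon> (u0, q0) (v, w)" using s s0 v w by (simp add: C_eq)
    also have "\<dots> = \<epsilon> * ap q0 v + \<epsilon> * ap q0 w" by (simp add: form_C_def algebra_simps)
    also have "\<dots> \<le> \<epsilon> * (np q0 * na v) + \<epsilon> * (np q0 * np w)"
      using ap_bound[OF q0V v] ap_Cauchy_Schwarz[OF q0V wV] e0 by (intro add_mono mult_left_mono) auto
    \<comment> \<open>Writing \<epsilon> as a product of square roots isolates
      \<open>sqrt \<epsilon> * np w\<close>, which the weighted term of the norm controls.\<close>
    also have "\<dots> = \<epsilon> * np q0 * na v + sqrt \<epsilon> * np q0 * (sqrt \<epsilon> * np w)"
      using e0 by (simp add: algebra_simps)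
    also have "\<dots> \<le> \<epsilon> * np q0 * nX \<epsilon> (v, w) + sqrt \<epsilon> * np q0 * nX \<epsilon> (v, w)"
      using e0 norms_nonneg(2) by (intro add_mono mult_left_mono na_le_nX np_le_nX v) auto
    finally show "C \<epsilon> (?u, ?q) (v, w) \<le> (\<epsilon> + sqrt \<epsilon>) * np q0 * nX \<epsilon> (v, w)"
      by (simp add: algebra_simps)
  qed
  then show ?thesis by simp
qed

lemma solution_convergence:
  assumes "\<And>\<epsilon>. \<epsilon> \<in> {0..1} \<Longrightarrow> discrete_solution a ap V L \<epsilon> f (u \<epsilon>) (q \<epsilon>)"
  shows "((\<lambda>\<epsilon>. nX \<epsilon> (\<lambda>x. u \<epsilon> x - u 0 x, \<lambda>x. q \<epsilon> x - q 0 x)) \<longlongrightarrow> 0) (at_right 0)"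
proof (rule tendsto_sandwich[OF _ _ tendsto_const])
  have ev: "\<forall>\<^sub>F \<epsilon> in at_right 0. \<epsilon> \<in> {0<..<1::real}" by (rule eventually_at_right_real) simp
  show "\<forall>\<^sub>F \<epsilon> in at_right 0. 0 \<le> nX \<epsilon> (\<lambda>x. u \<epsilon> x - u 0 x, \<lambda>x. q \<epsilon> x - q 0 x)"
    using ev by eventually_elim (simp add: nX_nonneg)
  show "\<forall>\<^sub>F \<epsilon> in at_right 0. nX \<epsilon> (\<lambda>x. u \<epsilon> x - u 0 x, \<lambda>x. q \<epsilon> x - q 0 x) \<le> (\<epsilon> + sqrt \<epsilon>) * np (q 0) / \<beta>"
    using ev by eventually_elim (auto intro!: solution_convergence_bound assms)
  have "((\<lambda>\<epsilon>. (\<epsilon> + sqrt \<epsilon>) * np (q 0) / \<beta>) \<longlongrightarrow> (0 + sqrt 0) * np (q 0) / \<beta>) (at_right 0)"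
    using \<beta> by (intro tendsto_intros) auto
  then show "((\<lambda>\<epsilon>. (\<epsilon> + sqrt \<epsilon>) * np (q 0) / \<beta>) \<longlongrightarrow> 0) (at_right 0)" by simp
qed

section \<open>The linear system in given bases\<close>

context
  fixes N M :: nat and e l :: "nat \<Rightarrow> 'n field"
  assumes e: "is_basis V N e" and l: "is_basis L M l"
begin

abbreviation S where "S \<epsilon> \<equiv> system_matrix a ap \<epsilon> N e M l"
abbreviation pb where "pb \<equiv> product_basis N e l"

definition comb1 where "comb1 c = (\<lambda>x. \<Sum>i<N. vec_index c i * e i x)"
definition comb2 where "comb2 c = (\<lambda>x. \<Sum>j<M. vec_index c (N + j) * l j x)"

lemma basis_in: "i < N \<Longrightarrow> e i \<in> V" "j < M \<Longrightarrow> l j \<in> L"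
  using e l by (auto simp: is_basis_def)

lemma comb_in: "comb1 c \<in> V" "comb2 c \<in> L"
  unfolding comb1_def comb2_def by (intro lin_closed_sum V L basis_in; assumption)+

lemma S_carrier: "S \<epsilon> \<in> carrier_mat (N + M) (N + M)"
  by (simp add: system_matrix_def)

text \<open>In \<open>system_matrix\<close> columns carry the trial and rows the test functions, and
  \<open>C\<close> is linear in the trial pair. Multiplying by coefficients therefore evaluates the
  form at the combined pair.\<close>

lemma S_mult_vec:
  assumes c: "c \<in> carrier_vec (N + M)" and i: "i < N + M"
  shows "vec_index (S \<epsilon> *\<^sub>v c) i = C \<epsilon> (comb1 c, comb2 c) (pb i)"
proof -
  have z: "(\<lambda>_. 0) \<in> V" "(\<lambda>_. 0) \<in> L" using lin_closed_zero V L by auto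
  have "fst (pb i) \<in> V \<and> snd (pb i) \<in> V"
    using i z basis_in LV' by (simp add: product_basis_def)
  then obtain v w where vw: "pb i = (v, w)" "v \<in> V" "w \<in> V"
    by (metis prod.collapse)
  \<comment> \<open>Each basis pair has a zero component, which must contribute nothing.\<close>
  have z1: "col1 \<epsilon> v w (\<lambda>_. 0) = 0" "col2 \<epsilon> v w (\<lambda>_. 0) = 0"
    using lin_on_zero[OF V lin_col1[OF vw(2,3)]] lin_on_zero[OF L lin_col2[OF vw(2,3)]] by auto
  have "vec_index (S \<epsilon> *\<^sub>v c) i = (\<Sum>j<N + M. C \<epsilon> (pb j) (v, w) * vec_index c j)"
    using c i by (simp add: system_matrix_def scalar_prod_def lessThan_atLeast0 vw(1))
  also have "\<dots> = (\<Sum>j<N. vec_index c j * col1 \<epsilon> v w (e j)) + (\<Sum>j<M. vec_index c (N + j) * col2 \<epsilon> v w (l j))"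
    unfolding sum_lessThan_add by (simp add: product_basis_def C_eq_col z1 mult.commute)
  also have "\<dots> = col1 \<epsilon> v w (comb1 c) + col2 \<epsilon> v w (comb2 c)"
    unfolding comb1_def comb2_def
    by (simp add: lin_on_sum[OF V lin_col1[OF vw(2,3)]] lin_on_sum[OF L lin_col2[OF vw(2,3)]] basis_in)
  finally show ?thesis by (simp add: C_eq_col vw(1))
qed

text \<open>Each equation is linear in its test function, so testing with a basis suffices.\<close>

lemma solves_if_basis:
  assumes u: "u \<in> V" and q: "q \<in> L" and f: "lin_on V f"
    and 1: "\<And>i. i < N \<Longrightarrow> C \<epsilon> (u, q) (pb i) = f (e i)"
    and 2: "\<And>i. N \<le> i \<Longrightarrow> i < N + M \<Longrightarrow> C \<epsilon> (u, q) (pb i) = 0"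
  shows "discrete_solution a ap V L \<epsilon> f u q"
proof -
  note lin = lin_eq1[OF u LV'[OF q], of \<epsilon>] lin_eq2[OF u LV'[OF q], of \<epsilon>]
  have z: "eq1 \<epsilon> u q (\<lambda>_. 0) = 0" "eq2 \<epsilon> u q (\<lambda>_. 0) = 0"
    using lin_on_zero[OF V lin(1)] lin_on_zero[OF L lin(2)] by auto
  have b1: "eq1 \<epsilon> u q (e i) = f (e i)" if "i < N" for i
    using 1[OF that] that z by (simp add: product_basis_def C_eq)
  have b2: "eq2 \<epsilon> u q (l j) = 0" if "j < M" for j
    using 2[of "N + j"] that z by (simp add: product_basis_def C_eq)
  have "eq1 \<epsilon> u q v = f v" if "v \<in> V" for v
  proof -
    have "\<forall>v\<in>V. \<exists>c. v = (\<lambda>x. \<Sum>i<N. c i * e i x)" using e by (simp add: is_basis_def)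
    from bspec[OF this that] obtain c where c: "v = (\<lambda>x. \<Sum>i<N. c i * e i x)" by (rule exE)
    show ?thesis by (simp add: c lin_on_sum[OF V lin(1)] lin_on_sum[OF V f] basis_in b1)
  qed
  moreover have "eq2 \<epsilon> u q w = 0" if "w \<in> L" for w
  proof -
    have "\<forall>w\<in>L. \<exists>c. w = (\<lambda>x. \<Sum>i<M. c i * l i x)" using l by (simp add: is_basis_def)
    from bspec[OF this that] obtain c where c: "w = (\<lambda>x. \<Sum>i<M. c i * l i x)" by (rule exE)
    show ?thesis by (simp add: c lin_on_sum[OF L lin(2)] basis_in b2)
  qed
  ultimately show ?thesis using u q by (simp add: discrete_solution_eq)
qed

text \<open>A kernel vector yields a solution for right-hand side 0. By uniqueness it is the zero
  pair, and independence of the bases makes all coefficients 0.\<close>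

lemma det_S_nonzero:
  assumes \<epsilon>: "\<epsilon> \<in> {0..1}" shows "det (S \<epsilon>) \<noteq> 0"
proof
  assume "det (S \<epsilon>) = 0"
  then obtain c where c: "c \<in> carrier_vec (N + M)" "c \<noteq> 0\<^sub>v (N + M)" "S \<epsilon> *\<^sub>v c = 0\<^sub>v (N + M)"
    using det_0_iff_vec_prod_zero[OF S_carrier] by blast
  have Cz: "C \<epsilon> (comb1 c, comb2 c) (pb i) = 0" if "i < N + M" for i
    using S_mult_vec[OF c(1) that, of \<epsilon>] c(3) that by simp
  have "discrete_solution a ap V L \<epsilon> (\<lambda>_. 0) (comb1 c) (comb2 c)"
    by (rule solves_if_basis[OF comb_in]) (use Cz in \<open>auto simp: lin_on_def\<close>)
  moreover have "discrete_solution a ap V L \<epsilon> (\<lambda>_. 0) (\<lambda>_. 0) (\<lambda>_. 0)"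
  proof -
    have z: "(\<lambda>_. 0) \<in> V" "(\<lambda>_. 0) \<in> L" using lin_closed_zero V L by auto
    have "a (\<lambda>_. 0) v = 0" "ap (\<lambda>_. 0) v = 0" if "v \<in> V" for v
      using lin_on_zero[OF V a_left[OF that]] lin_on_zero[OF V ap_left[OF that]] by auto
    then show ?thesis using z LV' by (simp add: discrete_solution_def)
  qed
  ultimately have z: "comb1 c = (\<lambda>_. 0)" "comb2 c = (\<lambda>_. 0)" using solution_unique[OF \<epsilon>] by blast+
  have "vec_index c i = 0" if "i < N" for i
    using z(1) e that unfolding comb1_def is_basis_def by blast
  moreover have "\<forall>j<M. vec_index c (N + j) = 0"
    using z(2) l unfolding comb2_def is_basis_def by (elim conjE allE[of _ "\<lambda>j. vec_index c (N + j)"]) blast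
  then have "vec_index c i = 0" if "N \<le> i" "i < N + M" for i
    using that by (metis add_less_cancel_left le_Suc_ex)
  ultimately have "c = 0\<^sub>v (N + M)"
    using c(1) by (intro eq_vecI) (auto simp: not_le[symmetric] intro: le_less_linear)
  then show False using c(2) by simp
qed

lemma solution_exists:
  assumes \<epsilon>: "\<epsilon> \<in> {0..1}" and f: "lin_on V f"
  shows "\<exists>u q. discrete_solution a ap V L \<epsilon> f u q"
proof -
  \<comment> \<open>The second equation is homogeneous, so the load vector is 0 in the block
    belonging to \<open>l\<close>.\<close>
  define F where "F = Matrix.vec (N + M) (\<lambda>i. if i < N then f (e i) else 0)"
  note I = adj_inverse[OF S_carrier det_S_nonzero[OF \<epsilon>]]
  let ?c = "adj_inverse (S \<epsilon>) *\<^sub>v F"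
  have F: "F \<in> carrier_vec (N + M)" by (simp add: F_def)
  have c: "?c \<in> carrier_vec (N + M)" using I(1) F by simp
  have "S \<epsilon> *\<^sub>v ?c = F"
    using assoc_mult_mat_vec[OF S_carrier I(1) F, of \<epsilon>] I(2) F by simp
  then have "C \<epsilon> (comb1 ?c, comb2 ?c) (pb i) = (if i < N then f (e i) else 0)" if "i < N + M" for i
    using S_mult_vec[OF c that, of \<epsilon>] that by (simp add: F_def)
  then have "discrete_solution a ap V L \<epsilon> f (comb1 ?c) (comb2 ?c)"
    by (intro solves_if_basis[OF comb_in f]) auto
  then show ?thesis by blast
qed

lemma system_cond2_bounded: "\<exists>\<kappa>. \<forall>\<epsilon>\<in>{0..1}. invertible_mat (S \<epsilon>) \<and> cond2 (S \<epsilon>) \<le> \<kappa>"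
proof (rule cond2_bounded[OF S_carrier _ compact_Icc det_S_nonzero])
  show "continuous_on {0..1} (\<lambda>\<epsilon>. S \<epsilon> $$ (i, j))" if "i < N + M" "j < N + M" for i j
    \<comment> \<open>Every entry is affine in \<epsilon>.\<close>
    using that by (simp add: system_matrix_def form_C_eq) (intro continuous_intros)
qed

end

end

section \<open>The finite element spaces\<close>

lemma sum_fun_apply: "(\<Sum>w\<in>B. f w) x = (\<Sum>w\<in>B. (f w x :: real))"
  by (induction B rule: infinite_finite_induct) (auto simp: zero_fun_def plus_fun_def)

text \<open>\<open>B\<close> may lie outside \<open>V\<close>, so the basis cannot be extracted from
  it. A maximal independent subset of \<open>V\<close> is taken instead; it is finite because it
  lies in the span of a finite set.\<close>

lemma basis_of_finite_span:
  fixes V :: "'n field set"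
  assumes fin: "finite B"
    and span: "\<And>v. v \<in> V \<Longrightarrow> \<exists>c. v = (\<lambda>x. \<Sum>w\<in>B. c w * w x)"
  shows "\<exists>N e. is_basis V N e"
proof -
  let ?scale = "\<lambda>(s::real) (u::'n field) x. s * u x"
  interpret F: vector_space ?scale
    by unfold_locales (auto simp: fun_eq_iff algebra_simps)
  have sum_scale: "(\<Sum>w\<in>A. ?scale (c w) (g w)) = (\<lambda>x. \<Sum>w\<in>A. c w * g w x)" for A c and g :: "'i \<Rightarrow> 'n field"
    by (simp add: fun_eq_iff sum_fun_apply)
  obtain E where E: "E \<subseteq> V" "F.independent E" "V \<subseteq> F.span E"
    using F.maximal_independent_subset by blast
  have "V \<subseteq> F.span B"
  proof
    fix v assume "v \<in> V"
    then obtain c where "v = (\<lambda>x. \<Sum>w\<in>B. c w * w x)" using span by blast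
    then have "v = (\<Sum>w\<in>B. ?scale (c w) w)" by (simp add: sum_scale)
    also have "\<dots> \<in> F.span B" by (intro F.span_sum F.span_scale F.span_base)
    finally show "v \<in> F.span B" .
  qed
  then have "E \<subseteq> F.span B" using E(1) by blast
  then have finE: "finite E" using F.independent_span_bound[OF fin E(2)] by blast
  obtain e where e: "bij_betw e {..<card E} E"
    using ex_bij_betw_nat_finite[OF finE] by (auto simp: lessThan_atLeast0)
  have reindex: "(\<lambda>x. \<Sum>w\<in>E. c w * w x) = (\<lambda>x. \<Sum>i<card E. c (e i) * e i x)" for c
    using sum.reindex_bij_betw[OF e, of "\<lambda>w. c w * w _"] by (simp add: fun_eq_iff)
  have "is_basis V (card E) e"
    unfolding is_basis_def
  proof (intro conjI allI impI ballI)
    show "e i \<in> V" if "i < card E" for i using e E(1) that by (auto simp: bij_betw_def)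
    show "\<exists>c. v = (\<lambda>x. \<Sum>i<card E. c i * e i x)" if "v \<in> V" for v
    proof -
      have "v \<in> F.span E" using E(3) that by blast
      then obtain u where "v = (\<Sum>w\<in>E. ?scale (u w) w)" unfolding F.span_finite[OF finE] by blast
      then have "v = (\<lambda>x. \<Sum>i<card E. u (e i) * e i x)" by (simp add: sum_scale reindex)
      then show ?thesis by (rule exI[of _ "\<lambda>i. u (e i)"])
    qed
    fix c i assume z: "(\<lambda>x. \<Sum>i<card E. c i * e i x) = (\<lambda>_. 0)" and i: "i < card E"
    \<comment> \<open>Independence speaks of coefficients indexed by vectors,
      \<open>is_basis\<close> of coefficients indexed by numbers; inverting the enumeration
      translates.\<close>
    define u where "u w = c (inv_into {..<card E} e w)" for w
    have ue: "u (e j) = c j" if "j < card E" for j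
      using e that by (simp add: u_def bij_betw_def inv_into_f_f)
    have "(\<Sum>w\<in>E. ?scale (u w) w) = (\<lambda>x. \<Sum>i<card E. u (e i) * e i x)"
      by (simp only: sum_scale reindex)
    also have "\<dots> = (\<lambda>x. \<Sum>i<card E. c i * e i x)" by (intro ext sum.cong refl) (simp add: ue)
    also have "\<dots> = 0" using z by (simp add: zero_fun_def)
    finally have "u (e i) = 0"
      using F.independentD[OF E(2) finE order_refl, of u "e i"] e i by (auto simp: bij_betw_def)
    then show "c i = 0" using ue[OF i] by simp
  qed
  then show ?thesis by blast
qed

section \<open>Polynomials on a cell\<close>

lemma local_fe_RectanglesD:
  fixes R :: "real^'n^'n"
  assumes "local_fe Rectangles k K v" "orthogonal_matrix R" "K = (*v) R ` cbox l r"
  shows "\<exists>p\<in>Qk k. \<forall>y\<in>cbox l r. v (R *v y) = p y"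
proof -
  have "orthogonal_matrix R \<and> K = (*v) R ` cbox l r \<longrightarrow> (\<exists>p\<in>Qk k. \<forall>y\<in>cbox l r. v (R *v y) = p y)"
    using assms(1) unfolding local_fe.simps by (elim allE)
  then show ?thesis using assms(2,3) by blast
qed

lemma polys_lin: "p \<in> polys I \<Longrightarrow> q \<in> polys I \<Longrightarrow> (\<lambda>x. s * p x + t * q x) \<in> polys I"
proof -
  assume "p \<in> polys I" "q \<in> polys I"
  then obtain c d where "p = (\<lambda>x. \<Sum>\<alpha>\<in>I. c \<alpha> * (\<Prod>i\<in>UNIV. (x $ i) ^ \<alpha> i))"
      "q = (\<lambda>x. \<Sum>\<alpha>\<in>I. d \<alpha> * (\<Prod>i\<in>UNIV. (x $ i) ^ \<alpha> i))"
    by (auto simp: polys_def)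
  then have "(\<lambda>x. s * p x + t * q x) = (\<lambda>x. \<Sum>\<alpha>\<in>I. (s * c \<alpha> + t * d \<alpha>) * (\<Prod>i\<in>UNIV. (x $ i) ^ \<alpha> i))"
    by (simp add: sum_distrib_left sum.distrib distrib_right mult.assoc)
  then show "(\<lambda>x. s * p x + t * q x) \<in> polys I"
    unfolding polys_def by (intro CollectI exI[of _ "\<lambda>\<alpha>. s * c \<alpha> + t * d \<alpha>"])
qed

lemma polys_zero: "(\<lambda>x. 0) \<in> polys I"
  unfolding polys_def by (intro CollectI exI[of _ "\<lambda>_. 0"]) simp

lemma local_fe_lin:
  assumes "local_fe kind k K u" "local_fe kind k K v"
  shows "local_fe kind k K (\<lambda>x. s * u x + t * v x)"
proof (cases kind)
  case Simplices
  then obtain p q where pq: "p \<in> Pk k" "q \<in> Pk k" "\<forall>x\<in>K. u x = p x" "\<forall>x\<in>K. v x = q x"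
    using assms by auto
  have "(\<lambda>x. s * p x + t * q x) \<in> Pk k" using pq(1,2) unfolding Pk_def by (rule polys_lin)
  then show ?thesis unfolding Simplices local_fe.simps by (rule bexI[rotated]) (simp add: pq(3,4))
next
  case Rectangles
  have "\<exists>p\<in>Qk k. \<forall>y\<in>cbox l r. s * u (R *v y) + t * v (R *v y) = p y"
    if R: "orthogonal_matrix R" "K = (*v) R ` cbox l r" for R :: "real^'a^'a" and l r
  proof -
    obtain p where p: "p \<in> Qk k" "\<forall>y\<in>cbox l r. u (R *v y) = p y"
      using local_fe_RectanglesD[OF assms(1)[unfolded Rectangles] R] by (rule bexE)
    obtain q where q: "q \<in> Qk k" "\<forall>y\<in>cbox l r. v (R *v y) = q y"
      using local_fe_RectanglesD[OF assms(2)[unfolded Rectangles] R] by (rule bexE)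
    have "(\<lambda>x. s * p x + t * q x) \<in> Qk k" using p(1) q(1) unfolding Qk_def by (rule polys_lin)
    then show ?thesis by (rule bexI[rotated]) (simp add: p(2) q(2))
  qed
  then show ?thesis unfolding Rectangles local_fe.simps by (intro allI impI) (elim conjE)
qed

lemma local_fe_zero: "local_fe kind k K (\<lambda>_. 0)"
proof (cases kind)
  case Simplices
  have "(\<lambda>x. 0) \<in> Pk k" unfolding Pk_def by (rule polys_zero)
  then show ?thesis unfolding Simplices local_fe.simps by (rule bexI[rotated]) simp
next
  case Rectangles
  have "(\<lambda>x. 0) \<in> Qk k" unfolding Qk_def by (rule polys_zero)
  then show ?thesis unfolding Rectangles local_fe.simps by (intro allI impI bexI[of _ "\<lambda>x. 0"]) simp_all
qed

lemma finite_exponents: "finite {\<alpha> :: 'n::finite \<Rightarrow> nat. \<forall>i. \<alpha> i \<le> k}"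
proof -
  have "{\<alpha> :: 'n \<Rightarrow> nat. \<forall>i. \<alpha> i \<le> k} = PiE UNIV (\<lambda>_. {..k})" by (auto simp: PiE_def)
  then show ?thesis by (simp add: finite_PiE)
qed

text \<open>The functions \<open>F\<close> are monomials of bounded degree. On a rectangle one
  admissible rotation is fixed and the monomials are taken in the coordinates along its edges,
  obtained by applying the transpose, which is the inverse.\<close>

lemma local_fe_finite_span:
  assumes "cell kind (K :: (real^'n) set)"
  shows "\<exists>(I :: ('n \<Rightarrow> nat) set) F. finite I \<and>
    (\<forall>v. local_fe kind k K v \<longrightarrow> (\<exists>c. \<forall>x\<in>K. v x = (\<Sum>\<alpha>\<in>I. c \<alpha> * F \<alpha> x)))"
proof (cases kind)
  case Simplices
  let ?I = "{\<alpha> :: 'n \<Rightarrow> nat. (\<Sum>i\<in>UNIV. \<alpha> i) \<le> k}"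
  have "?I \<subseteq> {\<alpha>. \<forall>i. \<alpha> i \<le> k}"
    by (auto intro: order_trans[OF member_le_sum[OF UNIV_I]])
  then have "finite ?I" using finite_exponents finite_subset by blast
  moreover have "\<exists>c. \<forall>x\<in>K. v x = (\<Sum>\<alpha>\<in>?I. c \<alpha> * (\<Prod>i\<in>UNIV. (x $ i) ^ \<alpha> i))" if "local_fe kind k K v" for v
    using that Simplices by (auto simp: Pk_def polys_def)
  ultimately show ?thesis
    by (intro exI[of _ ?I] exI[of _ "\<lambda>\<alpha> x. \<Prod>i\<in>UNIV. (x $ i) ^ \<alpha> i"]) simp
next
  case Rectangles
  let ?I = "{\<alpha> :: 'n \<Rightarrow> nat. \<forall>i. \<alpha> i \<le> k}"
  obtain R :: "real^'n^'n" and l r where R: "orthogonal_matrix R" "K = (*v) R ` cbox l r"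
    using assms Rectangles by auto
  have "\<exists>c. \<forall>x\<in>K. v x = (\<Sum>\<alpha>\<in>?I. c \<alpha> * (\<Prod>i\<in>UNIV. ((transpose R *v x) $ i) ^ \<alpha> i))" if v: "local_fe kind k K v" for v
  proof -
    obtain p where p: "p \<in> Qk k" "\<forall>y\<in>cbox l r. v (R *v y) = p y"
      using local_fe_RectanglesD[OF v[unfolded Rectangles] R] by (rule bexE)
    obtain c where c: "p = (\<lambda>x. \<Sum>\<alpha>\<in>?I. c \<alpha> * (\<Prod>i\<in>UNIV. (x $ i) ^ \<alpha> i))"
      using p(1) unfolding Qk_def polys_def by blast
    have "transpose R *v (R *v y) = y" for y
      using R(1) by (simp add: matrix_vector_mul_assoc orthogonal_matrix)
    then show ?thesis using p(2) by (intro exI[of _ c]) (simp add: R(2) c)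
  qed
  then show ?thesis using finite_exponents[of k]
    by (intro exI[of _ ?I] exI[of _ "\<lambda>\<alpha> x. \<Prod>i\<in>UNIV. ((transpose R *v x) $ i) ^ \<alpha> i"]) simp
qed

text \<open>Each point of the closed domain is assigned to one cell containing it, and the local
  monomials are cut off to the points assigned to their cell. Such functions may be discontinuous
  and outside the space, which \<open>basis_of_finite_span\<close> permits.\<close>

lemma fe_space_finite_span:
  assumes mesh: "fe_mesh kind \<Omega> T"
  shows "\<exists>B. finite B \<and> (\<forall>v\<in>fe_space kind k \<Omega> b T. \<exists>c. v = (\<lambda>x. \<Sum>w\<in>B. c w * w x))"
proof -
  have T: "finite T" "\<And>K. K \<in> T \<Longrightarrow> cell kind K" "\<Union>T = closure \<Omega>"
    using mesh by (auto simp: fe_mesh_def)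
  have "\<forall>K\<in>T. \<exists>(I :: ('a \<Rightarrow> nat) set) F. finite I \<and>
      (\<forall>v. local_fe kind k K v \<longrightarrow> (\<exists>c. \<forall>x\<in>K. v x = (\<Sum>\<alpha>\<in>I. c \<alpha> * F \<alpha> x)))"
    using local_fe_finite_span T(2) by blast
  then obtain I :: "(real^'a) set \<Rightarrow> ('a \<Rightarrow> nat) set" and F where
    IF: "\<And>K. K \<in> T \<Longrightarrow> finite (I K)"
      "\<And>K v. K \<in> T \<Longrightarrow> local_fe kind k K v \<Longrightarrow> \<exists>c. \<forall>x\<in>K. v x = (\<Sum>\<alpha>\<in>I K. c \<alpha> * F K \<alpha> x)"
    by metis
  \<comment> \<open>Cells share faces; selecting one cell per point keeps values there from being
    counted twice.\<close>
  define \<kappa> where "\<kappa> x = (SOME K. K \<in> T \<and> x \<in> K)" for x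
  have \<kappa>: "\<kappa> x \<in> T \<and> x \<in> \<kappa> x" if "x \<in> closure \<Omega>" for x
  proof -
    have "\<exists>K. K \<in> T \<and> x \<in> K" using that T(3) by blast
    then show ?thesis unfolding \<kappa>_def by (rule someI_ex)
  qed
  define G where "G = (\<lambda>(K, \<alpha>) x. if x \<in> closure \<Omega> \<and> \<kappa> x = K then F K \<alpha> x else 0)"
  define J where "J = Sigma T I"
  have J: "finite J" unfolding J_def using T(1) IF(1) by (intro finite_SigmaI)
  have "\<exists>c. v = (\<lambda>x. \<Sum>w\<in>G ` J. c w * w x)" if v: "v \<in> fe_space kind k \<Omega> b T" for v
  proof -
    have "\<forall>K\<in>T. \<exists>c. \<forall>x\<in>K. v x = (\<Sum>\<alpha>\<in>I K. c \<alpha> * F K \<alpha> x)"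
      using v IF(2) by (auto simp: fe_space_def)
    then obtain c where c: "\<And>K x. K \<in> T \<Longrightarrow> x \<in> K \<Longrightarrow> v x = (\<Sum>\<alpha>\<in>I K. c K \<alpha> * F K \<alpha> x)"
      by metis
    have "v x = (\<Sum>j\<in>J. c (fst j) (snd j) * G j x)" for x
    proof (cases "x \<in> closure \<Omega>")
      case True
      have "(\<Sum>j\<in>J. c (fst j) (snd j) * G j x) = (\<Sum>K\<in>T. \<Sum>\<alpha>\<in>I K. c K \<alpha> * G (K, \<alpha>) x)"
        unfolding J_def using T(1) IF(1) by (subst sum.Sigma) (auto simp: case_prod_beta)
      also have "\<dots> = (\<Sum>K\<in>T. if K = \<kappa> x then (\<Sum>\<alpha>\<in>I K. c K \<alpha> * F K \<alpha> x) else 0)"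
        using True by (intro sum.cong refl) (auto simp: G_def)
      also have "\<dots> = v x" using T(1) \<kappa>[OF True] c[of "\<kappa> x" x] by simp
      finally show ?thesis by simp
    next
      case False
      then have "v x = 0" using v by (simp add: fe_space_def)
      then show ?thesis using False by (simp add: G_def case_prod_beta)
    qed
    \<comment> \<open>Distinct indices may give the same function, so coefficients are added over
      the fibres of \<open>G\<close>.\<close>
    also have "(\<Sum>j\<in>J. c (fst j) (snd j) * G j x) =
        (\<Sum>w\<in>G ` J. (\<Sum>j\<in>{j\<in>J. G j = w}. c (fst j) (snd j)) * w x)" for x
      unfolding sum.image_gen[OF J, of _ G] sum_distrib_right by (intro sum.cong refl) auto
    finally have "v = (\<lambda>x. \<Sum>w\<in>G ` J. (\<Sum>j\<in>{j\<in>J. G j = w}. c (fst j) (snd j)) * w x)" by (rule ext)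
    then show ?thesis by (rule exI[of _ "\<lambda>w. \<Sum>j\<in>{j\<in>J. G j = w}. c (fst j) (snd j)"])
  qed
  then show ?thesis using J by blast
qed

context bounded_open begin

lemma fe_space_lin_closed: "lin_closed (fe_space kind k \<Omega> b T)"
proof -
  have "(\<lambda>x. s * u x + t * v x) \<in> fe_space kind k \<Omega> b T"
    if "u \<in> fe_space kind k \<Omega> b T" "v \<in> fe_space kind k \<Omega> b T" for u v s t
    using that by (auto simp: fe_space_def intro!: space_V_lin continuous_intros local_fe_lin)
  moreover have "(\<lambda>_. 0) \<in> fe_space kind k \<Omega> b T"
    by (auto simp: fe_space_def intro: zero_space_V local_fe_zero)
  ultimately show ?thesis by (simp add: lin_closed_def)
qed

lemma space_Lin_lin_closed: "smooth_field b \<Longrightarrow> lin_closed (space_Lin \<Omega> b)"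
  by (simp add: lin_closed_def zero_space_Lin space_Lin_lin)

end

lemma lin_closed_Int: "lin_closed V \<Longrightarrow> lin_closed W \<Longrightarrow> lin_closed (V \<inter> W)"
  by (simp add: lin_closed_def)

lemma space_V_subset_H1: "space_V \<Omega> b \<subseteq> H1 \<Omega>"
  by (auto simp: space_V_def)

lemma fe_space_subset_V: "fe_space kind k \<Omega> b T \<subseteq> space_V \<Omega> b"
  by (auto simp: fe_space_def)

text \<open>The constant in \<open>in_dual\<close> bounds the quotients, so \<open>dual_norm\<close>
  really dominates them. Where the norm of \<open>v\<close> is 0 the quotient carries no
  information, and \<open>in_dual\<close> itself forces \<open>f v = 0\<close>.\<close>

lemma in_dual_bound:
  assumes f: "in_dual W a f" and W: "\<And>v. v \<in> W \<Longrightarrow> 0 \<le> a v v" and W0: "(\<lambda>_. 0) \<in> W"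
  shows "0 \<le> dual_norm W a f" "v \<in> W \<Longrightarrow> f v \<le> dual_norm W a f * form_norm a v"
proof -
  obtain C where C: "\<And>v. v \<in> W \<Longrightarrow> \<bar>f v\<bar> \<le> C * form_norm a v"
    using f unfolding in_dual_def by blast
  have n: "0 \<le> form_norm a v" if "v \<in> W" for v using W[OF that] by (simp add: form_norm_def)
  \<comment> \<open>The absolute value covers quotients with denominator 0, which are 0 although
    \<open>C\<close> might be negative.\<close>
  have "\<bar>f v\<bar> / form_norm a v \<le> \<bar>C\<bar>" if "v \<in> W" for v
  proof (cases "form_norm a v = 0")
    case False
    then have "0 < form_norm a v" using n[OF that] by simp
    then have "\<bar>f v\<bar> / form_norm a v \<le> C" using C[OF that] by (simp add: divide_le_eq)
    then show ?thesis by linarith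
  qed simp
  then have bdd: "bdd_above ((\<lambda>v. \<bar>f v\<bar> / form_norm a v) ` W)" by (rule bdd_aboveI2)
  have up: "\<bar>f v\<bar> / form_norm a v \<le> dual_norm W a f" if "v \<in> W" for v
    unfolding dual_norm_def by (rule cSUP_upper[OF that bdd])
  show "0 \<le> dual_norm W a f"
    using up[OF W0] n[OF W0] by (meson abs_ge_zero divide_nonneg_nonneg order_trans)
  show "f v \<le> dual_norm W a f * form_norm a v" if v: "v \<in> W"
  proof (cases "form_norm a v = 0")
    case True
    then show ?thesis using C[OF v] by simp
  next
    case False
    then have "0 < form_norm a v" using n[OF v] by simp
    then have "\<bar>f v\<bar> \<le> dual_norm W a f * form_norm a v" using up[OF v] by (simp add: divide_le_eq)
    then show ?thesis by linarith
  qed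
qed

theorem theorem6:
  fixes \<Omega> :: "(real^'n) set" and b :: "real^'n \<Rightarrow> real^'n"
    and Apar :: "real^'n \<Rightarrow> real" and Aperp :: "real^'n \<Rightarrow> real^'n^'n" and A0 A1 :: real
    and kind :: fe_kind and k :: nat
    and H :: "real set" and T :: "real \<Rightarrow> (real^'n) set set"
    and a ap :: "'n form" and Vh Lh :: "real \<Rightarrow> 'n field set" and \<beta> :: real
  assumes dim: "CARD('n) = 2 \<or> CARD('n) = 3"
    and domain: "regular_domain \<Omega>"
    and field: "unit_field \<Omega> b"
    and Gamma_D: "(top_of_set (frontier \<Omega>)) interior_of (Gamma_D \<Omega> b) \<noteq> {}"
    and field_lines: "field_lines_open \<Omega> b" "field_lines_enter \<Omega> b"
    and coeff: "coefficients \<Omega> b Apar Aperp A0 A1"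
    and a_def: "a = form_a \<Omega> b Apar Aperp"
    and ap_def: "ap = form_par \<Omega> b Apar"
    and degree: "k \<ge> 1"
    and mesh: "\<forall>h\<in>H. h > 0 \<and> fe_mesh kind \<Omega> (T h) \<and> mesh_size (T h) = h"
    and Vh_def: "\<And>h. Vh h = fe_space kind k \<Omega> b (T h)"
    and Lh_def: "\<And>h. Lh h = Vh h \<inter> space_Lin \<Omega> b"
    and beta: "\<beta> > 0"
      "\<forall>h\<in>H. \<forall>\<epsilon>\<in>{0..1}.
         inf_sup (Vh h \<times> Lh h) (X_norm a ap (Vh h) \<epsilon>) (form_C a ap \<epsilon>) \<ge> ereal \<beta>"
  shows "\<forall>h\<in>H.
     (\<forall>f. in_dual (space_V \<Omega> b) a f \<longrightarrow>
        (\<forall>\<epsilon>\<in>{0..1}.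
           (\<exists>!(u, q). discrete_solution a ap (Vh h) (Lh h) \<epsilon> f u q) \<and>
           (\<forall>u q. discrete_solution a ap (Vh h) (Lh h) \<epsilon> f u q \<longrightarrow>
              X_norm a ap (Vh h) \<epsilon> (u, q) \<le> 1 / \<beta> * dual_norm (space_V \<Omega> b) a f)) \<and>
        (\<forall>u q. (\<forall>\<epsilon>\<in>{0..1}. discrete_solution a ap (Vh h) (Lh h) \<epsilon> f (u \<epsilon>) (q \<epsilon>)) \<longrightarrow>
           ((\<lambda>\<epsilon>. X_norm a ap (Vh h) \<epsilon> (\<lambda>x. u \<epsilon> x - u 0 x, \<lambda>x. q \<epsilon> x - q 0 x)) \<longlongrightarrow> 0)
             (at_right 0))) \<and>
     (\<forall>N e M l. is_basis (Vh h) N e \<and> is_basis (Lh h) M l \<longrightarrow>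
        (\<exists>\<kappa>. \<forall>\<epsilon>\<in>{0..1}.
           invertible_mat (system_matrix a ap \<epsilon> N e M l) \<and>
           cond2 (system_matrix a ap \<epsilon> N e M l) \<le> \<kappa>))"
proof
  fix h assume h: "h \<in> H"
  interpret anisotropic_diffusion \<Omega> b Apar Aperp A0 A1
    using domain field coeff by unfold_locales (auto simp: regular_domain_def)
  have VH1: "Vh h \<subseteq> H1 \<Omega>"
    using fe_space_subset_V space_V_subset_H1 unfolding Vh_def by blast
  have V: "lin_closed (Vh h)" unfolding Vh_def by (rule fe_space_lin_closed)
  have L: "lin_closed (Lh h)"
    unfolding Lh_def by (intro lin_closed_Int V space_Lin_lin_closed smooth_b)
  interpret discrete_problem "Vh h" "Lh h" a ap \<beta>
  proof
    show "lin_closed (Vh h)" "lin_closed (Lh h)" by fact+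
    show "Lh h \<subseteq> Vh h" unfolding Lh_def by blast
    show "lin_on (Vh h) (\<lambda>u. a u w)" "lin_on (Vh h) (a w)" "lin_on (Vh h) (\<lambda>u. ap u w)"
      if "w \<in> Vh h" for w
      using VH1 that unfolding lin_on_def a_def ap_def
      by (auto intro!: form_a_lin_left form_a_lin_right form_par_lin_left)
    show "ap u v = ap v u" for u v unfolding ap_def by (rule form_par_sym)
    show "0 \<le> ap u u" for u unfolding ap_def by (rule form_par_nonneg)
    show "ap u u \<le> a u u" if "u \<in> Vh h" for u
      unfolding ap_def a_def using form_par_le_form_a VH1 that by blast
    show "\<beta> > 0" by fact
    show "ereal \<beta> \<le> inf_sup (Vh h \<times> Lh h) (X_norm a ap (Vh h) \<epsilon>) (form_C a ap \<epsilon>)" if "\<epsilon> \<in> {0..1}" for \<epsilon>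
      using beta(2) h that by blast
  qed
  have "fe_mesh kind \<Omega> (T h)" using mesh h by blast
  from fe_space_finite_span[OF this, of k b] obtain B
    where B0: "finite B \<and> (\<forall>v\<in>Vh h. \<exists>c. v = (\<lambda>x. \<Sum>w\<in>B. c w * w x))"
    unfolding Vh_def by (rule exE)
  have B: "finite B" "\<And>v. v \<in> Vh h \<Longrightarrow> \<exists>c. v = (\<lambda>x. \<Sum>w\<in>B. c w * w x)"
    using conjunct1[OF B0] bspec[OF conjunct2[OF B0]] by auto
  \<comment> \<open>Existence is proved through the system matrix, so some bases must be at hand;
    the spanning set of \<open>Vh h\<close> also serves its subset \<open>Lh h\<close>.\<close>
  obtain N e where e: "is_basis (Vh h) N e" using basis_of_finite_span[of B "Vh h", OF B] by auto
  obtain M l where l: "is_basis (Lh h) M l" using basis_of_finite_span[of B "Lh h", OF B(1) B(2)[OF LV']] by auto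
  have dual: "lin_on (Vh h) f" "0 \<le> dual_norm (space_V \<Omega> b) a f"
      "\<And>v. v \<in> Vh h \<Longrightarrow> f v \<le> dual_norm (space_V \<Omega> b) a f * form_norm a v"
    if f: "in_dual (space_V \<Omega> b) a f" for f
  proof -
    \<comment> \<open>\<open>f\<close> lives on the whole space; its restriction inherits linearity
      and the bound by the dual norm, a supremum over the larger set.\<close>
    have VV: "Vh h \<subseteq> space_V \<Omega> b" unfolding Vh_def by (rule fe_space_subset_V)
    show "lin_on (Vh h) f" using f VV unfolding in_dual_def lin_on_def by blast
    have "0 \<le> a v v" if "v \<in> space_V \<Omega> b" for v
      using order_trans[OF form_par_nonneg form_par_le_form_a] space_V_subset_H1 that unfolding a_def by blast
    note * = in_dual_bound[OF f this zero_space_V]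
    show "0 \<le> dual_norm (space_V \<Omega> b) a f" by (rule *(1))
    show "f v \<le> dual_norm (space_V \<Omega> b) a f * form_norm a v" if "v \<in> Vh h" for v
      using *(2) VV that by blast
  qed
  show "(\<forall>f. in_dual (space_V \<Omega> b) a f \<longrightarrow>
        (\<forall>\<epsilon>\<in>{0..1}.
           (\<exists>!(u, q). discrete_solution a ap (Vh h) (Lh h) \<epsilon> f u q) \<and>
           (\<forall>u q. discrete_solution a ap (Vh h) (Lh h) \<epsilon> f u q \<longrightarrow>
              X_norm a ap (Vh h) \<epsilon> (u, q) \<le> 1 / \<beta> * dual_norm (space_V \<Omega> b) a f)) \<and>
        (\<forall>u q. (\<forall>\<epsilon>\<in>{0..1}. discrete_solution a ap (Vh h) (Lh h) \<epsilon> f (u \<epsilon>) (q \<epsilon>)) \<longrightarrow>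
           ((\<lambda>\<epsilon>. X_norm a ap (Vh h) \<epsilon> (\<lambda>x. u \<epsilon> x - u 0 x, \<lambda>x. q \<epsilon> x - q 0 x)) \<longlongrightarrow> 0)
             (at_right 0))) \<and>
     (\<forall>N e M l. is_basis (Vh h) N e \<and> is_basis (Lh h) M l \<longrightarrow>
        (\<exists>\<kappa>. \<forall>\<epsilon>\<in>{0..1}.
           invertible_mat (system_matrix a ap \<epsilon> N e M l) \<and>
           cond2 (system_matrix a ap \<epsilon> N e M l) \<le> \<kappa>))"
  proof (intro conjI allI impI ballI)
    fix f and \<epsilon> :: real assume f: "in_dual (space_V \<Omega> b) a f" and \<epsilon>: "\<epsilon> \<in> {0..1}"
    obtain u q where uq: "discrete_solution a ap (Vh h) (Lh h) \<epsilon> f u q"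
      using solution_exists[OF e l \<epsilon> dual(1)[OF f]] by blast
    show "\<exists>!(u, q). discrete_solution a ap (Vh h) (Lh h) \<epsilon> f u q"
    proof (rule ex1I[of _ "(u, q)"])
      show "case (u, q) of (u, q) \<Rightarrow> discrete_solution a ap (Vh h) (Lh h) \<epsilon> f u q" using uq by simp
      fix y assume "case y of (u, q) \<Rightarrow> discrete_solution a ap (Vh h) (Lh h) \<epsilon> f u q"
      then show "y = (u, q)" using solution_unique[OF \<epsilon> _ uq] by (cases y) simp
    qed
    fix u q assume "discrete_solution a ap (Vh h) (Lh h) \<epsilon> f u q"
    from solution_bound[OF \<epsilon> this dual(2)[OF f] dual(3)[OF f]]
    show "X_norm a ap (Vh h) \<epsilon> (u, q) \<le> 1 / \<beta> * dual_norm (space_V \<Omega> b) a f" by simp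
  next
    fix f u q assume "\<forall>\<epsilon>\<in>{0..1}. discrete_solution a ap (Vh h) (Lh h) \<epsilon> f (u \<epsilon>) (q \<epsilon>)"
    then show "((\<lambda>\<epsilon>. X_norm a ap (Vh h) \<epsilon> (\<lambda>x. u \<epsilon> x - u 0 x, \<lambda>x. q \<epsilon> x - q 0 x)) \<longlongrightarrow> 0) (at_right 0)"
      by (intro solution_convergence) blast
  next
    \<comment> \<open>These bases are arbitrary, not the ones chosen above for existence.\<close>
    fix N e M l assume "is_basis (Vh h) N e \<and> is_basis (Lh h) M l"
    then show "\<exists>\<kappa>. \<forall>\<epsilon>\<in>{0..1}. invertible_mat (system_matrix a ap \<epsilon> N e M l) \<and>
        cond2 (system_matrix a ap \<epsilon> N e M l) \<le> \<kappa>"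
      using system_cond2_bounded by blast
  qed
qed

end
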